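(* Let $w$ be a word in the alphabet $\{1',1,\ldots,n',n\}$. For $i=1,\ldots,n-1$ let the $i$-th lattice walk of $w$ be the lattice walk of the subword of $w$ consisting of the letters $i',i,(i+1)',i+1$ (treated as $1',1,2',2$). Then $w$ is ballot if and only if each of its lattice walks ($i=1,\ldots,n-1$) ends on the $x$-axis; and $w$ is anti-ballot if and only if each of its lattice walks ends on the $y$-axis.
   Context: Words. Letters are $1'<1<2'<2<3'<3<\cdots$. The canonical form of a finite string of letters is obtained by replacing, for every $i$, the leftmost entry in $\{i,i'\}$ (if there is one) by $i$. Two strings are equivalent if they have the same canonical form; a word is an equivalence class of strings, its members are its representatives, and a word is identified with its representative in canonical form. The weight is $\mathrm{wt}(w)=(n_1,n_2,\ldots)$, where $n_i$ is the number of entries of $w$ equal to $i$ or $i'$. The standardization $\mathrm{std}(w)$ of a word of length $m$ is the permutation obtained by replacing its letters by $1,\ldots,m$ from least to greatest, breaking ties between equal unprimed letters from left to right and between equal primed letters from right to left (independent of the representative). Tableaux. A strict partition is a strictly decreasing finite (possibly empty) sequence $\lambda=(\lambda_1>\cdots>\lambda_k)$ of positive integers; its shifted diagram is the set of boxes $(r,c)$ (row $r$ counted from the top, column $c$ from the left) with $1\le r\le k$ and $r\le c\le r+\lambda_r-1$. A shifted skew shape $\lambda/\mu$ is the difference of two such diagrams, $\mu$ contained in $\lambda$; it is straight if $\mu=\varnothing$. A shifted semistandard tableau of shape $\lambda/\mu$ is a filling of the boxes by letters, weakly increasing along rows (left to right) and down columns, with no primed letter repeated in a row and no unprimed letter repeated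 in a column, whose row reading word (rows read left to right, concatenated from the bottom row to the top row) is in canonical form. $\mathrm{wt}(T)$ and $\mathrm{std}(T)$ are defined via the reading word. Jeu de taquin. An inner slide on a tableau $T$ of shape $\lambda/\mu$ starts at a box of $\mu$ whose removal from $\mu$ leaves a shifted diagram; the empty box is repeatedly exchanged with whichever of its right and lower neighbours is smaller (comparing entries of $\mathrm{std}(T)$) until it has neither. The result of a slide on $T$ is the unique shifted semistandard tableau with the same weight as $T$ whose standardization is the slid $\mathrm{std}(T)$ (this incorporates the usual rules for changing primes at the main diagonal and in passing to canonical form). $\mathrm{rect}(T)$ is the straight-shape tableau obtained by performing inner slides until none is possible (independent of choices); for a word $w$, $\mathrm{rect}(w)=\mathrm{rect}(T)$ for any shifted semistandard tableau $T$ with reading word $w$ (for example one whose boxes all lie in distinct rows and distinct columns). Ballot words. $w$ is ballot if for every $i$ the $i$-th row of $\mathrm{rect}(w)$ consists entirely of $i$'s. For a word $v$ in $\{1',1,2',2\}$ let $\eta(v)$ be the word obtained by replacing the letters of any representative of $v$ by $1'\mapsto2$, $1\mapsto2'$, $2'\mapsto1$, $2\mapsto1'$. A word $w$ in $\{1',1,\ldots,n',n\}$ is anti-ballot (opposite ballot) if for each $i=1,\ldots,n-1$ the word $\eta(w^{(i)})$ is ballot, where $w^{(i)}$ is the subword of letters $i',i,(i+1)',i+1$ treated as $1',1,2',2$. Lattice walk. For a word $w=w_1\cdots w_m$ in $\{1',1,2',2\}$ define $P_k=(x_k,y_k)\in\mathbb{N}\times\mathbb{N}$ by $P_0=(0,0)$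 and $P_k=P_{k-1}+(\text{step of } w_k)$. If $x_{k-1}y_{k-1}=0$ the step is $(1,0)$ for $w_k\in\{1',1\}$ and $(0,1)$ for $w_k\in\{2',2\}$. If $x_{k-1}y_{k-1}\ne0$ the step is $(1,0)$ for $1'$, $(0,-1)$ for $1$, $(-1,0)$ for $2'$, $(0,1)$ for $2$. (Independent of the representative.) The walk ends at $P_m$; it ends on the $x$-axis if $y_m=0$ and on the $y$-axis if $x_m=0$. *)

theory Defs
  imports Main
begin

section \<open>Letters and words\<close>

text \<open>\<open>Letter i True\<close> is \<open>i'\<close> and \<open>Letter i False\<close> is \<open>i\<close>; genuine letters have
  \<open>i \<ge> 1\<close>, which \<open>alphabet\<close> and \<open>tableau\<close> enforce.\<close>

datatype letter = Letter (index: nat) (primed: bool)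

instantiation letter :: linorder
begin

definition less_eq_letter :: "letter \<Rightarrow> letter \<Rightarrow> bool" where
  "a \<le> b \<longleftrightarrow> index a < index b \<or> (index a = index b \<and> (primed b \<longrightarrow> primed a))"

definition less_letter :: "letter \<Rightarrow> letter \<Rightarrow> bool" where
  "a < b \<longleftrightarrow> index a < index b \<or> (index a = index b \<and> primed a \<and> \<not> primed b)"

instance
  by standard (auto simp: less_eq_letter_def less_letter_def intro: letter.expand)

end

definition alphabet :: "nat \<Rightarrow> letter set" where
  "alphabet n = {a. 1 \<le> index a \<and> index a \<le> n}"

definition canon :: "letter list \<Rightarrow> letter list" where
  "canon w = map (\<lambda>k. if \<exists>j<k. index (w ! j) = index (w ! k) then w ! k
                      else Letter (index (w ! k)) False) [0..<length w]"

text \<open>A word is represented by the canonical member of its equivalence class of strings.\<close>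

definition words :: "nat \<Rightarrow> letter list set" where
  "words n = {w. set w \<subseteq> alphabet n \<and> canon w = w}"

definition wt :: "letter list \<Rightarrow> nat \<Rightarrow> nat" where
  "wt w i = length (filter (\<lambda>a. index a = i) w)"

definition std_before :: "letter list \<Rightarrow> nat \<Rightarrow> nat \<Rightarrow> bool" where
  "std_before w j k \<longleftrightarrow> w ! j < w ! k \<or>
     (w ! j = w ! k \<and> (if primed (w ! k) then k < j else j < k))"

definition std :: "letter list \<Rightarrow> nat list" where
  "std w = map (\<lambda>k. Suc (card {j. j < length w \<and> std_before w j k})) [0..<length w]"

section \<open>Shifted tableaux\<close>

type_synonym box = "nat \<times> nat"

definition strict_partition :: "nat list \<Rightarrow> bool" where
  "strict_partition lam \<longleftrightarrow> sorted_wrt (>) lam \<and> 0 \<notin> set lam"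

definition part :: "nat list \<Rightarrow> nat \<Rightarrow> nat" where
  "part lam r = (if 1 \<le> r \<and> r \<le> length lam then lam ! (r - 1) else 0)"

definition diagram :: "nat list \<Rightarrow> box set" where
  "diagram lam = {(r, c). 1 \<le> r \<and> r \<le> length lam \<and> r \<le> c \<and> c < r + part lam r}"

text \<open>\<open>Filling \<lambda> \<mu> f\<close> is a filling of the skew shape \<open>\<lambda>/\<mu>\<close>; \<open>f b = None\<close> off the shape.
  The pair \<open>(\<lambda>, \<mu>)\<close> is kept because slides start at boxes of \<open>\<mu>\<close>.\<close>

datatype 'a filling = Filling (outer: "nat list") (inner: "nat list") (entry: "box \<Rightarrow> 'a option")

definition skew_filling :: "'a filling \<Rightarrow> bool" where
  "skew_filling T \<longleftrightarrow> strict_partition (outer T) \<and> strict_partition (inner T) \<and>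
     diagram (inner T) \<subseteq> diagram (outer T) \<and>
     dom (entry T) = diagram (outer T) - diagram (inner T)"

text \<open>The boxes of the shape, rows from bottom to top, each row from left to right.\<close>

definition reading_boxes :: "'a filling \<Rightarrow> box list" where
  "reading_boxes T =
     concat (map (\<lambda>r. map (Pair r) [r + part (inner T) r ..< r + part (outer T) r])
                 (rev [1 ..< Suc (length (outer T))]))"

definition reading_word :: "'a filling \<Rightarrow> 'a list" where
  "reading_word T = map (\<lambda>b. the (entry T b)) (reading_boxes T)"

definition tableau :: "letter filling \<Rightarrow> bool" where
  "tableau T \<longleftrightarrow> skew_filling T \<and>
     (\<forall>a \<in> ran (entry T). 1 \<le> index a) \<and>
     (\<forall>r c c' a b. c < c' \<and> entry T (r, c) = Some a \<and> entry T (r, c') = Some b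
        \<longrightarrow> a \<le> b \<and> (a = b \<longrightarrow> \<not> primed a)) \<and>
     (\<forall>r r' c a b. r < r' \<and> entry T (r, c) = Some a \<and> entry T (r', c) = Some b
        \<longrightarrow> a \<le> b \<and> (a = b \<longrightarrow> primed a)) \<and>
     canon (reading_word T) = reading_word T"

definition std_entries :: "letter filling \<Rightarrow> box \<Rightarrow> nat option" where
  "std_entries T = map_of (zip (reading_boxes T) (std (reading_word T)))"

section \<open>Jeu de taquin\<close>

text \<open>\<open>jdt_path S e S' e'\<close>: starting from the filling \<open>S\<close> with empty box \<open>e\<close>, exchanging the
  empty box with the smaller of its right and lower neighbours for as long as there is one
  yields the filling \<open>S'\<close> with empty box \<open>e'\<close>.\<close>

inductive jdt_path :: "(box \<Rightarrow> nat option) \<Rightarrow> box \<Rightarrow> (box \<Rightarrow> nat option) \<Rightarrow> box \<Rightarrow> bool" where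
  stop: "S (r, c + 1) = None \<Longrightarrow> S (r + 1, c) = None \<Longrightarrow> jdt_path S (r, c) S (r, c)"
| right: "S (r, c + 1) = Some x \<Longrightarrow> (\<forall>y. S (r + 1, c) = Some y \<longrightarrow> x < y) \<Longrightarrow>
    jdt_path (S((r, c) := Some x, (r, c + 1) := None)) (r, c + 1) S' e' \<Longrightarrow>
    jdt_path S (r, c) S' e'"
| down: "S (r + 1, c) = Some x \<Longrightarrow> (\<forall>y. S (r, c + 1) = Some y \<longrightarrow> x < y) \<Longrightarrow>
    jdt_path (S((r, c) := Some x, (r + 1, c) := None)) (r + 1, c) S' e' \<Longrightarrow>
    jdt_path S (r, c) S' e'"

text \<open>\<open>T'\<close> is the result of an inner slide on the tableau \<open>T\<close>, starting at the corner \<open>e\<close> of the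
  inner shape and ending at the box \<open>e'\<close>, which leaves the outer shape.\<close>

definition inner_slide :: "letter filling \<Rightarrow> letter filling \<Rightarrow> bool" where
  "inner_slide T T' \<longleftrightarrow> tableau T \<and> tableau T' \<and>
     (\<exists>e e'. e \<in> diagram (inner T) \<and> diagram (inner T') = diagram (inner T) - {e} \<and>
        diagram (outer T') = diagram (outer T) - {e'} \<and>
        jdt_path (std_entries T) e (std_entries T') e') \<and>
     wt (reading_word T') = wt (reading_word T)"

text \<open>The rectification of a word does not depend on the tableau \<open>T\<close> with reading word \<open>w\<close>
  nor on the slides performed, so the choice operator only picks the unique candidate.\<close>

definition rect :: "letter list \<Rightarrow> letter filling" where
  "rect w = (SOME R. \<exists>T. tableau T \<and> reading_word T = w \<and> inner_slide\<^sup>*\<^sup>* T R \<and> inner R = [])"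

section \<open>Ballot words and lattice walks\<close>

definition ballot :: "letter list \<Rightarrow> bool" where
  "ballot w \<longleftrightarrow> (\<forall>i c a. entry (rect w) (i, c) = Some a \<longrightarrow> a = Letter i False)"

text \<open>The subword of the letters \<open>i', i, (i+1)', i+1\<close>, relabelled \<open>1', 1, 2', 2\<close>.\<close>

definition pair_subword :: "nat \<Rightarrow> letter list \<Rightarrow> letter list" where
  "pair_subword i w =
     map (\<lambda>a. Letter (index a + 1 - i) (primed a)) (filter (\<lambda>a. index a \<in> {i, i + 1}) w)"

text \<open>On letters \<open>eta\<close> is \<open>1' \<mapsto> 2\<close>, \<open>1 \<mapsto> 2'\<close>, \<open>2' \<mapsto> 1\<close>, \<open>2 \<mapsto> 1'\<close>; the resulting string
  need not be in canonical form.\<close>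

definition eta :: "letter list \<Rightarrow> letter list" where
  "eta v = canon (map (\<lambda>a. Letter (if index a = 1 then 2 else 1) (\<not> primed a)) v)"

definition anti_ballot :: "nat \<Rightarrow> letter list \<Rightarrow> bool" where
  "anti_ballot n w \<longleftrightarrow> (\<forall>i \<in> {1..<n}. ballot (eta (pair_subword i w)))"

text \<open>Both subtractions are from positive coordinates, so they do not truncate.\<close>

fun walk_step :: "nat \<times> nat \<Rightarrow> letter \<Rightarrow> nat \<times> nat" where
  "walk_step (x, y) a =
     (if x * y = 0 then (if index a = 1 then (x + 1, y) else (x, y + 1))
      else if index a = 1 then (if primed a then (x + 1, y) else (x, y - 1))
      else (if primed a then (x - 1, y) else (x, y + 1)))"

definition walk_end :: "letter list \<Rightarrow> nat \<times> nat" where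
  "walk_end w = foldl walk_step (0, 0) w"

end

theory Submission
  imports Defs
begin

text \<open>The end point of each lattice walk of the reading word is an invariant of jeu de taquin, so
  only tableaux of straight shape matter. A slide is followed box by box, keeping the numbers of
  the standardization and the letters they stand for. A move within a row does not change the
  reading word. A move from row \<open>r + 1\<close> up to row \<open>r\<close> turns \<open>A x B C D\<close> into \<open>A B C x D\<close>, which is a
  composition of Knuth relations in the semistandard sense, and each of these preserves the map
  that a word in \<open>1', 1, 2', 2\<close> induces on positions of the walk. The exception is a row \<open>r\<close> that
  starts on the diagonal: then \<open>C\<close> has one letter more than \<open>A\<close>, but the walk is still on
  the \<open>y\<close>-axis before these two rows, and the end points are compared directly; this
  also covers the removal of a prime on the diagonal.

  If the walk of a tableau of straight shape ends on the \<open>x\<close>-axis, then no letter \<open>i + 1\<close> is read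
  after the last \<open>i\<close>, which forces all \<open>i + 1\<close> into row \<open>i + 1\<close> by induction on \<open>i\<close>. Conversely, if
  row \<open>i\<close> consists of \<open>i\<close>'s, the strict decrease of the row lengths brings the walk to the \<open>x\<close>-axis.
  Finally, \<open>eta\<close> reflects
  the walk in the diagonal, which turns anti-ballot words into ballot words.\<close>

section \<open>Walk equivalence and Knuth relations\<close>

text \<open>The definition of a slide fixes its result only through the standardization and the
  weight, and between two moves the filling has an empty box, so it is no tableau. Hence the numbers
  are moved, while a labelling \<open>l\<close> by letters is carried along and shown to have these
  numbers as its standardization; a canonical word is recovered from standardization and weight, so
  the letters found in this way are the right ones. The obstacle is the diagonal. Equality of the
  maps induced on all positions is stable under concatenation, but it can fail there:
  \<open>2' 1\<close> and \<open>1 2'\<close> both lead from (0,0) to (1,1), whereas from (0,1) they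
  lead to (1,2) and (0,1). An upward move into a row that starts on the diagonal is therefore
  compared along the walk from the origin, and this needs control of everything read earlier: when
  such a move is made, the diagonal entry has smaller index than all entries of lower rows, except
  in the one configuration in which a prime is lost.\<close>

definition pair_step :: "nat \<Rightarrow> nat \<times> nat \<Rightarrow> letter \<Rightarrow> nat \<times> nat" where
  "pair_step i s a = (if index a = i \<or> index a = Suc i
     then walk_step s (Letter (index a + 1 - i) (primed a)) else s)"

text \<open>Since all other letters act as the identity, the walk of the subword is a fold over the
  whole word. Slides can then be followed on the full tableau, for all \<open>i\<close> at once,
  without relating them to slides of the part with two indices.\<close>

lemma walk_pair_subword: "foldl walk_step s (pair_subword i w) = foldl (pair_step i) s w"
  by (induction w arbitrary: s) (auto simp: pair_subword_def pair_step_def)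

text \<open>An \<open>a\<close> read before a \<open>b\<close> gets the smaller number in the
  standardization exactly if \<open>row_le a b\<close>; an \<open>a\<close> read after a
  \<open>b\<close> does exactly if \<open>col_le a b\<close>. So the two relations are the
  tie-breaking rule as well as the conditions on rows and columns.\<close>

definition row_le :: "letter \<Rightarrow> letter \<Rightarrow> bool" where
  "row_le a b \<longleftrightarrow> a < b \<or> (a = b \<and> \<not> primed a)"

definition col_le :: "letter \<Rightarrow> letter \<Rightarrow> bool" where
  "col_le a b \<longleftrightarrow> a < b \<or> (a = b \<and> primed a)"

text \<open>Quantifying over all positions, not only those reached from the origin, makes this a
  congruence for concatenation, so that local rewriting is sound inside any word.\<close>

definition walk_equiv :: "nat \<Rightarrow> letter list \<Rightarrow> letter list \<Rightarrow> bool" where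
  "walk_equiv i u v \<longleftrightarrow> (\<forall>s. foldl (pair_step i) s u = foldl (pair_step i) s v)"

lemma walk_equiv_refl [simp]: "walk_equiv i u u"
  by (simp add: walk_equiv_def)

lemma walk_equiv_sym: "walk_equiv i u v \<Longrightarrow> walk_equiv i v u"
  by (simp add: walk_equiv_def)

lemma walk_equiv_trans [trans]: "walk_equiv i u v \<Longrightarrow> walk_equiv i v w \<Longrightarrow> walk_equiv i u w"
  by (simp add: walk_equiv_def)

lemma walk_equiv_append: "walk_equiv i u u' \<Longrightarrow> walk_equiv i v v' \<Longrightarrow> walk_equiv i (u @ v) (u' @ v')"
  unfolding walk_equiv_def foldl_append by metis

lemma walk_equiv_cons: "walk_equiv i u v \<Longrightarrow> walk_equiv i (a # u) (a # v)"
  unfolding walk_equiv_def foldl_Cons by metis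

lemma pair_step_simps [simp]:
  "pair_step i (x, y) (Letter k p) =
     (if k = i then (if x * y = 0 \<or> p then (x + 1, y) else (x, y - 1))
      else if k = Suc i then (if x * y = 0 \<or> \<not> p then (x, y + 1) else (x - 1, y))
      else (x, y))"
  by (auto simp: pair_step_def)

declare walk_step.simps [simp del]

lemma pair_step_id [simp]: "index a \<noteq> i \<Longrightarrow> index a \<noteq> Suc i \<Longrightarrow> pair_step i s a = s"
  by (simp add: pair_step_def)

lemma letter_cases:
  obtains "a = Letter i True" | "a = Letter i False" | "a = Letter (Suc i) True" | "a = Letter (Suc i) False"
    | "index a \<noteq> i" "index a \<noteq> Suc i"
  by (cases a) (metis (full_types) letter.sel(1))

lemma nat_cases_01:
  obtains "n = (0::nat)" | "n = 1" | m where "n = Suc (Suc m)"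
  by (metis One_nat_def nat.exhaust)

text \<open>The Knuth relation \<open>x z y ~ z x y\<close> for x < y < z, with ties resolved by
  position. It is a finite check: letters of other indices act trivially, and the coordinates 0 and
  1 are split off because steps on an axis and steps that reach one behave differently.\<close>

lemma knuth_low:
  assumes "row_le a b" "col_le b c"
  shows "walk_equiv i [a, c, b] [c, a, b]"
proof -
  have "foldl (pair_step i) (p, q) [a, c, b] = foldl (pair_step i) (p, q) [c, a, b]" for p q
    using assms
    by (cases a rule: letter_cases[of _ i]; cases b rule: letter_cases[of _ i];
        cases c rule: letter_cases[of _ i]; simp add: row_le_def col_le_def less_letter_def;
        (cases p rule: nat_cases_01; cases q rule: nat_cases_01; auto)?)
  then show ?thesis by (simp add: walk_equiv_def)
qed

text \<open>The Knuth relation \<open>y x z ~ y z x\<close> for x < y < z, by the same finite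
  check.\<close>

lemma knuth_high:
  assumes "col_le a b" "row_le b c"
  shows "walk_equiv i [b, a, c] [b, c, a]"
proof -
  have "foldl (pair_step i) (p, q) [b, a, c] = foldl (pair_step i) (p, q) [b, c, a]" for p q
    using assms
    by (cases a rule: letter_cases[of _ i]; cases b rule: letter_cases[of _ i];
        cases c rule: letter_cases[of _ i]; simp add: row_le_def col_le_def less_letter_def;
        (cases p rule: nat_cases_01; cases q rule: nat_cases_01; auto)?)
  then show ?thesis by (simp add: walk_equiv_def)
qed

lemma col_row_less: "col_le a b \<Longrightarrow> row_le b c \<Longrightarrow> a < c"
  by (auto simp: row_le_def col_le_def)

lemma row_col_less: "row_le a b \<Longrightarrow> col_le b c \<Longrightarrow> a < c"
  by (auto simp: row_le_def col_le_def)

text \<open>The letter \<open>a\<close> travels left through the row by \<open>knuth_high\<close>;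
  the pivot for passing a letter is the letter in front of it. So \<open>a\<close> stops right
  behind \<open>y\<close>, which has no pivot.\<close>

lemma knuth_insert:
  assumes "col_le a y" "sorted_wrt row_le (y # B)"
  shows "walk_equiv i (y # B @ [a]) (y # a # B)"
  using assms
proof (induction B arbitrary: y)
  case Nil
  then show ?case by simp
next
  case (Cons b B)
  have "row_le y b" using Cons.prems by simp
  then have ab: "col_le a b" using col_row_less[OF Cons.prems(1)] by (auto simp: col_le_def)
  have "walk_equiv i (y # (b # B @ [a])) (y # (b # a # B))"
    by (rule walk_equiv_cons, rule Cons.IH[OF ab]) (use Cons.prems(2) in simp)
  also have "walk_equiv i (y # (b # a # B)) (y # a # b # B)"
    using walk_equiv_append[OF walk_equiv_sym[OF knuth_high[OF Cons.prems(1) \<open>row_le y b\<close>]] walk_equiv_refl[of i B]]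
    by simp
  finally show ?case by simp
qed

text \<open>For \<open>x\<close> to cross \<open>b\<close> a letter between them is needed as pivot.
  The \<open>d\<close> above \<open>b\<close> is borrowed from the front of \<open>D\<close>,
  brought behind \<open>b\<close> by \<open>knuth_insert\<close>, used in \<open>knuth_low\<close>,
  and sent back.\<close>

lemma knuth_row_right:
  assumes "sorted_wrt row_le B" "sorted_wrt row_le (x # D)" "length B \<le> length D"
    "\<And>j. j < length B \<Longrightarrow> col_le (D ! j) (B ! j)"
  shows "walk_equiv i (x # B @ D) (B @ x # D)"
  using assms
proof (induction B arbitrary: x D)
  case Nil
  then show ?case by simp
next
  case (Cons b B)
  from Cons.prems(3) obtain d D' where D: "D = d # D'" by (cases D) auto
  have db: "col_le d b" using Cons.prems(4)[of 0] D by simp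
  have col: "col_le (D' ! j) (B ! j)" if "j < length B" for j
    using Cons.prems(4)[of "Suc j"] D that by simp
  have xd: "row_le x d" using Cons.prems(2) D by simp
  \<comment> \<open>All of \<open>D\<close> now faces the tail of the row, whose entries lie one
    column further right, so the column inequality becomes strict.\<close>
  have col2: "col_le (D ! j) (B ! j)" if "j < length B" for j
  proof -
    have "row_le ((b # B) ! j) ((b # B) ! Suc j)"
      using Cons.prems(1) that sorted_wrt_nth_less[of row_le "b # B" j "Suc j"] by simp
    then have "D ! j < B ! j" using col_row_less Cons.prems(4)[of j] that by auto
    then show ?thesis by (simp add: col_le_def)
  qed
  have "walk_equiv i (x # (b # B @ [d]) @ D') (x # (b # d # B) @ D')"
    using Cons.prems(1) by (intro walk_equiv_cons walk_equiv_append knuth_insert db) auto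
  also have "walk_equiv i (x # (b # d # B) @ D') (b # x # d # B @ D')"
    using walk_equiv_append[OF knuth_low[OF xd db] walk_equiv_refl[of i "B @ D'"]] by simp
  \<comment> \<open>The returning \<open>d\<close> crosses the rest of \<open>B\<close>: this is the
    same statement with \<open>d\<close> for \<open>x\<close> and \<open>D'\<close> for
    \<open>D\<close>, which is why both are arbitrary in the induction.\<close>
  also have "walk_equiv i (b # x # d # B @ D') (b # x # B @ d # D')"
    using Cons.prems D by (intro walk_equiv_cons Cons.IH col) auto
  also have "walk_equiv i (b # x # B @ d # D') (b # B @ x # d # D')"
    using Cons.prems D col2 by (intro walk_equiv_cons Cons.IH) auto
  finally show ?case by (simp add: D)
qed

text \<open>The reading of a two-row array by columns, each from bottom to top: the common normal
  form in which \<open>x\<close> no longer meets \<open>C\<close>.\<close>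

fun interleave :: "'a list \<Rightarrow> 'a list \<Rightarrow> 'a list" where
  "interleave (a # A) (c # C) = a # c # interleave A C"
| "interleave A C = A"

text \<open>Each \<open>c\<close> moves left by \<open>knuth_insert\<close> until it stands behind
  the entry below it. \<open>X\<close> is arbitrary because this is applied both with
  \<open>x\<close> in the lower row and with \<open>x\<close> removed.\<close>

lemma knuth_row_left:
  assumes "list_all2 col_le C A" "sorted_wrt row_le (A @ X)"
  shows "walk_equiv i (A @ X @ C) (interleave A C @ X)"
  using assms
proof (induction C A rule: list_all2_induct)
  case Nil
  then show ?case by simp
next
  case (Cons c C a A)
  have "walk_equiv i ((a # (A @ X) @ [c]) @ C) ((a # c # (A @ X)) @ C)"
    using Cons by (intro walk_equiv_append knuth_insert) auto
  also have "walk_equiv i ((a # c # (A @ X)) @ C) (a # c # interleave A C @ X)"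
    using Cons by (simp add: walk_equiv_cons)
  finally show ?case by simp
qed

text \<open>\<open>C\<close> is absorbed into \<open>A\<close> column by column, \<open>x\<close>
  crosses \<open>B\<close> with \<open>D\<close> directly behind it, and \<open>C\<close> is
  released again. The equal lengths of \<open>A\<close> and \<open>C\<close> are what fails for a
  row that starts on the diagonal.\<close>

lemma knuth_slide_up:
  assumes "list_all2 col_le C A" "sorted_wrt row_le (A @ x # B)"
    "sorted_wrt row_le (x # D)" "length B \<le> length D"
    "\<And>j. j < length B \<Longrightarrow> col_le (D ! j) (B ! j)"
  shows "walk_equiv i (A @ x # B @ C @ D) (A @ B @ C @ x # D)"
proof -
  have "walk_equiv i ((A @ (x # B) @ C) @ D) ((interleave A C @ x # B) @ D)"
    using assms(1,2) by (intro walk_equiv_append knuth_row_left) auto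
  also have "walk_equiv i ((interleave A C @ x # B) @ D) (interleave A C @ B @ x # D)"
    using assms(2-) by (simp add: sorted_wrt_append walk_equiv_append knuth_row_right)
  also have "walk_equiv i (interleave A C @ B @ x # D) ((A @ B @ C) @ x # D)"
    using walk_equiv_append[OF walk_equiv_sym[OF knuth_row_left[OF assms(1), of B i]] walk_equiv_refl[of i "x # D"]]
      assms(2) by (simp add: sorted_wrt_append)
  finally show ?thesis by simp
qed

section \<open>Walks starting at the origin\<close>

lemma walk_inert:
  "(\<And>a. a \<in> set W \<Longrightarrow> index a \<noteq> i \<and> index a \<noteq> Suc i) \<Longrightarrow> foldl (pair_step i) s W = s"
  by (induction W) auto

lemma walk_y_axis:
  "(\<And>a. a \<in> set W \<Longrightarrow> index a \<noteq> i) \<Longrightarrow>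
    foldl (pair_step i) (0, t) W = (0, t + length (filter (\<lambda>a. index a = Suc i) W))"
proof (induction W arbitrary: t)
  case (Cons a W)
  then show ?case using Cons.prems[of a] by (cases a rule: letter_cases[of _ i]) auto
qed simp

lemma walk_up:
  "(\<And>a. a \<in> set W \<Longrightarrow> index a \<noteq> i \<and> a \<noteq> Letter (Suc i) True) \<Longrightarrow>
    foldl (pair_step i) (x, y) W = (x, y + length (filter (\<lambda>a. index a = Suc i) W))"
proof (induction W arbitrary: y)
  case (Cons a W)
  then show ?case using Cons.prems[of a] by (cases a rule: letter_cases[of _ i]) auto
qed simp

text \<open>Only the first letter of the row can be \<open>(i+1)'\<close>, and on the x-axis it
  moves up like an unprimed one; so the abscissa never changes.\<close>

lemma walk_from_x_axis:
  assumes "sorted_wrt row_le B" "\<And>b. b \<in> set B \<Longrightarrow> Suc i \<le> index b" "x > 0"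
  shows "foldl (pair_step i) (x, 0) B = (x, length (filter (\<lambda>a. index a = Suc i) B))"
proof (cases B)
  case (Cons b B')
  have *: "index a \<noteq> i \<and> a \<noteq> Letter (Suc i) True" if "a \<in> set B'" for a
  proof -
    have "row_le b a" "Suc i \<le> index b" "Suc i \<le> index a"
      using assms that Cons by auto
    then show ?thesis by (cases a; cases b) (auto simp: row_le_def less_letter_def)
  qed
  have "index b \<noteq> i" using assms(2)[of b] Cons by simp
  then show ?thesis
    using walk_up[OF *] assms(3) Cons by (cases b rule: letter_cases[of _ i]) auto
qed simp

text \<open>The letters \<open>C\<close> come from a row above a row of \<open>i + 1\<close>'s of the same length.\<close>
lemma walk_shift_right:
  assumes "sorted_wrt row_le C" "\<And>c. c \<in> set C \<Longrightarrow> c = Letter i False \<or> c = Letter (Suc i) True"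
  shows "foldl (pair_step i) (1, Suc (length C)) C =
    foldl (pair_step i) (1, length C) (C @ [Letter (Suc i) False])"
  using assms
proof (induction C)
  case Nil
  then show ?case by simp
next
  case (Cons c C)
  show ?case
  proof (cases "c = Letter i False")
    case True
    then show ?thesis using Cons by simp
  next
    case False
    then have c: "c = Letter (Suc i) True" using Cons.prems(2) by auto
    have "C = []"
    proof (rule ccontr)
      assume "C \<noteq> []"
      then obtain d where "d \<in> set C" by (cases C) auto
      then have "row_le c d" "d = Letter i False \<or> d = Letter (Suc i) True"
        using Cons.prems by auto
      then show False using c by (auto simp: row_le_def less_letter_def)
    qed
    then show ?thesis using c by simp
  qed
qed

text \<open>Letters \<open>i\<close> lower both walks in parallel until they are at (2,1) and (1,0).
  There \<open>i\<close> sends both to (2,0) and \<open>(i+1)'\<close> sends both to (1,1). An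
  earlier \<open>(i+1)'\<close> is impossible, since in a row it can be followed neither by
  \<open>i\<close> nor by itself.\<close>

lemma walk_merge:
  assumes "sorted_wrt row_le D" "q < length D"
    "\<And>j. j \<le> q \<Longrightarrow> D ! j = Letter i False \<or> D ! j = Letter (Suc i) True"
  shows "foldl (pair_step i) (2, Suc q) D = foldl (pair_step i) (1, q) D"
  using assms
proof (induction D arbitrary: q)
  case Nil
  then show ?case by simp
next
  case (Cons d D)
  show ?case
  proof (cases "d = Letter i False")
    case True
    show ?thesis
    proof (cases q)
      case 0
      then show ?thesis using True by (simp add: numeral_2_eq_2)
    next
      case (Suc p)
      have "D ! j = Letter i False \<or> D ! j = Letter (Suc i) True" if "j \<le> p" for j
        using Cons.prems(3)[of "Suc j"] Suc that by simp
      then have "foldl (pair_step i) (2, Suc p) D = foldl (pair_step i) (1, p) D"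
        using Cons.prems(1,2) Suc by (intro Cons.IH) simp_all
      then show ?thesis using True Suc by simp
    qed
  next
    case False
    then have d: "d = Letter (Suc i) True" using Cons.prems(3)[of 0] by auto
    have "q = 0"
    proof (rule ccontr)
      assume "q \<noteq> 0"
      then obtain e D' where D: "D = e # D'" using Cons.prems(2) by (cases D) auto
      have "e = Letter i False \<or> e = Letter (Suc i) True"
        using Cons.prems(3)[of 1] \<open>q \<noteq> 0\<close> D by simp
      moreover have "row_le d e" using Cons.prems(1) D by simp
      ultimately show False using d by (auto simp: row_le_def less_letter_def)
    qed
    then show ?thesis using d by simp
  qed
qed

text \<open>\<open>c0\<close> is the diagonal entry and \<open>W\<close> the part read before the
  two rows. If \<open>x\<close> has index \<open>i + 1\<close>, then \<open>B\<close> is inert, as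
  each of its entries lies right and then down from \<open>x\<close>. For a primed \<open>x\<close>
  both \<open>A\<close> and \<open>C\<close> are empty, and the two sides reach (1,1). For an
  unprimed \<open>x\<close>, \<open>A\<close> consists of letters of index \<open>i + 1\<close> and
  only climbs the y-axis; delaying \<open>x\<close> past \<open>C\<close> is then
  \<open>walk_shift_right\<close>.\<close>

lemma walk_slide_up_diagonal:
  assumes W: "\<And>a. a \<in> set W \<Longrightarrow> Suc i < index a"
    and low: "\<And>a. a \<in> set A \<Longrightarrow> Suc i \<le> index a" "Suc i \<le> index x"
    and c0: "index c0 = i"
    and CA: "list_all2 col_le C A"
    and sorted: "sorted_wrt row_le (A @ x # B)" "sorted_wrt row_le (c0 # C @ x # D)"
    and BD: "length B \<le> length D" "\<And>j. j < length B \<Longrightarrow> col_le (D ! j) (B ! j)"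
  shows "foldl (pair_step i) (0, 0) (W @ A @ x # B @ c0 # C @ D) =
    foldl (pair_step i) (0, 0) (W @ A @ B @ c0 # C @ x # D)"
proof (cases "index x = Suc i")
  case False
  then show ?thesis using low(2) by simp
next
  case x: True
  have W0: "foldl (pair_step i) (0, 0) W = (0, 0)"
    using W by (intro walk_inert) force
  have inert: "index b \<noteq> i \<and> index b \<noteq> Suc i" if "row_le x d" "col_le d b" for d b
    using that x by (cases b; cases x; cases d) (auto simp: row_le_def col_le_def less_letter_def)
  have B0: "foldl (pair_step i) s B = s" for s
  proof (rule walk_inert)
    fix b assume "b \<in> set B"
    then obtain j where j: "j < length B" "B ! j = b" by (metis in_set_conv_nth)
    then have "D ! j \<in> set D" using BD(1) by simp
    then have "row_le x (D ! j)" using sorted(2) by (simp add: sorted_wrt_append)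
    then show "index b \<noteq> i \<and> index b \<noteq> Suc i" using inert BD(2)[OF j(1)] j(2) by blast
  qed
  show ?thesis
  proof (cases "primed x")
    case True
    have "A = []"
    proof (rule ccontr)
      assume "A \<noteq> []"
      then obtain a where "a \<in> set A" by (cases A) auto
      then have "row_le a x" "Suc i \<le> index a" using sorted low by (auto simp: sorted_wrt_append)
      then show False using True x by (cases a; cases x) (auto simp: row_le_def less_letter_def)
    qed
    with CA have "C = []" by simp
    with \<open>A = []\<close> True x c0 show ?thesis
      by (cases x; cases c0) (simp add: W0 B0)
  next
    case False
    have A: "index a = Suc i" if "a \<in> set A" for a
    proof -
      have "row_le a x" "Suc i \<le> index a" using sorted low that by (auto simp: sorted_wrt_append)
      then show ?thesis using x by (cases a; cases x) (auto simp: row_le_def less_letter_def)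
    qed
    have C: "c = Letter i False \<or> c = Letter (Suc i) True" if "c \<in> set C" for c
    proof -
      obtain j where j: "j < length C" "C ! j = c" using \<open>c \<in> set C\<close> by (auto simp: in_set_conv_nth)
      obtain a where a: "A ! j = a" by simp
      have "col_le c a" "a \<in> set A" using CA j a by (auto simp: list_all2_conv_all_nth)
      moreover have "row_le c0 c" using sorted(2) that by simp
      ultimately show ?thesis using A[of a] c0
        by (cases a; cases c; cases c0) (auto simp: row_le_def col_le_def less_letter_def)
    qed
    have A0: "foldl (pair_step i) (0, 0) A = (0, length C)"
    proof -
      have "filter (\<lambda>a. index a = Suc i) A = A" using A by simp
      moreover have "foldl (pair_step i) (0, 0) A = (0, 0 + length (filter (\<lambda>a. index a = Suc i) A))"
        using A by (intro walk_y_axis) auto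
      ultimately show ?thesis using list_all2_lengthD[OF CA] by simp
    qed
    have xL: "x = Letter (Suc i) False" using x False by (cases x) simp
    have "foldl (pair_step i) (1, Suc (length C)) C = pair_step i (foldl (pair_step i) (1, length C) C) x"
      using walk_shift_right[of C i] C sorted(2) xL by (simp add: sorted_wrt_append)
    then show ?thesis using xL c0 by (cases c0) (simp add: W0 B0 A0)
  qed
qed

text \<open>If \<open>W\<close> contains an \<open>i + 1\<close>, the walk is at (0,t) with t > 0
  afterwards; on the left the head of \<open>B\<close> takes back the step of the first
  \<open>i\<close>, on the right the second \<open>i\<close> takes back the step of that head, and
  the positions agree. Otherwise let \<open>m\<close> be the number of letters of index
  \<open>i + 1\<close> in \<open>B\<close>. For m > 0 the sides are at (2,m) and (1,m-1) before
  \<open>D\<close>, and only \<open>D\<close> brings them together.\<close>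

lemma walk_slide_up_unprime:
  assumes W: "\<And>a. a \<in> set W \<Longrightarrow> Suc i \<le> index a"
    and WB: "\<And>a. a \<in> set W \<Longrightarrow> index a = Suc i \<Longrightarrow> \<exists>B'. B = Letter (Suc i) True # B'"
    and B: "\<And>b. b \<in> set B \<Longrightarrow> Suc i \<le> index b" "sorted_wrt row_le B"
    and D: "sorted_wrt row_le (Letter i False # D)"
    and BD: "length B \<le> length D" "\<And>j. j < length B \<Longrightarrow> col_le (D ! j) (B ! j)"
  shows "foldl (pair_step i) (0, 0) (W @ Letter i False # B @ Letter i True # D) =
    foldl (pair_step i) (0, 0) (W @ B @ Letter i False # Letter i False # D)"
proof (cases "\<exists>a \<in> set W. index a = Suc i")
  case True
  then obtain B' where B': "B = Letter (Suc i) True # B'" using WB by auto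
  define t where "t = length (filter (\<lambda>a. index a = Suc i) W)"
  have "t > 0" using True by (auto simp: t_def filter_empty_conv)
  moreover have "foldl (pair_step i) (0, 0) W = (0, t)"
    using walk_y_axis[of W i 0] W by (force simp: t_def)
  moreover have "foldl (pair_step i) (0, s) B' = (0, s + length (filter (\<lambda>a. index a = Suc i) B'))" for s
    using B B' by (intro walk_y_axis) force
  ultimately show ?thesis using B' by simp
next
  case False
  define m where "m = length (filter (\<lambda>a. index a = Suc i) B)"
  have W0: "foldl (pair_step i) (0, 0) W = (0, 0)"
    using W False by (intro walk_inert) force
  have B0: "foldl (pair_step i) (0, 0) B = (0, m)"
    using walk_y_axis[of B i 0] B(1) by (force simp: m_def)
  have B1: "foldl (pair_step i) (1, 0) B = (1, m)"
    using walk_from_x_axis[of B i 1] B by (simp add: m_def)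
  show ?thesis
  proof (cases m)
    case 0
    then show ?thesis using W0 B0 B1 by (simp add: numeral_2_eq_2)
  next
    case (Suc q)
    \<comment> \<open>The row \<open>B\<close> has no index below \<open>i + 1\<close>, so its
      letters of index \<open>i + 1\<close> come first: a larger index at a place
      \<open>j < m\<close> would leave room for fewer than \<open>m\<close> of them.\<close>
    have idx: "index (B ! j) = Suc i" if "j < m" for j
    proof (rule ccontr)
      assume neq: "index (B ! j) \<noteq> Suc i"
      have jl: "j < length B" using that length_filter_le[of _ B] unfolding m_def
        by (rule less_le_trans)
      have "filter (\<lambda>a. index a = Suc i) (drop j B) = []"
      proof (rule filter_False, rule ballI)
        fix b assume "b \<in> set (drop j B)"
        then obtain k where "k < length (drop j B)" "b = drop j B ! k"
          by (auto simp: in_set_conv_nth)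
        then have k: "j + k < length B" "b = B ! (j + k)" by auto
        have "B ! j \<le> B ! (j + k)"
        proof (cases k)
          case (Suc k')
          have "row_le (B ! j) (B ! (j + k))"
            using sorted_wrt_nth_less[OF B(2), of j "j + k"] k Suc by simp
          then show ?thesis by (auto simp: row_le_def)
        qed simp
        moreover have "Suc i < index (B ! j)" using B(1)[of "B ! j"] jl neq by (simp add: le_less)
        ultimately show "index b \<noteq> Suc i" using k by (auto simp: less_eq_letter_def)
      qed
      moreover have "m = length (filter (\<lambda>a. index a = Suc i) (take j B))
          + length (filter (\<lambda>a. index a = Suc i) (drop j B))"
        unfolding m_def by (metis append_take_drop_id filter_append length_append)
      ultimately have "m = length (filter (\<lambda>a. index a = Suc i) (take j B))" by simp
      also have "\<dots> \<le> length (take j B)" by (rule length_filter_le)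
      finally show False using that by simp
    qed
    have "m \<le> length B" unfolding m_def by (rule length_filter_le)
    then have "m \<le> length D" using BD(1) by simp
    have between: "d = Letter i False \<or> d = Letter (Suc i) True"
      if "row_le (Letter i False) d" "col_le d b" "index b = Suc i" for d b
      using that by (cases d; cases b) (auto simp: row_le_def col_le_def less_letter_def)
    have "foldl (pair_step i) (2, Suc q) D = foldl (pair_step i) (1, q) D"
    proof (rule walk_merge)
      show "sorted_wrt row_le D" "q < length D" using D Suc \<open>m \<le> length D\<close> by auto
      fix j assume "j \<le> q"
      then have j: "j < m" "j < length D" "j < length B"
        using Suc \<open>m \<le> length D\<close> \<open>m \<le> length B\<close> by auto
      then have "row_le (Letter i False) (D ! j)" using D by simp
      then show "D ! j = Letter i False \<or> D ! j = Letter (Suc i) True"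
        using between BD(2)[OF j(3)] idx[OF j(1)] by blast
    qed
    then show ?thesis using W0 B0 B1 Suc by (simp add: numeral_2_eq_2)
  qed
qed

section \<open>Slides of fillings with one empty box\<close>

text \<open>Meant for the outer shape minus the new inner shape, hole included; this set stays fixed
  while the hole moves. The condition \<open>a \<le> b\<close> keeps to boxes on or right of the
  diagonal, since a shifted shape is convex only there.\<close>

definition convex_shape :: "box set \<Rightarrow> bool" where
  "convex_shape D \<longleftrightarrow> (\<forall>r c. (r, c) \<in> D \<longrightarrow> 1 \<le> r \<and> r \<le> c) \<and>
     (\<forall>r c r' c' a b. (r, c) \<in> D \<longrightarrow> (r', c') \<in> D \<longrightarrow> r \<le> a \<longrightarrow> a \<le> r' \<longrightarrow>
        c \<le> b \<longrightarrow> b \<le> c' \<longrightarrow> a \<le> b \<longrightarrow> (a, b) \<in> D)"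

definition before :: "box \<Rightarrow> box \<Rightarrow> bool" where
  "before b b' \<longleftrightarrow> fst b' < fst b \<or> (fst b = fst b' \<and> snd b < snd b')"

definition increasing :: "(box \<Rightarrow> nat option) \<Rightarrow> bool" where
  "increasing S \<longleftrightarrow> (\<forall>r c r' c' u v. S (r, c) = Some u \<longrightarrow> S (r', c') = Some v \<longrightarrow>
     r \<le> r' \<longrightarrow> c \<le> c' \<longrightarrow> (r, c) \<noteq> (r', c') \<longrightarrow> u < v)"

text \<open>Numbers in a filling stand for letters via \<open>l\<close>. This says that the order of the numbers is that of
  the standardization of the resulting reading word; ties within a row cannot involve primes.\<close>
definition compatible :: "(box \<Rightarrow> nat option) \<Rightarrow> (nat \<Rightarrow> letter) \<Rightarrow> bool" where
  "compatible S l \<longleftrightarrow> (\<forall>r c r' c' u v. S (r, c) = Some u \<longrightarrow> S (r', c') = Some v \<longrightarrow> u < v \<longrightarrow>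
     (if r < r' then col_le (l u) (l v) else row_le (l u) (l v)))"

text \<open>The first entry of each index in reading order is unprimed.\<close>
definition canonical :: "(box \<Rightarrow> nat option) \<Rightarrow> (nat \<Rightarrow> letter) \<Rightarrow> bool" where
  "canonical S l \<longleftrightarrow> (\<forall>b u. S b = Some u \<longrightarrow> primed (l u) \<longrightarrow>
     (\<exists>b' v. before b' b \<and> S b' = Some v \<and> index (l v) = index (l u)))"

text \<open>Within one index, a step to the right ends at an unprimed letter and a step down starts
  at a primed one. So going right and then down must increase the index; this is the border strip
  property of the letters of one index.\<close>

lemma row_col_index_less: "row_le a b \<Longrightarrow> col_le b c \<Longrightarrow> index a < index c"
  by (cases a; cases b; cases c) (auto simp: row_le_def col_le_def less_letter_def)

lemma row_le_index: "row_le a b \<Longrightarrow> index a \<le> index b"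
  by (auto simp: row_le_def less_letter_def)

lemma col_le_index: "col_le a b \<Longrightarrow> index a \<le> index b"
  by (auto simp: col_le_def less_letter_def)

lemma row_le_less: "a < b \<Longrightarrow> row_le a b" and col_le_less: "a < b \<Longrightarrow> col_le a b"
  by (auto simp: row_le_def col_le_def)

text \<open>The invariant of a slide. At both ends \<open>D - {e}\<close> is a skew shape and the
  data amount to a tableau with its standardization; in between, the hole may lie inside
  \<open>D\<close>.\<close>

locale slide_state =
  fixes D :: "box set" and S :: "box \<Rightarrow> nat option" and e :: box and l :: "nat \<Rightarrow> letter"
  assumes convex: "convex_shape D"
    and hole: "e \<in> D"
    and dom_S: "dom S = D - {e}"
    and incr: "increasing S"
    and inj: "inj_on S (dom S)"
    and compat: "compatible S l"
    and canon: "canonical S l"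
begin

lemma D_bounds: "(r, c) \<in> D \<Longrightarrow> 1 \<le> r \<and> r \<le> c"
  using convex[unfolded convex_shape_def, THEN conjunct1] by blast

lemma D_between:
  "(r, c) \<in> D \<Longrightarrow> (r', c') \<in> D \<Longrightarrow> r \<le> a \<Longrightarrow> a \<le> r' \<Longrightarrow> c \<le> b \<Longrightarrow> b \<le> c' \<Longrightarrow> a \<le> b \<Longrightarrow> (a, b) \<in> D"
  by (rule convex[unfolded convex_shape_def, THEN conjunct2, rule_format])

lemma S_in_D: "S b = Some u \<Longrightarrow> b \<in> D \<and> b \<noteq> e"
  using dom_S by auto

lemma D_obtain: "b \<in> D \<Longrightarrow> b \<noteq> e \<Longrightarrow> \<exists>u. S b = Some u"
  using dom_S by auto

lemma S_less: "S (r, c) = Some u \<Longrightarrow> S (r', c') = Some v \<Longrightarrow> r \<le> r' \<Longrightarrow> c \<le> c' \<Longrightarrow> (r, c) \<noteq> (r', c') \<Longrightarrow> u < v"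
  using incr[unfolded increasing_def, rule_format] by blast

lemma compat_col: "S (r, c) = Some u \<Longrightarrow> S (r', c') = Some v \<Longrightarrow> u < v \<Longrightarrow> r < r' \<Longrightarrow> col_le (l u) (l v)"
  using compat[unfolded compatible_def, rule_format, of r c u r' c' v] by simp

lemma compat_row: "S (r, c) = Some u \<Longrightarrow> S (r', c') = Some v \<Longrightarrow> u < v \<Longrightarrow> r' \<le> r \<Longrightarrow> row_le (l u) (l v)"
  using compat[unfolded compatible_def, rule_format, of r c u r' c' v] by simp

lemma S_inj: "S b = Some u \<Longrightarrow> S b' = Some u \<Longrightarrow> b = b'"
  using inj_onD[OF inj, of b b'] by auto

lemma row_letters: "S (r, c) = Some u \<Longrightarrow> S (r, c') = Some v \<Longrightarrow> c < c' \<Longrightarrow> row_le (l u) (l v)"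
  using compat_row[of r c u r c' v] S_less[of r c u r c' v] by simp

lemma col_letters: "S (r, c) = Some u \<Longrightarrow> S (r', c') = Some v \<Longrightarrow> r < r' \<Longrightarrow> c \<le> c' \<Longrightarrow> col_le (l u) (l v)"
  using compat_col[of r c u r' c' v] S_less[of r c u r' c' v] by simp

text \<open>Right along row \<open>k\<close>, then down. Box \<open>(k, k + 1)\<close> is used as
  the corner of this route and so must not be the hole.\<close>

lemma below_diagonal:
  assumes "S (k, k) = Some u" "S (r', c') = Some v" "k < r'" "e \<noteq> (k, Suc k)"
  shows "index (l u) < index (l v)"
proof -
  have D: "(k, k) \<in> D" "(r', c') \<in> D" using S_in_D assms by auto
  then have "r' \<le> c'" using D_bounds by auto
  then have "(k, Suc k) \<in> D" using D_between[OF D, of k "Suc k"] assms(3) by simp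
  then obtain b where b: "S (k, Suc k) = Some b" using D_obtain assms(4) by metis
  have "row_le (l u) (l b)" using row_letters[OF assms(1) b] by simp
  moreover have "col_le (l b) (l v)" using col_letters[OF b assms(2,3)] assms(3) \<open>r' \<le> c'\<close> by simp
  ultimately show ?thesis by (rule row_col_index_less)
qed

end

section \<open>Upward moves: comparisons with the neighbouring rows\<close>

locale slide_up = slide_state D S "(r, c)" l for D S r c l +
  fixes x :: nat
  assumes x: "S (Suc r, c) = Some x"
    and x_less: "\<And>y. S (r, Suc c) = Some y \<Longrightarrow> x < y"
begin

definition slid :: "box \<Rightarrow> nat option" where
  "slid = S((r, c) := Some x, (Suc r, c) := None)"

lemma c_gt: "r < c"
  using S_in_D[OF x] D_bounds by fastforce

lemma slid_cases:
  assumes "slid b = Some v"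
  obtains "b = (r, c)" "v = x" | "b \<noteq> (r, c)" "b \<noteq> (Suc r, c)" "S b = Some v" "v \<noteq> x"
proof (cases "b = (r, c)")
  case False
  then have "b \<noteq> (Suc r, c)" "S b = Some v" using assms by (auto simp: slid_def split: if_splits)
  with that False S_inj x show ?thesis by blast
qed (use assms that in \<open>auto simp: slid_def\<close>)

lemma slid_other: "S b = Some v \<Longrightarrow> b \<noteq> (Suc r, c) \<Longrightarrow> slid b = Some v"
  using S_in_D[of b v] by (auto simp: slid_def)

lemma slid_new: "slid (r, c) = Some x"
  by (simp add: slid_def)

text \<open>The entry above \<open>b\<close> is at least the right neighbour of the hole, hence
  larger than \<open>x\<close>, which was chosen as the smaller neighbour. So from the new place of
  \<open>x\<close> one gets to \<open>b\<close> by going right and then down.\<close>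

lemma above_right:
  assumes "S (Suc r, c') = Some b" "c < c'"
  obtains d where "S (r, c') = Some d" "x < d" "d < b" "row_le (l x) (l d)" "col_le (l d) (l b)"
proof -
  have D: "(Suc r, c') \<in> D" "(r, c) \<in> D" using S_in_D assms hole by auto
  then have "r \<le> c'" using D_bounds by fastforce
  then have "(r, c') \<in> D" using D_between[OF D(2,1), of r c'] assms c_gt by simp
  then obtain d where d: "S (r, c') = Some d" using D_obtain assms by (metis nat_neq_iff prod.inject)
  have "(r, Suc c) \<in> D" using D_between[OF D(2,1), of r "Suc c"] assms c_gt by simp
  then obtain d1 where d1: "S (r, Suc c) = Some d1" using D_obtain by (metis n_not_Suc_n prod.inject)
  have "d1 \<le> d"
  proof (cases "c' = Suc c")
    case False
    then show ?thesis using S_less[OF d1 d] assms(2) by simp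
  qed (use d d1 in simp)
  then have xd: "x < d" using x_less[OF d1] by simp
  moreover have "d < b" using S_less[OF d assms(1)] by simp
  moreover have "row_le (l x) (l d)" using compat_row[OF x d xd] by simp
  moreover have "col_le (l d) (l b)" using col_letters[OF d assms(1)] by simp
  ultimately show ?thesis using that d by blast
qed

lemma below_left:
  assumes "S (r, c') = Some u" "r < c'" "c' < c"
  obtains a where "S (Suc r, c') = Some a" "u < a" "a < x" "col_le (l u) (l a)" "row_le (l a) (l x)"
proof -
  have D: "(r, c') \<in> D" "(Suc r, c) \<in> D" using S_in_D assms x by auto
  have "(Suc r, c') \<in> D" using D_between[OF D, of "Suc r" c'] assms by simp
  then obtain a where a: "S (Suc r, c') = Some a" using D_obtain by (metis n_not_Suc_n prod.inject)
  show ?thesis using that[OF a] S_less[OF assms(1) a] S_less[OF a x] assms(3)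
      col_letters[OF assms(1) a] row_letters[OF a x] by simp
qed

lemma increasing_slid: "increasing slid"
  unfolding increasing_def
proof (intro allI impI)
  fix p q p' q' u v
  assume u: "slid (p, q) = Some u" and v: "slid (p', q') = Some v" and le: "p \<le> p'" "q \<le> q'" "(p, q) \<noteq> (p', q')"
  show "u < v"
  proof (cases rule: slid_cases[OF u])
    case 1
    note u = 1
    show ?thesis
    proof (cases rule: slid_cases[OF v])
      case 1
      then show ?thesis using u le by simp
    next
      case 2
      show ?thesis
      proof (cases "p' = r")
        case True
        then have q': "Suc c \<le> q'" using u le by auto
        have "(r, Suc c) \<in> D"
          using D_between[OF hole, of p' q' r "Suc c"] S_in_D[OF 2(3)] c_gt q' True by simp
        then obtain d where d: "S (r, Suc c) = Some d" using D_obtain by (metis n_not_Suc_n prod.inject)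
        have "d \<le> v"
        proof (cases "q' = Suc c")
          case True
          then show ?thesis using d 2 \<open>p' = r\<close> by simp
        next
          case False
          then show ?thesis using S_less[OF d 2(3)] q' True by simp
        qed
        then show ?thesis using x_less[OF d] u by simp
      next
        case False
        then show ?thesis using S_less[OF x 2(3)] 2 u le by auto
      qed
    qed
  next
    case 2
    note u = 2
    show ?thesis
    proof (cases rule: slid_cases[OF v])
      case 1
      then show ?thesis using S_less[OF u(3) x] u le by auto
    next
      case 2
      then show ?thesis using S_less[OF u(3) 2(3)] le by simp
    qed
  qed
qed

lemma inj_slid: "inj_on slid (dom slid)"
proof (rule inj_onI)
  fix b b' assume "b \<in> dom slid" "b' \<in> dom slid" "slid b = slid b'"
  then obtain u where u: "slid b = Some u" and u': "slid b' = Some u" by auto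
  show "b = b'"
    by (cases rule: slid_cases[OF u]; cases rule: slid_cases[OF u']) (auto dest: S_inj)
qed

lemma dom_slid: "dom slid = D - {(Suc r, c)}"
proof -
  have "dom slid = insert (r, c) (dom S) - {(Suc r, c)}" by (auto simp: slid_def)
  then show ?thesis using dom_S hole by auto
qed

text \<open>A prime requires an earlier letter of the same index. Box \<open>(r + 1, r + 1)\<close>
  is the first of its row, so that letter would lie in a lower row, where indices are
  larger.\<close>

lemma diagonal_unprimed:
  assumes "c = Suc r"
  shows "\<not> primed (l x)"
proof
  assume "primed (l x)"
  then obtain b v where b: "before b (Suc r, c)" "S b = Some v" "index (l v) = index (l x)"
    using canon x unfolding canonical_def by blast
  obtain r' c' where [simp]: "b = (r', c')" by (cases b)
  have "r' \<le> c'" using S_in_D[OF b(2)] D_bounds by simp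
  then have "Suc r < r'" using b(1) assms by (auto simp: before_def)
  then have "index (l x) < index (l v)"
    using below_diagonal[of "Suc r" x r' c' v] x b(2) assms by simp
  then show False using b(3) by simp
qed

text \<open>Only the comparisons of \<open>x\<close> with its old row and its new row change their
  form. A larger entry of the old row has an entry above it, and a smaller entry of the new row has
  one below it, lying between it and \<open>x\<close>; this makes the inequality strict, and a
  strict inequality is valid in both forms.\<close>

lemma compatible_slid: "compatible slid l"
  unfolding compatible_def
proof (intro allI impI)
  fix p q p' q' u v
  assume u: "slid (p, q) = Some u" and v: "slid (p', q') = Some v" and less: "u < v"
  show "if p < p' then col_le (l u) (l v) else row_le (l u) (l v)"
  proof (cases rule: slid_cases[OF u])
    case 1
    note u = 1
    show ?thesis
    proof (cases rule: slid_cases[OF v])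
      case 1
      then show ?thesis using u less by simp
    next
      case 2
      consider "p' \<le> r" | "p' = Suc r" | "Suc r < p'" by linarith
      then show ?thesis
      proof cases
        case 1
        then show ?thesis using compat_row[OF x 2(3)] less u by simp
      next
        case p': 2
        have "c < q'"
        proof (rule ccontr)
          assume "\<not> c < q'"
          then have "v < x" using S_less[OF 2(3) x] p' 2 by simp
          then show False using less u by simp
        qed
        from 2(3) have v': "S (Suc r, q') = Some v" using p' by simp
        from above_right[OF v' \<open>c < q'\<close>] obtain d where "row_le (l x) (l d)" "col_le (l d) (l v)" .
        then show ?thesis using row_col_less[THEN col_le_less] p' u by simp
      next
        case 3
        then show ?thesis using compat_col[OF x 2(3)] less u by simp
      qed
    qed
  next
    case 2
    note u = 2
    show ?thesis
    proof (cases rule: slid_cases[OF v])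
      case 1
      consider "p < r" | "p = r" | "Suc r \<le> p" by linarith
      then show ?thesis
      proof cases
        assume "p < r"
        then show ?thesis using compat_col[OF u(3) x] less 1 by simp
      next
        assume p: "p = r"
        then have u': "S (r, q) = Some u" using u by simp
        have "q < c"
        proof (rule ccontr)
          assume "\<not> q < c"
          then have "c < q" using u p by (simp add: nat_neq_iff)
          then have "x < u" using \<open>slid (p, q) = Some u\<close> p increasing_slid slid_new
            unfolding increasing_def by (metis le_refl less_imp_le nat_neq_iff prod.inject)
          then show False using less 1 by simp
        qed
        have "row_le (l u) (l x)"
        proof (cases "r < q")
          case True
          from below_left[OF u' True \<open>q < c\<close>] obtain a where "col_le (l u) (l a)" "row_le (l a) (l x)" .
          then show ?thesis using col_row_less[THEN row_le_less] by blast
        next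
          case False
          then have q: "q = r" using S_in_D[OF u'] D_bounds by fastforce
          \<comment> \<open>A diagonal entry has no box below it. If the hole is next to it,
            \<open>x\<close> is itself on the diagonal and unprimed, so equality of the letters is
            excluded; otherwise the entry in \<open>(r, r + 1)\<close> mediates.\<close>
          show ?thesis
          proof (cases "c = Suc r")
            case True
            have "col_le (l u) (l x)" using col_letters[OF u' x] q True by simp
            then show ?thesis using diagonal_unprimed[OF True] by (auto simp: col_le_def row_le_def)
          next
            case False
            then have "Suc r < c" using c_gt by simp
            have "(r, Suc r) \<in> D" using D_between[of r q r c r "Suc r"] S_in_D[OF u'] hole \<open>Suc r < c\<close> q by simp
            then obtain v' where v': "S (r, Suc r) = Some v'" using D_obtain \<open>Suc r < c\<close> by (metis nat_neq_iff prod.inject)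
            from below_left[OF v'] \<open>Suc r < c\<close> obtain a where "col_le (l v') (l a)" "row_le (l a) (l x)" by auto
            then have "l v' < l x" by (rule col_row_less)
            moreover have "row_le (l u) (l v')" using row_letters[OF u' v'] q by simp
            ultimately show ?thesis by (auto simp: row_le_def)
          qed
        qed
        then show ?thesis using 1 p by simp
      next
        assume "Suc r \<le> p"
        then show ?thesis using compat_row[OF u(3) x] less 1 by simp
      qed
    next
      case 2
      then show ?thesis using compat_col[OF u(3) 2(3)] compat_row[OF u(3) 2(3)] less by simp
    qed
  qed
qed

text \<open>\<open>x\<close> is read later than before, so a primed letter that it passes may lose
  the earlier letter of its index. Those right of \<open>x\<close> in row \<open>r + 1\<close> have
  larger index; those left of the hole in row \<open>r\<close> have an entry of the same index below
  them, which is read earlier. Only box \<open>(r, r)\<close> next to the hole lacks such a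
  substitute.\<close>

lemma canonical_slid:
  assumes u: "slid b = Some u" "primed (l u)"
    and not: "\<not> (c = Suc r \<and> b = (r, r) \<and> index (l u) = index (l x))"
  shows "\<exists>b' v. before b' b \<and> slid b' = Some v \<and> index (l v) = index (l u)"
proof (cases rule: slid_cases[OF u(1)])
  case 1
  then obtain b' v where b': "before b' (Suc r, c)" "S b' = Some v" "index (l v) = index (l u)"
    using canon x u(2) unfolding canonical_def by blast
  then have "b' \<noteq> (Suc r, c)" by (auto simp: before_def)
  moreover have "before b' b" using b'(1) 1 by (auto simp: before_def)
  ultimately show ?thesis using slid_other b' by blast
next
  case 2
  then obtain b' v where b': "before b' b" "S b' = Some v" "index (l v) = index (l u)"
    using canon u(2) unfolding canonical_def by blast
  show ?thesis
  proof (cases "b' = (Suc r, c)")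
    case False
    then show ?thesis using slid_other b' by blast
  next
    case True
    then have vx: "v = x" using b' x by simp
    obtain p q where b: "b = (p, q)" by (cases b)
    consider "before (r, c) b" | "p = Suc r" "c < q" | "p = r" "q < c"
      using b'(1) True b 2(1) by (auto simp: before_def) linarith+
    then show ?thesis
    proof cases
      case 1
      then show ?thesis using slid_new b' vx by blast
    next
      assume pq: "p = Suc r" "c < q"
      then have "S (Suc r, q) = Some u" using 2 b by simp
      from above_right[OF this pq(2)] obtain d where "row_le (l x) (l d)" "col_le (l d) (l u)" .
      then have "index (l x) < index (l u)" by (rule row_col_index_less)
      then show ?thesis using b' vx by simp
    next
      assume pq: "p = r" "q < c"
      then have u': "S (r, q) = Some u" using 2 b by simp
      show ?thesis
      proof (cases "r < q")
        case True
        from below_left[OF u' True pq(2)] obtain a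
          where a: "S (Suc r, q) = Some a" "col_le (l u) (l a)" "row_le (l a) (l x)" .
        then have "index (l a) = index (l u)"
          using col_le_index[OF a(2)] row_le_index[OF a(3)] b' vx by simp
        moreover have "slid (Suc r, q) = Some a" using slid_other[OF a(1)] pq by simp
        moreover have "before (Suc r, q) b" using b pq by (simp add: before_def)
        ultimately show ?thesis by blast
      next
        case False
        then have q: "q = r" using S_in_D[OF u'] D_bounds by fastforce
        then have "Suc r < c" using not b pq c_gt b' vx by (metis Suc_lessI)
        then have "index (l u) < index (l x)"
          using below_diagonal[of r u "Suc r" c x] u' x q by simp
        then show ?thesis using b' vx by simp
      qed
    qed
  qed
qed

end

section \<open>Reading words\<close>

definition row_segment :: "(box \<Rightarrow> 'a option) \<Rightarrow> nat \<Rightarrow> nat \<Rightarrow> nat \<Rightarrow> 'a list" where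
  "row_segment S k a b = List.map_filter (\<lambda>j. S (k, j)) [a..<b]"

text \<open>A bounding square takes the place of the shape and empty boxes are skipped, so a filling
  with a hole has a reading word too. Row 0 is included but holds no box.\<close>

definition reading :: "nat \<Rightarrow> (box \<Rightarrow> 'a option) \<Rightarrow> 'a list" where
  "reading N S = concat (map (\<lambda>k. row_segment S k 0 N) (rev [0..<N]))"

lemma set_row_segment: "v \<in> set (row_segment S k a b) \<longleftrightarrow> (\<exists>j. a \<le> j \<and> j < b \<and> S (k, j) = Some v)"
  unfolding row_segment_def by (force simp: List.map_filter_def)

lemma row_segment_split: "a \<le> m \<Longrightarrow> m \<le> b \<Longrightarrow> row_segment S k a b = row_segment S k a m @ row_segment S k m b"
  unfolding row_segment_def using upt_add_eq_append[of a m "b - m"] by (simp add: List.map_filter_def)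

lemma row_segment_Some: "a < b \<Longrightarrow> S (k, a) = Some v \<Longrightarrow> row_segment S k a b = v # row_segment S k (Suc a) b"
  by (simp add: row_segment_def upt_conv_Cons map_filter_simps)

lemma row_segment_None: "a < b \<Longrightarrow> S (k, a) = None \<Longrightarrow> row_segment S k a b = row_segment S k (Suc a) b"
  by (simp add: row_segment_def upt_conv_Cons map_filter_simps)

lemma row_segment_cong: "(\<And>j. a \<le> j \<Longrightarrow> j < b \<Longrightarrow> S (k, j) = S' (k, j)) \<Longrightarrow> row_segment S k a b = row_segment S' k a b"
  unfolding row_segment_def List.map_filter_def by (rule map_cong[OF filter_cong]) auto

lemma row_segment_empty: "(\<And>j. a \<le> j \<Longrightarrow> j < b \<Longrightarrow> S (k, j) = None) \<Longrightarrow> row_segment S k a b = []"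
  by (simp add: row_segment_def List.map_filter_def)

lemma row_segment_full:
  "(\<And>j. a \<le> j \<Longrightarrow> j < b \<Longrightarrow> S (k, j) \<noteq> None) \<Longrightarrow> row_segment S k a b = map (\<lambda>j. the (S (k, j))) [a..<b]"
  by (simp add: row_segment_def List.map_filter_def)

lemma set_reading: "dom S \<subseteq> {..<N} \<times> {..<N} \<Longrightarrow> set (reading N S) = ran S"
  by (force simp: reading_def set_row_segment ran_def)

lemma reading_rows:
  assumes "Suc r < N"
  shows "reading N S = concat (map (\<lambda>k. row_segment S k 0 N) (rev [Suc (Suc r)..<N])) @
    row_segment S (Suc r) 0 N @ row_segment S r 0 N @ concat (map (\<lambda>k. row_segment S k 0 N) (rev [0..<r]))"
proof -
  have "[0..<N] = [0..<r] @ [r..<N]"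
    using upt_add_eq_append[of 0 r "N - r"] assms by simp
  moreover have "[r..<N] = r # Suc r # [Suc (Suc r)..<N]" using assms by (simp add: upt_conv_Cons)
  ultimately show ?thesis by (simp add: reading_def)
qed

lemma sorted_row_segment:
  assumes "increasing S" "compatible S l"
  shows "sorted_wrt row_le (map l (row_segment S k a b))"
proof (induction b)
  case (Suc b)
  show ?case
  proof (cases "a \<le> b")
    case True
    have split: "row_segment S k a (Suc b) = row_segment S k a b @ row_segment S k b (Suc b)"
      using True by (intro row_segment_split) auto
    show ?thesis
    proof (cases "S (k, b)")
      case None
      then show ?thesis using Suc split row_segment_None[of b "Suc b" S k] by (simp add: row_segment_def map_filter_simps)
    next
      case (Some v)
      have "row_le (l u) (l v)" if u: "S (k, j) = Some u" "j < b" for u j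
      proof -
        have "u < v"
          using assms(1)[unfolded increasing_def, rule_format, OF u(1) Some] u(2) by simp
        then show ?thesis
          using assms(2)[unfolded compatible_def, rule_format, OF u(1) Some] by simp
      qed
      then have "row_le (l u) (l v)" if "u \<in> set (row_segment S k a b)" for u
        using that by (auto simp: set_row_segment)
      then show ?thesis using Suc split Some row_segment_Some[of b "Suc b" S k]
        by (auto simp add: sorted_wrt_append row_segment_def map_filter_simps)
    qed
  qed (simp add: row_segment_def map_filter_simps)
qed (simp add: row_segment_def map_filter_simps)

section \<open>Moves within a row\<close>

context slide_state
begin

text \<open>Every row keeps its entries in their order. Compatibility sees only rows and numbers,
  and canonicity only the order of reading, so both carry over; the choice of the smaller neighbour
  enters in monotonicity.\<close>

lemma slide_right:
  assumes e: "e = (r, c)" and x: "S (r, Suc c) = Some x" and less: "\<And>y. S (Suc r, c) = Some y \<Longrightarrow> x < y"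
    and bound: "D \<subseteq> {..<N} \<times> {..<N}"
  defines "S' \<equiv> S((r, c) := Some x, (r, Suc c) := None)"
  shows "slide_state D S' (r, Suc c) l" "reading N S' = reading N S"
proof -
  have eD: "(r, c) \<in> D" and xD: "(r, Suc c) \<in> D" using hole e S_in_D[OF x] by auto
  have hole_None: "S (r, c) = None" using dom_S e by auto
  have cases: thesis if "S' (p, q) = Some v" "(p, q) = (r, c) \<Longrightarrow> v = x \<Longrightarrow> thesis"
    "(p, q) \<noteq> (r, c) \<Longrightarrow> (p, q) \<noteq> (r, Suc c) \<Longrightarrow> S (p, q) = Some v \<Longrightarrow> thesis" for p q v thesis
    using that by (auto simp: S'_def split: if_splits)
  \<comment> \<open>The box from which the entry now in \<open>b\<close> came; it lies in the same
    row.\<close>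
  define old where "old b = (if b = (r, c) then (r, Suc c) else b)" for b
  have S'_old: "S (old b) = Some v \<and> old b \<noteq> (r, c) \<and> fst (old b) = fst b" if "S' b = Some v" for b v
    using that x by (auto simp: S'_def old_def split: if_splits)
  have incr': "increasing S'"
    unfolding increasing_def
  proof (intro allI impI)
    fix p q p' q' u v
    assume u: "S' (p, q) = Some u" and v: "S' (p', q') = Some v" and le: "p \<le> p'" "q \<le> q'" "(p, q) \<noteq> (p', q')"
    show "u < v"
    proof (cases rule: cases[OF u])
      case 1
      note u = 1
      show ?thesis
      proof (cases rule: cases[OF v])
        case 1
        then show ?thesis using u le by simp
      next
        case 2
        show ?thesis
        proof (cases "q' = c")
          case True
          then have p': "Suc r \<le> p'" using u le by auto
          have "(Suc r, c) \<in> D"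
            using D_between[OF eD, of p' q' "Suc r" c] S_in_D[OF 2(3)] D_bounds p' True by fastforce
          then obtain d where d: "S (Suc r, c) = Some d" using D_obtain e by (metis n_not_Suc_n prod.inject)
          have "d \<le> v"
          proof (cases "p' = Suc r")
            case True
            then show ?thesis using d 2 \<open>q' = c\<close> by simp
          next
            case False
            then show ?thesis using S_less[OF d 2(3)] p' True by simp
          qed
          then show ?thesis using less[OF d] u by simp
        next
          case False
          then show ?thesis using S_less[OF x 2(3)] 2 u le by auto
        qed
      qed
    next
      case 2
      note u = 2
      show ?thesis
      proof (cases rule: cases[OF v])
        case 1
        then show ?thesis using S_less[OF u(3) x] u le by auto
      next
        case 2
        then show ?thesis using S_less[OF u(3) 2(3)] le by simp
      qed
    qed
  qed
  have "inj_on S' (dom S')"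
  proof (rule inj_onI)
    fix b b' assume "b \<in> dom S'" "b' \<in> dom S'" "S' b = S' b'"
    then obtain u where u: "S' b = Some u" "S' b' = Some u" by auto
    then have "old b = old b'" using S'_old S_inj by blast
    then show "b = b'" using u S'_old by (auto simp: old_def S'_def split: if_splits)
  qed
  moreover have "dom S' = D - {(r, Suc c)}"
  proof -
    have "dom S' = insert (r, c) (dom S) - {(r, Suc c)}" by (auto simp: S'_def)
    then show ?thesis using dom_S e eD by auto
  qed
  moreover have "compatible S' l"
    unfolding compatible_def
  proof (intro allI impI)
    fix p q p' q' u v
    assume "S' (p, q) = Some u" "S' (p', q') = Some v" and uv: "u < v"
    then have o: "S (old (p, q)) = Some u" "S (old (p', q')) = Some v"
      "fst (old (p, q)) = p" "fst (old (p', q')) = p'"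
      using S'_old by auto
    then obtain q1 q1' where "S (p, q1) = Some u" "S (p', q1') = Some v" by (metis prod.collapse)
    then show "if p < p' then col_le (l u) (l v) else row_le (l u) (l v)"
      using compat_row compat_col uv by simp
  qed
  moreover have "canonical S' l"
    unfolding canonical_def
  proof (intro allI impI)
    fix b u assume u: "S' b = Some u" "primed (l u)"
    then obtain b' v where b': "before b' (old b)" "S b' = Some v" "index (l v) = index (l u)"
      using canon S'_old unfolding canonical_def by blast
    define b1 where "b1 = (if b' = (r, Suc c) then (r, c) else b')"
    have "S' b1 = Some v" using b' x hole_None by (auto simp: S'_def b1_def)
    moreover have "before b1 b"
      using b'(1,2) u(1) hole_None by (cases b; cases b') (auto simp: before_def b1_def old_def S'_def less_Suc_eq split: if_splits)
    ultimately show "\<exists>b' v. before b' b \<and> S' b' = Some v \<and> index (l v) = index (l u)" using b' by blast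
  qed
  ultimately show "slide_state D S' (r, Suc c) l"
    using convex xD incr' by unfold_locales auto
  have N: "Suc c < N" using xD bound by auto
  have "row_segment S' k 0 N = row_segment S k 0 N" for k
  proof (cases "k = r")
    case True
    have "row_segment T r 0 N = row_segment T r 0 c @ row_segment T r c N" for T :: "box \<Rightarrow> nat option"
      using N by (intro row_segment_split) auto
    moreover have "row_segment S' r 0 c = row_segment S r 0 c"
      by (rule row_segment_cong) (auto simp: S'_def)
    moreover have "row_segment S r c N = x # row_segment S r (Suc (Suc c)) N"
      using N hole_None x by (simp add: row_segment_None row_segment_Some)
    moreover have "row_segment S' r c N = x # row_segment S' r (Suc (Suc c)) N"
      using N by (simp add: row_segment_None row_segment_Some S'_def)
    moreover have "row_segment S' r (Suc (Suc c)) N = row_segment S r (Suc (Suc c)) N"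
      by (rule row_segment_cong) (auto simp: S'_def)
    ultimately show ?thesis using True by simp
  next
    case False
    then show ?thesis by (intro row_segment_cong) (auto simp: S'_def)
  qed
  then show "reading N S' = reading N S" by (simp add: reading_def)
qed

end

section \<open>The invariant after an upward move, with or without loss of a prime\<close>

context slide_up
begin

text \<open>In this case the entry of box \<open>(r, r)\<close> becomes the first of its index in reading order, so it
  loses its prime.\<close>
definition unpriming :: bool where
  "unpriming \<longleftrightarrow> c = Suc r \<and> (\<exists>y. S (r, r) = Some y \<and> primed (l y) \<and> index (l y) = index (l x))"

lemma slide_state_slid:
  assumes "\<not> unpriming"
  shows "slide_state D slid (Suc r, c) l"
proof -
  have "canonical slid l"
    unfolding canonical_def
  proof (intro allI impI)
    fix b u assume u: "slid b = Some u" "primed (l u)"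
    have "\<not> (c = Suc r \<and> b = (r, r) \<and> index (l u) = index (l x))"
    proof
      assume *: "c = Suc r \<and> b = (r, r) \<and> index (l u) = index (l x)"
      then have "S (r, r) = Some u" by (auto intro: slid_cases[OF u(1)])
      then show False using assms * u(2) unfolding unpriming_def by blast
    qed
    then show "\<exists>b' v. before b' b \<and> slid b' = Some v \<and> index (l v) = index (l u)"
      by (rule canonical_slid[OF u])
  qed
  then show ?thesis
    using convex S_in_D[OF x] dom_slid increasing_slid inj_slid compatible_slid by unfold_locales auto
qed

text \<open>Changing \<open>y\<close> from \<open>i'\<close> to \<open>i\<close> gives it the letter
  of \<open>x\<close>. Whatever could precede \<open>i'\<close> is smaller than \<open>i\<close>,
  and whatever could follow it in its own or a higher row can follow \<open>i\<close>. An entry of a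
  lower row has a larger number than \<open>x\<close>, which now lies in the row of
  \<open>y\<close>, so its comparison with \<open>x\<close> can be taken over.\<close>

lemma slide_state_slid_unpriming:
  assumes "unpriming" "S (r, r) = Some y"
  shows "slide_state D slid (Suc r, c) (l(y := l x))" "l x = Letter (index (l y)) False"
proof -
  have c: "c = Suc r" and y: "primed (l y)" "index (l y) = index (l x)"
    using assms unfolding unpriming_def by auto
  show lx: "l x = Letter (index (l y)) False"
    using diagonal_unprimed[OF c] y(2) by (cases "l x") auto
  have ly: "l y = Letter (index (l y)) True" using y(1) by (cases "l y") auto
  have yx: "y < x" using S_less[OF assms(2) x] c by simp
  have slidy: "slid (r, r) = Some y" using slid_other[OF assms(2)] by simp
  have slid_inj: "b = b'" if "slid b = Some v" "slid b' = Some v" for b b' v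
    using inj_onD[OF inj_slid, of b b'] that by auto
  have old: "if p < p' then col_le (l u) (l v) else row_le (l u) (l v)"
    if "slid (p, q) = Some u" "slid (p', q') = Some v" "u < v" for p q p' q' u v
    using compatible_slid[unfolded compatible_def, rule_format, OF that] .
  have up: "row_le (Letter i True) b \<Longrightarrow> row_le (Letter i False) b" for i b
    by (cases b) (auto simp: row_le_def less_letter_def)
  have down: "col_le a (Letter i True) \<Longrightarrow> a < Letter i False" "row_le a (Letter i True) \<Longrightarrow> a < Letter i False" for i a
    by (cases a; auto simp: row_le_def col_le_def less_letter_def)+
  have "compatible slid (l(y := l x))"
    unfolding compatible_def
  proof (intro allI impI)
    fix p q p' q' u v
    assume u: "slid (p, q) = Some u" and v: "slid (p', q') = Some v" and uv: "u < v"
    consider "u = y" "v \<noteq> y" | "v = y" "u \<noteq> y" | "u \<noteq> y" "v \<noteq> y" using uv by auto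
    then show "if p < p' then col_le ((l(y := l x)) u) ((l(y := l x)) v) else row_le ((l(y := l x)) u) ((l(y := l x)) v)"
    proof cases
      case 1
      then have "p = r" using slid_inj[OF u, of "(r, r)"] slidy by simp
      show ?thesis
      proof (cases "r < p'")
        case True
        have v': "S (p', q') = Some v" "(p', q') \<noteq> (Suc r, c)"
          using True by (auto intro: slid_cases[OF v])
        then have "p' \<le> q'" using S_in_D[OF v'(1)] D_bounds by simp
        then have "x < v" using S_less[OF x v'(1)] v'(2) True c by auto
        then show ?thesis using old[OF slid_new v] True \<open>p = r\<close> 1 by simp
      next
        case False
        then have "row_le (l y) (l v)" using old[OF u v uv] \<open>p = r\<close> 1 by simp
        then have "row_le (l x) (l v)" using up[of "index (l y)", folded lx ly] by blast
        then show ?thesis using 1 False \<open>p = r\<close> by simp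
      qed
    next
      case 2
      have "l u < l x"
        using old[OF u v uv] 2 down[of "l u" "index (l y)", folded ly lx] by (simp split: if_splits)
      then show ?thesis using 2 by (auto simp: row_le_def col_le_def)
    next
      case 3
      then show ?thesis using old[OF u v uv] by simp
    qed
  qed
  moreover have "canonical slid (l(y := l x))"
    unfolding canonical_def
  proof (intro allI impI)
    fix b u assume u: "slid b = Some u" "primed ((l(y := l x)) u)"
    then have "u \<noteq> y" using lx by auto
    then have "\<exists>b' v. before b' b \<and> slid b' = Some v \<and> index (l v) = index (l u)"
    proof -
      have "b \<noteq> (r, r)" using u(1) slidy \<open>u \<noteq> y\<close> by auto
      then show ?thesis using canonical_slid[OF u(1)] u(2) \<open>u \<noteq> y\<close> by simp
    qed
    then show "\<exists>b' v. before b' b \<and> slid b' = Some v \<and> index ((l(y := l x)) v) = index ((l(y := l x)) u)"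
      using y \<open>u \<noteq> y\<close> by (metis fun_upd_apply)
  qed
  ultimately show "slide_state D slid (Suc r, c) (l(y := l x))"
    using convex S_in_D[OF x] dom_slid increasing_slid inj_slid by unfold_locales auto
qed

end

section \<open>The walk under an upward move\<close>

locale bounded_slide_up = slide_up +
  fixes N :: nat
  assumes bound: "D \<subseteq> {..<N} \<times> {..<N}"
begin

definition "low_rows = concat (map (\<lambda>k. row_segment S k 0 N) (rev [Suc (Suc r)..<N]))"
definition "high_rows = concat (map (\<lambda>k. row_segment S k 0 N) (rev [0..<r]))"
text \<open>The four pieces of rows \<open>r + 1\<close> and \<open>r\<close> on both sides of
  column \<open>c\<close>: they are \<open>A\<close>, \<open>B\<close>, \<open>C\<close> and
  \<open>D\<close> of the exchange, apart from the initial letters that \<open>left_columns\<close>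
  splits off from the left pieces.\<close>

definition "lower_left = row_segment S (Suc r) 0 c"
definition "lower_right = row_segment S (Suc r) (Suc c) N"
definition "upper_left = row_segment S r 0 c"
definition "upper_right = row_segment S r (Suc c) N"

lemma N_gt: "Suc r < N" "Suc c \<le> N"
  using S_in_D[OF x] bound by auto

lemma S_hole: "S (r, c) = None"
  using dom_S by auto

lemma reading_S: "reading N S = low_rows @ lower_left @ x # lower_right @ upper_left @ upper_right @ high_rows"
proof -
  have "row_segment S k 0 N = row_segment S k 0 c @ row_segment S k c N" for k
    using N_gt by (intro row_segment_split) auto
  moreover have "row_segment S (Suc r) c N = x # lower_right"
    using N_gt x by (simp add: row_segment_Some lower_right_def)
  moreover have "row_segment S r c N = upper_right"
    using N_gt S_hole by (simp add: row_segment_None upper_right_def)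
  ultimately show ?thesis
    using N_gt by (simp add: reading_rows low_rows_def high_rows_def lower_left_def upper_left_def)
qed

lemma row_slid: "row_segment slid r 0 N = upper_left @ x # upper_right"
proof -
  have "row_segment slid r 0 N = row_segment slid r 0 c @ row_segment slid r c N"
    using N_gt by (intro row_segment_split) auto
  moreover have "row_segment slid r 0 c = upper_left"
    unfolding upper_left_def by (rule row_segment_cong) (auto simp: slid_def)
  moreover have "row_segment slid r c N = x # row_segment slid r (Suc c) N"
    using N_gt slid_new by (simp add: row_segment_Some)
  moreover have "row_segment slid r (Suc c) N = upper_right"
    unfolding upper_right_def by (rule row_segment_cong) (auto simp: slid_def)
  ultimately show ?thesis by simp
qed

lemma reading_slid: "reading N slid = low_rows @ lower_left @ lower_right @ upper_left @ x # upper_right @ high_rows"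
proof -
  have "row_segment slid (Suc r) 0 N = row_segment slid (Suc r) 0 c @ row_segment slid (Suc r) c N"
    using N_gt by (intro row_segment_split) auto
  moreover have "row_segment slid (Suc r) 0 c = lower_left"
    unfolding lower_left_def by (rule row_segment_cong) (auto simp: slid_def)
  moreover have "row_segment slid (Suc r) c N = row_segment slid (Suc r) (Suc c) N"
    using N_gt by (simp add: row_segment_None slid_def)
  moreover have "row_segment slid (Suc r) (Suc c) N = lower_right"
    unfolding lower_right_def by (rule row_segment_cong) (auto simp: slid_def)
  moreover have "row_segment slid k 0 N = row_segment S k 0 N" if "k \<noteq> r" "k \<noteq> Suc r" for k
    using that by (intro row_segment_cong) (auto simp: slid_def)
  then have "concat (map (\<lambda>k. row_segment slid k 0 N) (rev [Suc (Suc r)..<N])) = low_rows"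
    "concat (map (\<lambda>k. row_segment slid k 0 N) (rev [0..<r])) = high_rows"
    unfolding low_rows_def high_rows_def by (auto intro!: arg_cong[where f = concat])
  ultimately show ?thesis using N_gt row_slid by (simp add: reading_rows)
qed

lemma sorted_lower: "sorted_wrt row_le (map l (lower_left @ x # lower_right))"
proof -
  have "row_segment S (Suc r) 0 N = lower_left @ x # lower_right"
  proof -
    have "row_segment S (Suc r) 0 N = row_segment S (Suc r) 0 c @ row_segment S (Suc r) c N"
      using N_gt by (intro row_segment_split) auto
    then show ?thesis using N_gt x by (simp add: row_segment_Some lower_right_def lower_left_def)
  qed
  then show ?thesis using sorted_row_segment[OF incr compat, of "Suc r" 0 N] by simp
qed

lemma sorted_upper: "sorted_wrt row_le (map l (upper_left @ x # upper_right))"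
  using sorted_row_segment[OF increasing_slid compatible_slid, of r 0 N] row_slid by simp

lemma set_low_rows:
  assumes "v \<in> set low_rows"
  obtains k j where "Suc r < k" "S (k, j) = Some v"
  using assms by (auto simp: low_rows_def set_row_segment Suc_le_eq)

lemma set_lower_left:
  assumes "v \<in> set lower_left"
  obtains j where "j < c" "S (Suc r, j) = Some v"
  using assms by (auto simp: lower_left_def set_row_segment)

lemma set_lower_right:
  assumes "v \<in> set lower_right"
  obtains j where "c < j" "S (Suc r, j) = Some v"
  using assms by (auto simp: lower_right_def set_row_segment Suc_le_eq)

lemma right_columns:
  "length lower_right \<le> length upper_right"
  "j < length lower_right \<Longrightarrow> col_le (map l upper_right ! j) (map l lower_right ! j)"
proof -
  \<comment> \<open>The column in which row \<open>r + 1\<close> has ended. Before it both rows are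
    filled, by \<open>above_right\<close>; from it on only row \<open>r\<close> can
    continue.\<close>
  define t where "t = (LEAST t. Suc c \<le> t \<and> (Suc r, t) \<notin> D)"
  have "Suc c \<le> N \<and> (Suc r, N) \<notin> D" using N_gt bound by auto
  then have t: "Suc c \<le> t" "(Suc r, t) \<notin> D" "t \<le> N"
    using LeastI[of "\<lambda>t. Suc c \<le> t \<and> (Suc r, t) \<notin> D" N] Least_le[of "\<lambda>t. Suc c \<le> t \<and> (Suc r, t) \<notin> D" N]
    unfolding t_def by auto
  have in_D: "(Suc r, j) \<in> D" if "Suc c \<le> j" "j < t" for j
    using not_less_Least[of j "\<lambda>t. Suc c \<le> t \<and> (Suc r, t) \<notin> D"] that unfolding t_def by auto
  have xD: "(Suc r, c) \<in> D" using S_in_D[OF x] by simp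
  have not_in_D: "(Suc r, j) \<notin> D" if "t \<le> j" for j
    using D_between[OF xD, of "Suc r" j "Suc r" t] t that c_gt by auto
  have full: "S (Suc r, j) \<noteq> None \<and> S (r, j) \<noteq> None" if j: "Suc c \<le> j" "j < t" for j
  proof -
    obtain b where b: "S (Suc r, j) = Some b" using D_obtain[of "(Suc r, j)"] in_D[OF j] by auto
    have "c < j" using j by simp
    from above_right[OF b this] obtain d where "S (r, j) = Some d" .
    then show ?thesis using b by simp
  qed
  have "lower_right = row_segment S (Suc r) (Suc c) t @ row_segment S (Suc r) t N"
    unfolding lower_right_def using t by (intro row_segment_split)
  moreover have "row_segment S (Suc r) t N = []"
    using not_in_D dom_S by (intro row_segment_empty) (metis Diff_iff domIff)
  moreover have "row_segment S (Suc r) (Suc c) t = map (\<lambda>j. the (S (Suc r, j))) [Suc c..<t]"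
    using full by (intro row_segment_full) auto
  ultimately have lower: "lower_right = map (\<lambda>j. the (S (Suc r, j))) [Suc c..<t]" by simp
  have "upper_right = row_segment S r (Suc c) t @ row_segment S r t N"
    unfolding upper_right_def using t by (intro row_segment_split)
  moreover have "row_segment S r (Suc c) t = map (\<lambda>j. the (S (r, j))) [Suc c..<t]"
    using full by (intro row_segment_full) auto
  ultimately have upper: "upper_right = map (\<lambda>j. the (S (r, j))) [Suc c..<t] @ row_segment S r t N" by simp
  show length: "length lower_right \<le> length upper_right" using lower upper by simp
  assume "j < length lower_right"
  then have j: "j < t - Suc c" "Suc c + j < t" using lower by auto
  then obtain b where b: "S (Suc r, Suc c + j) = Some b" using full[of "Suc c + j"] by auto
  obtain d where d: "S (r, Suc c + j) = Some d" "col_le (l d) (l b)"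
    by (rule above_right[OF b]) simp_all
  have "lower_right ! j = b" using lower b j by simp
  moreover have "upper_right ! j = d" using upper d j by (simp add: nth_append)
  ultimately show "col_le (map l upper_right ! j) (map l lower_right ! j)"
    using d(2) \<open>j < length lower_right\<close> length by simp
qed

text \<open>Every entry of row \<open>r\<close> strictly between the diagonal and the hole has an
  entry below it. Apart from these full columns, either row \<open>r + 1\<close> starts earlier,
  which gives \<open>A0\<close>, or row \<open>r\<close> starts on the diagonal, which gives the
  extra letter; the two exclude each other.\<close>

lemma left_columns:
  obtains A0 A C where "lower_left = A0 @ A" "upper_left = (case S (r, r) of None \<Rightarrow> [] | Some y \<Rightarrow> [y]) @ C"
    "list_all2 col_le (map l C) (map l A)" "S (r, r) \<noteq> None \<Longrightarrow> A0 = []" "c = Suc r \<Longrightarrow> C = []"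
proof -
  \<comment> \<open>The first column right of the diagonal in which row \<open>r\<close> has a box.
    The alternative \<open>j = c\<close> gives the value \<open>c\<close> if there is none before
    the hole.\<close>
  define s where "s = (LEAST j. Suc r \<le> j \<and> (j = c \<or> (r, j) \<in> D))"
  have s: "Suc r \<le> s" "s = c \<or> (r, s) \<in> D" "s \<le> c"
    using LeastI[of "\<lambda>j. Suc r \<le> j \<and> (j = c \<or> (r, j) \<in> D)" c]
      Least_le[of "\<lambda>j. Suc r \<le> j \<and> (j = c \<or> (r, j) \<in> D)" c] c_gt
    unfolding s_def by auto
  have left: "(r, j) \<notin> D" if "Suc r \<le> j" "j < s" for j
    using not_less_Least[of j "\<lambda>j. Suc r \<le> j \<and> (j = c \<or> (r, j) \<in> D)"] that unfolding s_def by auto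
  have right: "\<exists>u a. S (r, j) = Some u \<and> S (Suc r, j) = Some a \<and> col_le (l u) (l a)" if j: "s \<le> j" "j < c" for j
  proof -
    have "(r, j) \<in> D" using D_between[of r s r c r j] s hole j by auto
    then obtain u where u: "S (r, j) = Some u" using D_obtain j by (metis nat_neq_iff prod.inject)
    show ?thesis using below_left[OF u] s j u by (metis Suc_le_lessD order_trans)
  qed
  define A where "A = map (\<lambda>j. the (S (Suc r, j))) [s..<c]"
  define C where "C = map (\<lambda>j. the (S (r, j))) [s..<c]"
  have "lower_left = row_segment S (Suc r) 0 s @ row_segment S (Suc r) s c"
    unfolding lower_left_def using s by (intro row_segment_split) auto
  moreover have "row_segment S (Suc r) s c = A"
    unfolding A_def using right by (intro row_segment_full) fastforce
  ultimately have lower: "lower_left = row_segment S (Suc r) 0 s @ A" by simp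
  have "upper_left = row_segment S r 0 s @ row_segment S r s c"
    unfolding upper_left_def using s by (intro row_segment_split) auto
  moreover have "row_segment S r s c = C"
    unfolding C_def using right by (intro row_segment_full) fastforce
  moreover have "row_segment S r 0 s = (case S (r, r) of None \<Rightarrow> [] | Some y \<Rightarrow> [y])"
  proof -
    have "row_segment S r 0 s = row_segment S r 0 r @ row_segment S r r s"
      using s by (intro row_segment_split) auto
    moreover have "row_segment S r 0 r = []"
      using D_bounds S_in_D by (intro row_segment_empty) (meson leD not_None_eq)
    moreover have "row_segment S r (Suc r) s = []"
      using left S_in_D by (intro row_segment_empty) (meson not_None_eq)
    ultimately show ?thesis
      using s row_segment_None[of r s S r] row_segment_Some[of r s S r] by (auto split: option.split)
  qed
  ultimately have upper: "upper_left = (case S (r, r) of None \<Rightarrow> [] | Some y \<Rightarrow> [y]) @ C" by simp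
  have all2: "list_all2 col_le (map l C) (map l A)"
    unfolding A_def C_def using right by (fastforce simp: list_all2_map1 list_all2_map2 list_all2_same)
  have empty: "row_segment S (Suc r) 0 s = []" if "S (r, r) \<noteq> None"
  proof -
    have "(r, r) \<in> D" using that S_in_D by blast
    then have "(r, Suc r) \<in> D" using D_between[OF _ hole, of r r r "Suc r"] c_gt by auto
    then have "s = Suc r" using left[of "Suc r"] s by (metis le_eq_less_or_eq le_refl)
    then show ?thesis using D_bounds S_in_D by (intro row_segment_empty) (metis leD not_None_eq)
  qed
  have "C = []" if "c = Suc r" using s that by (simp add: C_def)
  then show ?thesis using that lower upper all2 empty by blast
qed

text \<open>If the hole is next to the diagonal, the corner used in \<open>below_diagonal\<close> is
  missing. Then \<open>y\<close> and \<open>x\<close> are compared directly: as \<open>x\<close> is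
  unprimed, equal indices would make \<open>y\<close> primed, which is the excluded case.\<close>

lemma index_lower:
  assumes "v \<in> set lower_left \<or> v \<in> set lower_right \<or> v = x" "S (r, r) = Some y"
    "\<not> unpriming"
  shows "index (l y) < index (l v)"
proof (cases "c = Suc r")
  case False
  then show ?thesis using assms below_diagonal[OF assms(2), of "Suc r" _ v] x
    by (auto elim!: set_lower_left set_lower_right)
next
  case True
  have "y < x" using S_less[OF assms(2) x] True by simp
  then have "col_le (l y) (l x)" using compat_col[OF assms(2) x] by simp
  then have "index (l y) < index (l x)"
    using assms(2,3) True diagonal_unprimed[OF True] unfolding unpriming_def
    by (cases "l x"; cases "l y") (auto simp: col_le_def less_letter_def)
  moreover have "lower_left = []"
    using D_bounds S_in_D True unfolding lower_left_def
    by (intro row_segment_empty) (metis leD not_None_eq)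
  moreover have "row_le (l x) (l v)" if "v \<in> set lower_right"
    using sorted_lower that by (simp add: sorted_wrt_append)
  ultimately show ?thesis using assms(1) row_le_index[of "l x" "l v"] by auto
qed

text \<open>The entry of box \<open>(r + 1, r + 1)\<close> is the \<open>u\<close>. Together with
  \<open>index_lower\<close> this puts the lower rows at least two indices above a diagonal entry of
  index \<open>i\<close>, so the walk is still at the origin when row \<open>r + 1\<close>
  begins.\<close>

lemma index_low_rows:
  assumes "v \<in> set low_rows" "S (r, r) = Some y"
  shows "\<exists>u. (u \<in> set lower_left \<or> u = x) \<and> index (l u) < index (l v)"
proof -
  obtain k j where v: "Suc r < k" "S (k, j) = Some v" using assms(1) by (rule set_low_rows)
  have "(Suc r, Suc r) \<in> D"
    using D_between[of r r "Suc r" c "Suc r" "Suc r"] S_in_D[OF assms(2)] S_in_D[OF x] c_gt by simp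
  then obtain u where u: "S (Suc r, Suc r) = Some u" using D_obtain by (metis n_not_Suc_n prod.inject)
  have "u \<in> set lower_left \<or> u = x"
  proof (cases "c = Suc r")
    case True
    then show ?thesis using u x by simp
  next
    case False
    then have "Suc r < c" using c_gt by simp
    then have "u \<in> set lower_left" using u unfolding lower_left_def set_row_segment by blast
    then show ?thesis ..
  qed
  moreover have "index (l u) < index (l v)" using below_diagonal[OF u v(2,1)] by simp
  ultimately show ?thesis by blast
qed

text \<open>A diagonal entry \<open>y\<close> obstructs the Knuth argument only if its index is
  \<open>i\<close>, and then the walk starts these rows at the origin. If the index is
  \<open>i + 1\<close>, then \<open>x\<close> has a larger index and is inert; if it is neither,
  \<open>y\<close> is inert.\<close>

lemma walk_slid:
  assumes "\<not> unpriming"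
  shows "foldl (pair_step i) (0, 0) (map l (reading N slid)) = foldl (pair_step i) (0, 0) (map l (reading N S))"
proof -
  obtain A0 A C where split: "lower_left = A0 @ A"
    "upper_left = (case S (r, r) of None \<Rightarrow> [] | Some y \<Rightarrow> [y]) @ C"
    "list_all2 col_le (map l C) (map l A)" "S (r, r) \<noteq> None \<Longrightarrow> A0 = []"
    "c = Suc r \<Longrightarrow> C = []"
    by (rule left_columns) blast
  note sorted = sorted_lower[unfolded split(1)] sorted_upper[unfolded split(2)]
  have "walk_equiv i (map l A @ l x # map l lower_right @ map l C @ map l upper_right)
    (map l A @ map l lower_right @ map l C @ l x # map l upper_right)"
    using sorted right_columns
    by (intro knuth_slide_up split(3)) (auto simp: sorted_wrt_append)
  from walk_equiv_append[OF walk_equiv_refl[of i "map l A0"] this]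
  have equiv: "walk_equiv i (map l lower_left @ l x # map l lower_right @ map l C @ map l upper_right)
    (map l lower_left @ map l lower_right @ map l C @ l x # map l upper_right)"
    using split(1) by simp
  note equiv = equiv[unfolded walk_equiv_def, rule_format, of "foldl (pair_step i) (0, 0) (map l low_rows)"]
  have main: "foldl (pair_step i) (0, 0) (map l low_rows @ map l lower_left @ l x # map l lower_right @ map l upper_left @ map l upper_right)
     = foldl (pair_step i) (0, 0) (map l low_rows @ map l lower_left @ map l lower_right @ map l upper_left @ l x # map l upper_right)"
  proof (cases "S (r, r)")
    case None
    then show ?thesis using equiv split(2) by simp
  next
    case (Some y)
    then have upper: "upper_left = y # C" using split(2) by simp
    have lower: "lower_left = A" using split(1,4) Some by simp
    consider "index (l y) = i" | "index (l y) = Suc i" | "index (l y) \<noteq> i" "index (l y) \<noteq> Suc i" by blast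
    then show ?thesis
    proof cases
      case 1
      have low: "Suc i \<le> index (l v)" if "v \<in> set lower_left \<or> v = x" for v
        using index_lower[OF _ Some assms, of v] that 1 by auto
      have low_rows: "Suc i < index (l v)" if v: "v \<in> set low_rows" for v
        using index_low_rows[OF v Some] low by fastforce
      have "foldl (pair_step i) (0, 0) (map l low_rows @ map l A @ l x # map l lower_right @ l y # map l C @ map l upper_right)
        = foldl (pair_step i) (0, 0) (map l low_rows @ map l A @ map l lower_right @ l y # map l C @ l x # map l upper_right)"
        using low low_rows lower 1 split(3) sorted_lower sorted_upper right_columns upper
        by (intro walk_slide_up_diagonal) auto
      then show ?thesis using lower upper by simp
    next
      case 2
      then have "Suc i < index (l x)" using index_lower[OF _ Some assms, of x] by simp
      then show ?thesis by simp
    next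
      case 3
      then show ?thesis using equiv upper by simp
    qed
  qed
  have foldl_eq: "foldl (pair_step i) s (u @ w) = foldl (pair_step i) s (v @ w)"
    if "foldl (pair_step i) s u = foldl (pair_step i) s v" for s u v w
    using that by simp
  show ?thesis
    using foldl_eq[OF main[symmetric], of "map l high_rows"] by (simp add: reading_S reading_slid)
qed

text \<open>The two rows are \<open>x\<close> with \<open>lower_right\<close>, and \<open>y\<close>
  with \<open>upper_right\<close>, where \<open>x\<close> and \<open>y\<close> are \<open>k\<close>
  and \<open>k'\<close>. For \<open>k = i + 1\<close> all that is read before or between them is
  inert, and the walk just climbs the y-axis twice; for \<open>k = i\<close> the origin comparison
  applies.\<close>

lemma walk_slid_unpriming:
  assumes "unpriming" "S (r, r) = Some y"
  shows "foldl (pair_step i) (0, 0) (map (l(y := l x)) (reading N slid)) =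
    foldl (pair_step i) (0, 0) (map l (reading N S))"
proof -
  have c: "c = Suc r" and y: "primed (l y)" "index (l y) = index (l x)"
    using assms unfolding unpriming_def by auto
  obtain k where lx: "l x = Letter k False" and ly: "l y = Letter k True"
    using slide_state_slid_unpriming(2)[OF assms] y by (metis (full_types) letter.collapse)
  have left: "lower_left = []"
    using D_bounds S_in_D c unfolding lower_left_def
    by (intro row_segment_empty) (metis leD not_None_eq)
  obtain C where "upper_left = (case S (r, r) of None \<Rightarrow> [] | Some y \<Rightarrow> [y]) @ C" "C = []"
    by (rule left_columns) (use c in blast)
  then have upper: "upper_left = [y]" using assms(2) by simp
  have once: "v \<noteq> y" if "S (k, j) = Some v" "k \<noteq> r \<or> r < j" for k j v
    using S_inj[OF assms(2), of "(k, j)"] that by auto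
  have y_notin: "y \<notin> set low_rows" "y \<notin> set lower_right" "y \<notin> set upper_right" "y \<notin> set high_rows"
    using once c unfolding low_rows_def lower_right_def upper_right_def high_rows_def
    by (fastforce simp: set_row_segment)+
  have "x \<noteq> y" using once[OF x] by simp
  have upd: "map (l(y := a)) w = map l w" if "y \<notin> set w" for w a
    using that by simp
  have low_rows: "k < index (l v)" if v: "v \<in> set low_rows" for v
    using index_low_rows[OF v assms(2)] left lx by simp
  have lower_right: "k < index (l v)" if v: "v \<in> set lower_right" for v
  proof -
    obtain j where "c < j" "S (Suc r, j) = Some v" using v by (rule set_lower_right)
    then obtain d where "row_le (l x) (l d)" "col_le (l d) (l v)" using above_right by metis
    then show ?thesis using row_col_index_less[of "l x"] lx by fastforce
  qed
  have sorted: "sorted_wrt row_le (map l lower_right)" "sorted_wrt row_le (l x # map l upper_right)"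
    using sorted_lower sorted_upper by (auto simp: sorted_wrt_append)
  have main: "foldl (pair_step i) (0, 0) (map l low_rows @ l x # map l lower_right @ l y # map l upper_right)
     = foldl (pair_step i) (0, 0) (map l low_rows @ map l lower_right @ l x # l x # map l upper_right)"
  proof -
    consider "k = i" | "k = Suc i" | "k \<noteq> i" "k \<noteq> Suc i" by blast
    then show ?thesis
    proof cases
      case 1
      \<comment> \<open>The right neighbour of \<open>x\<close> has index above \<open>i\<close> and
        at most that of the \<open>i + 1\<close> in a lower row. So it has index
        \<open>i + 1\<close>, and the step down to a letter of the same index makes it
        primed.\<close>
      have first: "\<exists>B'. map l lower_right = Letter (Suc i) True # B'"
        if v: "v \<in> set low_rows" "index (l v) = Suc i" for v
      proof -
        obtain p j where kj: "Suc r < p" "S (p, j) = Some v" using v(1) by (rule set_low_rows)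
        then have "p \<le> j" using S_in_D D_bounds by blast
        have "(Suc r, Suc (Suc r)) \<in> D"
          using D_between[of "Suc r" c p j "Suc r" "Suc (Suc r)"] S_in_D[OF x] S_in_D[OF kj(2)] c kj \<open>p \<le> j\<close> by simp
        then obtain b where b: "S (Suc r, Suc (Suc r)) = Some b" using D_obtain by (metis n_not_Suc_n prod.inject)
        have "b \<in> set lower_right" using b c S_in_D[OF b] bound unfolding lower_right_def set_row_segment by auto
        then have "k < index (l b)" by (rule lower_right)
        moreover have "col_le (l b) (l v)" using col_letters[OF b kj(2,1)] kj \<open>p \<le> j\<close> by simp
        ultimately have "l b = Letter (Suc i) True"
          using v(2) 1 by (cases "l b"; cases "l v") (auto simp: col_le_def less_letter_def)
        moreover have "lower_right = b # row_segment S (Suc r) (Suc (Suc c)) N"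
          using b c S_in_D[OF b] bound unfolding lower_right_def by (intro row_segment_Some) auto
        ultimately show ?thesis by simp
      qed
      have "foldl (pair_step i) (0, 0) (map l low_rows @ Letter i False # map l lower_right @ Letter i True # map l upper_right)
        = foldl (pair_step i) (0, 0) (map l low_rows @ map l lower_right @ Letter i False # Letter i False # map l upper_right)"
      proof (rule walk_slide_up_unprime)
        show "Suc i \<le> index a" if "a \<in> set (map l low_rows)" for a using low_rows that 1 by (auto simp: Suc_le_eq)
        show "\<exists>B'. map l lower_right = Letter (Suc i) True # B'" if "a \<in> set (map l low_rows)" "index a = Suc i" for a
          using first that by auto
        show "Suc i \<le> index b" if "b \<in> set (map l lower_right)" for b using lower_right that 1 by (auto simp: Suc_le_eq)
        show "sorted_wrt row_le (map l lower_right)" by (rule sorted)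
        show "sorted_wrt row_le (Letter i False # map l upper_right)" using sorted(2) lx 1 by simp
      qed (use right_columns in auto)
      then show ?thesis using lx ly 1 by simp
    next
      case 2
      have "foldl (pair_step i) s (map l low_rows) = s" "foldl (pair_step i) s (map l lower_right) = s" for s
        using low_rows lower_right 2 by (force intro!: walk_inert)+
      then show ?thesis using lx ly 2 by simp
    next
      case 3
      then show ?thesis using lx ly by simp
    qed
  qed
  have foldl_eq: "foldl (pair_step i) s (u @ w) = foldl (pair_step i) s (v @ w)"
    if "foldl (pair_step i) s u = foldl (pair_step i) s v" for s u v w
    using that by simp
  have "map (l(y := l x)) (reading N slid) = (map l low_rows @ map l lower_right @ l x # l x # map l upper_right) @ map l high_rows"
    using y_notin left upper \<open>x \<noteq> y\<close> by (simp add: reading_slid upd)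
  moreover have "map l (reading N S) = (map l low_rows @ l x # map l lower_right @ l y # map l upper_right) @ map l high_rows"
    using left upper by (simp add: reading_S)
  ultimately show ?thesis using foldl_eq[OF main[symmetric], of "map l high_rows"] by simp
qed

end

section \<open>Slide paths\<close>

lemma (in slide_up) ran_slid: "ran slid = ran S"
proof (rule set_eqI, rule iffI)
  fix v assume "v \<in> ran slid"
  then obtain b where b: "slid b = Some v" by (auto simp: ran_def)
  show "v \<in> ran S"
    by (cases rule: slid_cases[OF b]) (use x in \<open>auto intro: ranI\<close>)
next
  fix v assume "v \<in> ran S"
  then obtain b where b: "S b = Some v" by (auto simp: ran_def)
  then show "v \<in> ran slid"
    using slid_other[OF b] slid_new x by (cases "b = (Suc r, c)") (auto intro: ranI)
qed

text \<open>Labels change only by lost primes, so their indices persist; with the unchanged range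
  this gives the weight. The final two conclusions record why the path stopped and serve to locate
  \<open>e'\<close> at a corner.\<close>

lemma slide_path:
  assumes "jdt_path S e S' e'" "slide_state D S e l" "D \<subseteq> {..<N} \<times> {..<N}"
  shows "\<exists>l'. slide_state D S' e' l' \<and> (\<forall>v. index (l' v) = index (l v)) \<and> ran S' = ran S \<and>
    (\<forall>i. foldl (pair_step i) (0, 0) (map l' (reading N S')) = foldl (pair_step i) (0, 0) (map l (reading N S))) \<and>
    S' (fst e', Suc (snd e')) = None \<and> S' (Suc (fst e'), snd e') = None"
  using assms
proof (induction arbitrary: l rule: jdt_path.induct)
  case (stop S r c)
  then show ?case by (intro exI[of _ l]) auto
next
  case (right S r c x S' e')
  interpret slide_state D S "(r, c)" l by fact
  define T where "T = S((r, c) := Some x, (r, Suc c) := None)"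
  have T: "slide_state D T (r, Suc c) l" "reading N T = reading N S"
    using slide_right[of r c x N] right by (simp_all add: T_def)
  then interpret T: slide_state D T "(r, Suc c)" l by simp
  have "ran T = ran S"
    using set_reading[of T N] set_reading[of S N] T(2) dom_S T.dom_S right.prems by (metis Diff_subset order_trans)
  moreover have "S((r, c) := Some x, (r, c + 1) := None) = T" by (simp add: T_def)
  ultimately show ?case using right.IH[of l] right.prems T by (simp del: fun_upd_apply)
next
  case (down S r c x S' e')
  interpret slide_state D S "(r, c)" l by fact
  interpret bounded_slide_up D S r c l x N
    using down by unfold_locales auto
  have slid: "slid = S((r, c) := Some x, (Suc r, c) := None)" by (simp add: slid_def)
  have "\<exists>l'. slide_state D slid (Suc r, c) l' \<and> (\<forall>v. index (l' v) = index (l v)) \<and>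
    (\<forall>i. foldl (pair_step i) (0, 0) (map l' (reading N slid)) = foldl (pair_step i) (0, 0) (map l (reading N S)))"
  proof (cases unpriming)
    case True
    then obtain y where y: "S (r, r) = Some y" "index (l y) = index (l x)" unfolding unpriming_def by auto
    then have "index ((l(y := l x)) v) = index (l v)" for v by simp
    then show ?thesis using slide_state_slid_unpriming(1)[OF True y(1)] walk_slid_unpriming[OF True y(1)] by blast
  next
    case False
    then show ?thesis using slide_state_slid walk_slid by blast
  qed
  then obtain l' where l': "slide_state D slid (Suc r, c) l'" "\<And>v. index (l' v) = index (l v)"
    "\<And>i. foldl (pair_step i) (0, 0) (map l' (reading N slid)) = foldl (pair_step i) (0, 0) (map l (reading N S))"
    by blast
  show ?case using down.IH[of l'] down.prems l' ran_slid by (simp add: slid[symmetric] del: fun_upd_apply)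
qed

text \<open>The sum of the coordinates of the hole grows within a bounded square, and injectivity
  makes one neighbour strictly smaller whenever there are two.\<close>

lemma slide_path_exists:
  assumes "slide_state D S e l" "D \<subseteq> {..<N} \<times> {..<N}"
  shows "\<exists>S' e'. jdt_path S e S' e'"
  using assms(1)
proof (induction "2 * N - (fst e + snd e)" arbitrary: S e l rule: less_induct)
  case less
  interpret slide_state D S e l by fact
  obtain r c where e: "e = (r, c)" by (cases e)
  have bound: "r < N" "c < N" using hole assms(2) e by auto
  consider "S (r, Suc c) = None" "S (Suc r, c) = None"
    | x where "S (r, Suc c) = Some x" "\<And>y. S (Suc r, c) = Some y \<Longrightarrow> x < y"
    | x where "S (Suc r, c) = Some x" "\<And>y. S (r, Suc c) = Some y \<Longrightarrow> x < y"
  proof (cases "S (r, Suc c)"; cases "S (Suc r, c)")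
    fix x y assume xy: "S (r, Suc c) = Some x" "S (Suc r, c) = Some y"
    then have "x \<noteq> y" using S_inj[of "(r, Suc c)" x "(Suc r, c)"] by auto
    then show ?thesis using that(2,3) xy by (metis nat_neq_iff option.inject)
  qed (use that in auto)
  then show ?case
  proof cases
    case 1
    then show ?thesis using jdt_path.stop[of S r c] e by auto
  next
    case (2 x)
    have s: "slide_state D (S((r, c) := Some x, (r, Suc c) := None)) (r, Suc c) l"
      using slide_right(1)[OF e 2 assms(2)] .
    have "\<exists>S' e'. jdt_path (S((r, c) := Some x, (r, Suc c) := None)) (r, Suc c) S' e'"
      by (rule less.hyps[OF _ s]) (use bound e in simp)
    then obtain S' e' where "jdt_path (S((r, c) := Some x, (r, c + 1) := None)) (r, c + 1) S' e'" by auto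
    then have "jdt_path S (r, c) S' e'" using 2 by (intro jdt_path.right[of S r c x]) auto
    then show ?thesis using e by blast
  next
    case (3 x)
    interpret slide_up D S r c l x
      using slide_state_axioms 3 e by (simp add: slide_up_def slide_up_axioms_def)
    have slid: "slid = S((r, c) := Some x, (r + 1, c) := None)" by (simp add: slid_def)
    obtain l' where s: "slide_state D slid (Suc r, c) l'"
      using slide_state_slid slide_state_slid_unpriming(1) unfolding unpriming_def by blast
    have "\<exists>S' e'. jdt_path slid (Suc r, c) S' e'"
      by (rule less.hyps[OF _ s]) (use bound e in simp)
    then obtain S' e' where "jdt_path slid (r + 1, c) S' e'" by auto
    then have "jdt_path S (r, c) S' e'" using 3 by (intro jdt_path.down[of S r c x]) (auto simp: slid)
    then show ?thesis using e by blast
  qed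
qed

section \<open>Shifted diagrams\<close>

lemma diagram_iff: "(r, c) \<in> diagram lam \<longleftrightarrow> 1 \<le> r \<and> r \<le> c \<and> c < r + part lam r"
  by (auto simp: diagram_def part_def split: if_splits)

lemma strict_partition_iff:
  "strict_partition lam \<longleftrightarrow> (\<forall>i j. i < j \<longrightarrow> j < length lam \<longrightarrow> lam ! j < lam ! i) \<and> (\<forall>i < length lam. 0 < lam ! i)"
  by (auto simp: strict_partition_def sorted_wrt_iff_nth_less in_set_conv_nth)

lemma part_less:
  "strict_partition lam \<Longrightarrow> 1 \<le> r \<Longrightarrow> r < r' \<Longrightarrow> r' \<le> length lam \<Longrightarrow> part lam r' < part lam r"
  by (simp add: strict_partition_iff part_def)

lemma part_pos: "strict_partition lam \<Longrightarrow> 1 \<le> r \<Longrightarrow> r \<le> length lam \<Longrightarrow> 0 < part lam r"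
  by (simp add: strict_partition_iff part_def)

lemma part_shift:
  assumes "strict_partition lam" "1 \<le> r" "r \<le> r'" "r' \<le> length lam"
  shows "r' + part lam r' \<le> r + part lam r"
  using assms(3,4)
proof (induction r' rule: dec_induct)
  case (step m)
  then have "part lam (Suc m) < part lam m" using assms by (intro part_less) auto
  then show ?case using step by simp
qed simp

lemma diagram_ideal:
  assumes "strict_partition lam" "(r', c') \<in> diagram lam" "1 \<le> r" "r \<le> r'" "r \<le> c" "c \<le> c'"
  shows "(r, c) \<in> diagram lam"
proof -
  have "r' \<le> length lam" using assms(2) by (simp add: diagram_def)
  then show ?thesis using part_shift[OF assms(1,3,4)] assms by (simp add: diagram_iff)
qed

lemma convex_skew_diagram:
  assumes "strict_partition lam" "strict_partition mu"
  shows "convex_shape (diagram lam - diagram mu)"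
  unfolding convex_shape_def
proof (intro conjI allI impI)
  fix r c assume "(r, c) \<in> diagram lam - diagram mu"
  then show "1 \<le> r" "r \<le> c" by (auto simp: diagram_iff)
next
  fix r c r' c' a b
  assume *: "(r, c) \<in> diagram lam - diagram mu" "(r', c') \<in> diagram lam - diagram mu"
    "r \<le> a" "a \<le> r'" "c \<le> b" "b \<le> c'" "a \<le> b"
  then have "1 \<le> r" "r \<le> c" by (auto simp: diagram_iff)
  then show "(a, b) \<in> diagram lam - diagram mu"
    using * diagram_ideal[OF assms(1), of r' c' a b] diagram_ideal[OF assms(2), of a b r c] by auto
qed

lemma finite_diagram: "finite (diagram lam)"
proof (rule finite_subset)
  show "diagram lam \<subseteq> (SIGMA r:{..length lam}. {..<r + part lam r})" by (auto simp: diagram_def)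
qed auto

lemma diagram_bound: "\<exists>N > k. diagram lam \<subseteq> {..<N} \<times> {..<N}"
proof -
  have "finite (insert k (fst ` diagram lam \<union> snd ` diagram lam))" using finite_diagram by simp
  then obtain N where "\<forall>n \<in> insert k (fst ` diagram lam \<union> snd ` diagram lam). n < N"
    using finite_nat_set_iff_bounded by blast
  then have N: "k < N" "\<And>b. b \<in> diagram lam \<Longrightarrow> fst b < N \<and> snd b < N" by auto
  then show ?thesis by (intro exI[of _ N]) fastforce
qed

text \<open>Either a last row of length 1 disappears or a row is shortened. In the second case the
  missing box below forces the next part to be smaller by at least two, so the parts remain strictly
  decreasing.\<close>

lemma remove_corner:
  assumes lam: "strict_partition lam" and rc: "(r, c) \<in> diagram lam" "(r, Suc c) \<notin> diagram lam" "(Suc r, c) \<notin> diagram lam"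
  shows "\<exists>lam'. strict_partition lam' \<and> diagram lam' = diagram lam - {(r, c)}"
proof -
  have r: "1 \<le> r" "r \<le> length lam" "r \<le> c" using rc(1) by (auto simp: diagram_def)
  have c: "Suc c = r + part lam r" using rc(1,2) by (auto simp: diagram_iff)
  show ?thesis
  proof (cases "part lam r = 1")
    case True
    have "r = length lam"
    proof (rule ccontr)
      assume "r \<noteq> length lam"
      then have "part lam (length lam) < part lam r" using r by (intro part_less[OF lam]) auto
      moreover have "0 < part lam (length lam)" using r by (intro part_pos[OF lam]) auto
      ultimately show False using True by simp
    qed
    moreover have "part (butlast lam) k = (if k = length lam then 0 else part lam k)" for k
      by (auto simp: part_def nth_butlast)
    ultimately have "diagram (butlast lam) = diagram lam - {(r, c)}"
      using True c by (auto simp: diagram_iff split: if_splits)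
    moreover have "strict_partition (butlast lam)"
      using lam by (auto simp: strict_partition_iff nth_butlast)
    ultimately show ?thesis by blast
  next
    case False
    have big: "1 < part lam r" using False part_pos[OF lam r(1,2)] by simp
    define lam' where "lam' = lam[r - 1 := part lam r - 1]"
    have part': "part lam' k = (if k = r then part lam r - 1 else part lam k)" for k
      using r by (auto simp: part_def nth_list_update lam'_def)
    have "diagram lam' = diagram lam - {(r, c)}"
      using big c by (auto simp: diagram_iff part' split: if_splits)
    moreover have "strict_partition lam'"
    proof -
      have below: "lam ! j < part lam r - 1" if "r - 1 < j" "j < length lam" for j
      proof -
        have "part lam (Suc r) < part lam r - 1"
          using rc(3) c big by (auto simp: diagram_iff)
        moreover have "lam ! j \<le> part lam (Suc r)"
        proof (cases "j = r")
          case False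
          then have "part lam (Suc j) < part lam (Suc r)" using that by (intro part_less[OF lam]) auto
          then show ?thesis using that by (simp add: part_def)
        qed (use that in \<open>simp add: part_def\<close>)
        ultimately show ?thesis by simp
      qed
      have "part lam r = lam ! (r - 1)" using r by (simp add: part_def)
      moreover have "r - 1 < length lam" using r by simp
      moreover have "lam ! (r - 1) - 1 < lam ! i" if "i < r - 1" for i
      proof -
        have "lam ! (r - 1) < lam ! i" using lam that \<open>r - 1 < length lam\<close> by (simp add: strict_partition_iff)
        then show ?thesis by simp
      qed
      ultimately show ?thesis using lam big below
        unfolding strict_partition_iff lam'_def by (simp add: nth_list_update)
    qed
    ultimately show ?thesis by blast
  qed
qed

section \<open>The reading order of a skew shape\<close>

lemma sorted_reading_boxes: "sorted_wrt before (reading_boxes T)"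
proof -
  have sorted: "sorted_wrt before (concat (map (\<lambda>r. map (Pair r) [f r..<g r]) rs))"
    if "sorted_wrt (>) rs" for rs and f g :: "nat \<Rightarrow> nat"
    using that
  proof (induction rs)
    case (Cons r rs)
    have "sorted_wrt before (map (Pair r) [f r..<g r])"
      by (simp add: sorted_wrt_map before_def)
    moreover have "before (r, j) (r', j')" if "r' \<in> set rs" for r' j j'
      using Cons.prems that by (simp add: before_def)
    ultimately show ?case using Cons by (auto simp: sorted_wrt_append)
  qed simp
  show ?thesis
    unfolding reading_boxes_def by (rule sorted) (simp add: sorted_wrt_rev del: upt_Suc)
qed

lemma set_reading_boxes:
  assumes "strict_partition (outer T)" "strict_partition (inner T)"
  shows "set (reading_boxes T) = diagram (outer T) - diagram (inner T)"
proof -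
  have mem: "(r, c) \<in> set (reading_boxes T) \<longleftrightarrow>
    1 \<le> r \<and> r \<le> length (outer T) \<and> r + part (inner T) r \<le> c \<and> c < r + part (outer T) r" for r c
    unfolding reading_boxes_def by (force simp del: upt_Suc)
  have len: "c < r + part (outer T) r \<Longrightarrow> r \<le> c \<Longrightarrow> r \<le> length (outer T)" for r c
    by (rule ccontr) (simp add: part_def)
  have "(r, c) \<in> set (reading_boxes T) \<longleftrightarrow> (r, c) \<in> diagram (outer T) - diagram (inner T)" for r c
    using len[of c r] unfolding mem Diff_iff diagram_iff by linarith
  then show ?thesis by (intro set_eqI) (metis prod.exhaust)
qed

lemma distinct_reading_boxes: "distinct (reading_boxes T)"
proof -
  have "\<not> before b b" for b by (simp add: before_def)
  then have distinct: "distinct bs" if "sorted_wrt before bs" for bs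
    using that by (induction bs) auto
  show ?thesis by (rule distinct[OF sorted_reading_boxes])
qed

lemma map_reading_boxes:
  assumes "strict_partition (outer T)" "strict_partition (inner T)" "diagram (inner T) \<subseteq> diagram (outer T)"
    and dom: "dom S = diagram (outer T) - diagram (inner T)"
    and N: "diagram (outer T) \<subseteq> {..<N} \<times> {..<N}" "length (outer T) < N"
  shows "map (\<lambda>b. the (S b)) (reading_boxes T) = reading N S"
proof -
  define row where "row r = map (\<lambda>j. the (S (r, j))) [r + part (inner T) r..<r + part (outer T) r]" for r
  have in_dom: "S (r, j) = None \<longleftrightarrow> \<not> (1 \<le> r \<and> r + part (inner T) r \<le> j \<and> j < r + part (outer T) r)" for r j
  proof -
    have "S (r, j) = None \<longleftrightarrow> (r, j) \<notin> dom S" by auto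
    then show ?thesis unfolding dom by (auto simp: diagram_iff)
  qed
  have row: "row_segment S r 0 N = row r" if r: "1 \<le> r" "r \<le> length (outer T)" for r
  proof -
    let ?a = "r + part (inner T) r" and ?b = "r + part (outer T) r"
    have pos: "0 < part (outer T) r" using part_pos[OF assms(1) r] .
    then have "(r, ?b - 1) \<in> diagram (outer T)" using r by (auto simp: diagram_iff)
    then have "?b - 1 < N" using N by auto
    then have b: "?b \<le> N" by simp
    have a: "?a \<le> ?b"
    proof (rule ccontr)
      assume "\<not> ?a \<le> ?b"
      then have "(r, ?b) \<in> diagram (inner T)" using r by (auto simp: diagram_iff)
      then have "(r, ?b) \<in> diagram (outer T)" using assms(3) by blast
      then show False by (simp add: diagram_iff)
    qed
    have "row_segment S r 0 N = row_segment S r 0 ?a @ row_segment S r ?a ?b @ row_segment S r ?b N"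
      using row_segment_split[of 0 ?a N S r] row_segment_split[of ?a ?b N S r] a b by simp
    moreover have "row_segment S r 0 ?a = []" "row_segment S r ?b N = []"
      by (intro row_segment_empty; simp add: in_dom)+
    moreover have "row_segment S r ?a ?b = row r"
      unfolding row_def using r by (intro row_segment_full) (simp add: in_dom)
    ultimately show ?thesis by simp
  qed
  have empty: "row_segment S r 0 N = []" if "r = 0 \<or> length (outer T) < r" for r
    using that by (intro row_segment_empty) (auto simp: in_dom part_def)
  have "[0..<N] = [0] @ [1..<Suc (length (outer T))] @ [Suc (length (outer T))..<N]"
    using N(2) upt_add_eq_append[of 1 "Suc (length (outer T))" "N - Suc (length (outer T))"]
    by (simp add: upt_conv_Cons del: upt_Suc)
  then have "reading N S = concat (map (\<lambda>r. row_segment S r 0 N) (rev [Suc (length (outer T))..<N]))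
      @ concat (map (\<lambda>r. row_segment S r 0 N) (rev [1..<Suc (length (outer T))])) @ row_segment S 0 0 N"
    by (simp add: reading_def del: upt_Suc)
  moreover have "concat (map (\<lambda>r. row_segment S r 0 N) (rev [Suc (length (outer T))..<N])) = []"
    using empty by (auto simp del: upt_Suc)
  moreover have "map (\<lambda>r. row_segment S r 0 N) (rev [1..<Suc (length (outer T))]) = map row (rev [1..<Suc (length (outer T))])"
    using row by (intro map_cong) (auto simp del: upt_Suc)
  ultimately have "reading N S = concat (map row (rev [1..<Suc (length (outer T))]))"
    using empty[of 0] by (simp only: append_Nil append_Nil2 simp_thms)
  then show ?thesis by (simp add: reading_boxes_def row_def[abs_def] map_concat comp_def del: upt_Suc)
qed

section \<open>Standardization\<close>

lemma std_before_irrefl: "\<not> std_before w k k"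
  by (simp add: std_before_def)

lemma std_before_trans: "std_before w i j \<Longrightarrow> std_before w j k \<Longrightarrow> std_before w i k"
  by (auto simp: std_before_def split: if_splits)

lemma std_before_total: "j \<noteq> k \<Longrightarrow> std_before w j k \<or> std_before w k j"
  by (auto simp: std_before_def)

lemma length_std [simp]: "length (std w) = length w"
  by (simp add: std_def)

lemma std_nth: "k < length w \<Longrightarrow> std w ! k = Suc (card {j. j < length w \<and> std_before w j k})"
  by (simp add: std_def)

lemma std_mono:
  assumes "j < length w" "k < length w" "std_before w j k"
  shows "std w ! j < std w ! k"
proof -
  have "{i. i < length w \<and> std_before w i j} \<subset> {i. i < length w \<and> std_before w i k}"
    using assms std_before_trans std_before_irrefl by blast
  then have "card {i. i < length w \<and> std_before w i j} < card {i. i < length w \<and> std_before w i k}"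
    by (intro psubset_card_mono) auto
  then show ?thesis using assms by (simp add: std_nth)
qed

lemma std_less:
  assumes "j < length w" "k < length w"
  shows "std w ! j < std w ! k \<longleftrightarrow> std_before w j k"
  using std_mono[OF assms] std_mono[OF assms(2,1)] std_before_total[of j k w]
  by (metis less_asym less_irrefl)

lemma distinct_std: "distinct (std w)"
  unfolding distinct_conv_nth using std_mono std_before_total by (metis length_std less_irrefl)

lemma set_std: "set (std w) = {1..length w}"
proof (rule card_subset_eq)
  have "std w ! k \<le> length w" if "k < length w" for k
  proof -
    have "{j. j < length w \<and> std_before w j k} \<subset> {..<length w}"
      using that std_before_irrefl by blast
    then have "card {j. j < length w \<and> std_before w j k} < card {..<length w}"
      by (intro psubset_card_mono) auto
    then show ?thesis using that by (simp add: std_nth)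
  qed
  then show "set (std w) \<subseteq> {1..length w}" by (auto simp: in_set_conv_nth std_nth)
  show "card (set (std w)) = card {1..length w}" by (simp add: distinct_card[OF distinct_std])
qed simp

text \<open>\<open>std_before\<close> is a strict linear order on positions, so a numbering by
  \<open>1..m\<close> that respects it is determined: each number is recovered by counting the
  smaller ones.\<close>

lemma std_eqI:
  assumes "length u = length w" "set u = {1..length w}"
    and before: "\<And>j k. j < length w \<Longrightarrow> k < length w \<Longrightarrow> u ! j < u ! k \<Longrightarrow> std_before w j k"
  shows "std w = u"
proof (rule nth_equalityI)
  fix k assume "k < length (std w)"
  then have k: "k < length w" by simp
  have dist: "distinct u" using assms(1,2) by (intro card_distinct) simp
  have eq: "{j. j < length w \<and> std_before w j k} = {j. j < length w \<and> u ! j < u ! k}"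
  proof (intro Collect_cong conj_cong refl iffI)
    fix j assume j: "j < length w" "std_before w j k"
    show "u ! j < u ! k"
    proof (rule ccontr)
      assume "\<not> u ! j < u ! k"
      then have "u ! k < u ! j \<or> j = k" using dist j k assms(1) by (metis linorder_neqE_nat nth_eq_iff_index_eq)
      then show False using before[OF k j(1)] j(2) std_before_trans std_before_irrefl by blast
    qed
  qed (use before k in blast)
  have "(\<lambda>j. u ! j) ` {j. j < length w \<and> u ! j < u ! k} = {1..<u ! k}"
  proof (intro equalityI subsetI)
    fix v assume "v \<in> {1..<u ! k}"
    moreover have "u ! k \<le> length w" using assms(1,2) k nth_mem[of k u] by simp
    ultimately have "v \<in> set u" "v < u ! k" using assms(2) by auto
    then show "v \<in> (\<lambda>j. u ! j) ` {j. j < length w \<and> u ! j < u ! k}"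
      using assms(1) by (auto simp: in_set_conv_nth)
  next
    fix v assume "v \<in> (\<lambda>j. u ! j) ` {j. j < length w \<and> u ! j < u ! k}"
    then obtain j where "j < length u" "v = u ! j" "v < u ! k" using assms(1) by auto
    then show "v \<in> {1..<u ! k}" using assms(2) nth_mem[of j u] by auto
  qed
  moreover have "inj_on (\<lambda>j. u ! j) {j. j < length w \<and> u ! j < u ! k}"
    using dist assms(1) by (auto simp: inj_on_def nth_eq_iff_index_eq)
  ultimately have "card {j. j < length w \<and> u ! j < u ! k} = u ! k - 1"
    by (metis card_atLeastLessThan card_image)
  moreover have "1 \<le> u ! k" using assms(1,2) k nth_mem[of k u] by simp
  ultimately show "std w ! k = u ! k" using k eq by (simp add: std_nth)
qed (use assms in simp)

lemma canon_iff: "canon w = w \<longleftrightarrow> (\<forall>k < length w. primed (w ! k) \<longrightarrow> (\<exists>j < k. index (w ! j) = index (w ! k)))"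
proof -
  have len: "length (canon w) = length w" by (simp add: canon_def)
  have "canon w = w \<longleftrightarrow> (\<forall>k < length w. canon w ! k = w ! k)"
    by (simp add: list_eq_iff_nth_eq[of "canon w" w] len)
  moreover have "canon w ! k = w ! k \<longleftrightarrow> (primed (w ! k) \<longrightarrow> (\<exists>j < k. index (w ! j) = index (w ! k)))"
    if "k < length w" for k
  proof -
    have "Letter (index a) False = a \<longleftrightarrow> \<not> primed a" for a by (cases a) auto
    then show ?thesis using that by (auto simp add: canon_def)
  qed
  ultimately show ?thesis by blast
qed

lemma sum_wt: "(\<Sum>t\<le>i. wt w t) = length (filter (\<lambda>a. index a \<le> i) w)"
proof (induction w)
  case (Cons a w)
  have "wt (a # w) t = (if t = index a then 1 else 0) + wt w t" for t
    by (simp add: wt_def)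
  then show ?case using Cons by (simp add: sum.distrib)
qed (simp add: wt_def)

text \<open>The letters of index at most \<open>i\<close> form an initial segment of the order
  \<open>std_before\<close>, and the partial sum of the weight is its size.\<close>

lemma index_le_iff_std:
  assumes k: "k < length w"
  shows "index (w ! k) \<le> i \<longleftrightarrow> std w ! k \<le> (\<Sum>t\<le>i. wt w t)"
proof -
  let ?I = "{j. j < length w \<and> index (w ! j) \<le> i}" and ?B = "{j. j < length w \<and> std_before w j k}"
  have sum: "(\<Sum>t\<le>i. wt w t) = card ?I" by (simp add: sum_wt length_filter_conv_card)
  show ?thesis
  proof
    assume le: "index (w ! k) \<le> i"
    have "insert k ?B \<subseteq> ?I"
      using k le by (auto simp: std_before_def less_letter_def)
    then have "card (insert k ?B) \<le> card ?I" by (intro card_mono) auto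
    then show "std w ! k \<le> (\<Sum>t\<le>i. wt w t)" using k sum std_before_irrefl by (simp add: std_nth)
  next
    assume "std w ! k \<le> (\<Sum>t\<le>i. wt w t)"
    then have "card ?B < card ?I" using k sum by (simp add: std_nth)
    then have "\<not> ?I \<subseteq> ?B" using card_mono[of ?B ?I] by auto
    then obtain j where "j < length w" "index (w ! j) \<le> i" "\<not> std_before w j k" by auto
    then show "index (w ! k) \<le> i" by (auto simp: std_before_def less_letter_def)
  qed
qed

text \<open>In a canonical word the first letter of an index is unprimed, so its number exceeds
  those of all primed letters of that index. Unprimed letters of one index are numbered from left to
  right, so none has a larger number before it.\<close>

lemma primed_iff_std:
  assumes "canon w = w" "k < length w"
  shows "primed (w ! k) \<longleftrightarrow> (\<exists>j < k. index (w ! j) = index (w ! k) \<and> std w ! k < std w ! j)"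
proof
  assume p: "primed (w ! k)"
  define j where "j = (LEAST j. index (w ! j) = index (w ! k))"
  obtain j' where j': "j' < k" "index (w ! j') = index (w ! k)" using assms p canon_iff by blast
  have j: "index (w ! j) = index (w ! k)" "j \<le> j'"
    unfolding j_def using j' by (auto intro: LeastI Least_le)
  then have "j < length w" using j' assms by simp
  have "\<not> primed (w ! j)"
  proof
    assume "primed (w ! j)"
    then obtain i where "i < j" "index (w ! i) = index (w ! j)"
      using assms \<open>j < length w\<close> canon_iff by blast
    then show False using j(1) not_less_Least[of i "\<lambda>j. index (w ! j) = index (w ! k)"] by (simp add: j_def)
  qed
  then have "std_before w k j" using p j(1) by (simp add: std_before_def less_letter_def)
  then show "\<exists>j < k. index (w ! j) = index (w ! k) \<and> std w ! k < std w ! j"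
    using std_less assms(2) \<open>j < length w\<close> j j' by (meson le_less_trans)
next
  assume "\<exists>j < k. index (w ! j) = index (w ! k) \<and> std w ! k < std w ! j"
  then obtain j where j: "j < k" "index (w ! j) = index (w ! k)" "std_before w k j"
    using std_less assms(2) by auto
  then show "primed (w ! k)"
    by (auto simp: std_before_def less_letter_def split: if_splits)
qed

text \<open>The weight cuts the standardization into indices, and within an index the primes are
  visible as numbers smaller than an earlier one. This makes the letters after a slide
  unique.\<close>

lemma word_determined:
  assumes "canon u = u" "canon w = w" "std u = std w" "wt u = wt w"
  shows "u = w"
proof (rule nth_equalityI)
  show len: "length u = length w" using assms(3) by (metis length_std)
  have idx: "index (u ! k) = index (w ! k)" if "k < length u" for k
  proof (rule antisym)
    show "index (u ! k) \<le> index (w ! k)"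
      using index_le_iff_std[of k u "index (w ! k)"] index_le_iff_std[of k w "index (w ! k)"] that len assms by simp
    show "index (w ! k) \<le> index (u ! k)"
      using index_le_iff_std[of k u "index (u ! k)"] index_le_iff_std[of k w "index (u ! k)"] that len assms by simp
  qed
  fix k assume k: "k < length u"
  have "primed (u ! k) \<longleftrightarrow> primed (w ! k)"
    using primed_iff_std[OF assms(1) k] primed_iff_std[OF assms(2), of k] k len idx assms(3) by auto
  then show "u ! k = w ! k" using idx[OF k] by (intro letter.expand) simp
qed

section \<open>Passage between tableaux and labelled standard fillings\<close>

lemma reading_boxes_before:
  assumes "j < length (reading_boxes T)" "k < length (reading_boxes T)"
  shows "before (reading_boxes T ! j) (reading_boxes T ! k) \<longleftrightarrow> j < k"
proof -
  have "before (reading_boxes T ! j) (reading_boxes T ! k)" if "j < k" "k < length (reading_boxes T)" for j k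
    using sorted_wrt_nth_less[OF sorted_reading_boxes that] .
  from this[of j k] this[of k j] show ?thesis
    using assms by (cases j k rule: linorder_cases) (auto simp: before_def)
qed

lemma length_reading_word [simp]: "length (reading_word T) = length (reading_boxes T)"
  by (simp add: reading_word_def)

lemma std_entries_nth:
  "k < length (reading_boxes T) \<Longrightarrow> std_entries T (reading_boxes T ! k) = Some (std (reading_word T) ! k)"
  by (simp add: std_entries_def map_of_zip_nth distinct_reading_boxes)

lemma dom_std_entries: "dom (std_entries T) = set (reading_boxes T)"
  by (simp add: std_entries_def)

lemma std_entries_SomeD:
  assumes "std_entries T b = Some v"
  obtains k where "k < length (reading_boxes T)" "reading_boxes T ! k = b" "v = std (reading_word T) ! k"
proof -
  have "b \<in> set (reading_boxes T)" using assms dom_std_entries by blast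
  then obtain k where "k < length (reading_boxes T)" "reading_boxes T ! k = b" by (auto simp: in_set_conv_nth)
  then show ?thesis using that std_entries_nth[of k T] assms by simp
qed

lemma ran_std_entries: "ran (std_entries T) = {1..length (reading_boxes T)}"
proof -
  have "ran (std_entries T) = set (std (reading_word T))"
  proof (intro set_eqI iffI)
    fix v assume "v \<in> ran (std_entries T)"
    then obtain b where "std_entries T b = Some v" by (auto simp: ran_def)
    then show "v \<in> set (std (reading_word T))" by (rule std_entries_SomeD) auto
  next
    fix v assume "v \<in> set (std (reading_word T))"
    then obtain k where "k < length (reading_boxes T)" "v = std (reading_word T) ! k"
      by (auto simp: in_set_conv_nth)
    then show "v \<in> ran (std_entries T)" using std_entries_nth[of k T] by (auto intro: ranI)
  qed
  then show ?thesis by (simp add: set_std)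
qed

lemma tableau_reading_boxes: "tableau T \<Longrightarrow> set (reading_boxes T) = dom (entry T)"
  by (simp add: tableau_def skew_filling_def set_reading_boxes)

lemma reading_word_nth: "tableau T \<Longrightarrow> k < length (reading_boxes T) \<Longrightarrow>
    entry T (reading_boxes T ! k) = Some (reading_word T ! k)"
  using tableau_reading_boxes[of T] nth_mem[of k "reading_boxes T"] by (auto simp: reading_word_def)

text \<open>\<open>D\<close> is the shape with one more box, the corner about to leave the inner
  shape. The labelling inverts the standardization, which repeats no number.\<close>

lemma tableau_slide_state:
  assumes T: "tableau T" and D: "convex_shape D" "e \<in> D" "dom (entry T) = D - {e}"
  shows "\<exists>l. slide_state D (std_entries T) e l \<and> (\<forall>b. entry T b = map_option l (std_entries T b))"
proof -
  define bs where "bs = reading_boxes T"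
  define w where "w = reading_word T"
  define S where "S = std_entries T"
  have len: "length w = length bs" by (simp add: w_def bs_def)
  have dom_S: "dom S = dom (entry T)" using tableau_reading_boxes[OF T] by (simp add: S_def dom_std_entries)
  have S_Some: "\<exists>k < length bs. bs ! k = b \<and> v = std w ! k \<and> entry T b = Some (w ! k)" if "S b = Some v" for b v
    using that unfolding S_def bs_def w_def by (rule std_entries_SomeD) (use reading_word_nth[OF T] in auto)
  have before_bs: "before (bs ! j) (bs ! k) \<longleftrightarrow> j < k" if "j < length bs" "k < length bs" for j k
    using that reading_boxes_before unfolding bs_def by blast
  have std_lt: "std w ! j < std w ! k \<longleftrightarrow> std_before w j k" if "j < length bs" "k < length bs" for j k
    using that len by (intro std_less) simp_all
  have row_cond: "c < c' \<Longrightarrow> entry T (r, c) = Some a \<Longrightarrow> entry T (r, c') = Some b \<Longrightarrow> a \<le> b \<and> (a = b \<longrightarrow> \<not> primed a)"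
    and col_cond: "r < r' \<Longrightarrow> entry T (r, c) = Some a \<Longrightarrow> entry T (r', c) = Some b \<Longrightarrow> a \<le> b \<and> (a = b \<longrightarrow> primed a)"
    for r r' c c' a b
    using T unfolding tableau_def by blast+
  have row_step: "u < v" if uv: "S (r, c) = Some u" "S (r, c') = Some v" "c < c'" for r c c' u v
  proof -
    obtain j k where jk: "j < length bs" "bs ! j = (r, c)" "u = std w ! j" "entry T (r, c) = Some (w ! j)"
      "k < length bs" "bs ! k = (r, c')" "v = std w ! k" "entry T (r, c') = Some (w ! k)"
      using S_Some uv by metis
    then have "j < k" using before_bs[of j k] uv(3) by (simp add: before_def)
    then have "std_before w j k"
      using row_cond[OF uv(3) jk(4) jk(8)] by (auto simp: std_before_def)
    then show ?thesis using std_lt jk by simp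
  qed
  have col_step: "u < v" if uv: "S (r, c) = Some u" "S (r', c) = Some v" "r < r'" for r r' c u v
  proof -
    obtain j k where jk: "j < length bs" "bs ! j = (r, c)" "u = std w ! j" "entry T (r, c) = Some (w ! j)"
      "k < length bs" "bs ! k = (r', c)" "v = std w ! k" "entry T (r', c) = Some (w ! k)"
      using S_Some uv by metis
    then have "k < j" using before_bs[of k j] uv(3) by (simp add: before_def)
    then have "std_before w j k"
      using col_cond[OF uv(3) jk(4) jk(8)] by (auto simp: std_before_def)
    then show ?thesis using std_lt jk by simp
  qed
  have convex: "convex_shape (dom S)"
    using T convex_skew_diagram dom_S by (simp add: tableau_def skew_filling_def)
  have incr: "increasing S"
    unfolding increasing_def
  proof (intro allI impI)
    fix r c r' c' u v
    assume uv: "S (r, c) = Some u" "S (r', c') = Some v" and le: "r \<le> r'" "c \<le> c'" "(r, c) \<noteq> (r', c')"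
    have in_dom: "(r, c) \<in> dom S" "(r', c') \<in> dom S" using uv by auto
    then have "r \<le> c" using convex unfolding convex_shape_def by blast
    \<comment> \<open>Monotonicity along a row and then down a column; the corner lies in the shape
      because \<open>r \<le> c\<close> and \<open>c \<le> c'\<close>.\<close>
    then have "(r, c') \<in> dom S"
      using convex[unfolded convex_shape_def, THEN conjunct2, rule_format, OF in_dom, of r c'] le by simp
    then obtain m where m: "S (r, c') = Some m" by auto
    have "u \<le> m"
    proof (cases "c = c'")
      case False
      then show ?thesis using row_step[OF uv(1) m] le by simp
    qed (use uv m in simp)
    moreover have "m \<le> v"
    proof (cases "r = r'")
      case False
      then show ?thesis using col_step[OF m uv(2)] le by simp
    qed (use uv m in simp)
    moreover have "u < m \<or> m < v"
      using row_step[OF uv(1) m] col_step[OF m uv(2)] le by fastforce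
    ultimately show "u < v" by linarith
  qed
  define l where "l v = w ! (SOME k. k < length w \<and> std w ! k = v)" for v
  have l_std: "l (std w ! k) = w ! k" if "k < length bs" for k
  proof -
    have "(SOME k'. k' < length w \<and> std w ! k' = std w ! k) = k"
      using that len distinct_std[of w] by (intro some_equality) (auto simp: nth_eq_iff_index_eq)
    then show ?thesis by (simp add: l_def)
  qed
  have "inj_on S (dom S)"
  proof (rule inj_onI)
    fix b b' assume "b \<in> dom S" "b' \<in> dom S" "S b = S b'"
    then obtain v where "S b = Some v" "S b' = Some v" by auto
    then obtain j k where jk: "j < length bs" "bs ! j = b" "v = std w ! j" "k < length bs" "bs ! k = b'" "v = std w ! k"
      using S_Some by metis
    then have "j = k" using len distinct_std[of w] by (simp add: nth_eq_iff_index_eq)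
    then show "b = b'" using jk by simp
  qed
  moreover have "compatible S l"
    unfolding compatible_def
  proof (intro allI impI)
    fix r c r' c' u v
    assume uv: "S (r, c) = Some u" "S (r', c') = Some v" "u < v"
    then obtain j k where jk: "j < length bs" "bs ! j = (r, c)" "u = std w ! j"
      "k < length bs" "bs ! k = (r', c')" "v = std w ! k"
      using S_Some by metis
    have lu: "l u = w ! j" "l v = w ! k" using jk l_std by auto
    have sb: "std_before w j k" using std_lt jk uv(3) by simp
    then consider "w ! j < w ! k" | "w ! j = w ! k" "primed (w ! k)" "k < j" | "w ! j = w ! k" "\<not> primed (w ! k)" "j < k"
      by (auto simp: std_before_def split: if_splits)
    then show "if r < r' then col_le (l u) (l v) else row_le (l u) (l v)"
    proof cases
      case 1
      then show ?thesis using lu by (simp add: row_le_less col_le_less)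
    next
      case 2
      then have "before (r', c') (r, c)" using before_bs[of k j] jk by simp
      moreover have "\<not> (r = r' \<and> c' < c)" using row_step[of r' c' v c u] uv by auto
      ultimately have "r < r'" by (auto simp: before_def)
      then show ?thesis using 2 lu by (simp add: col_le_def)
    next
      case 3
      then have "before (r, c) (r', c')" using before_bs[of j k] jk by simp
      then have "\<not> r < r'" by (auto simp: before_def)
      then show ?thesis using 3 lu by (simp add: row_le_def)
    qed
  qed
  moreover have "canonical S l"
    unfolding canonical_def
  proof (intro allI impI)
    fix b u assume u: "S b = Some u" "primed (l u)"
    then obtain k where k: "k < length bs" "bs ! k = b" "u = std w ! k" using S_Some by metis
    have "canon w = w" using T by (simp add: tableau_def w_def)
    then obtain j where j: "j < k" "index (w ! j) = index (w ! k)"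
      using u k l_std len canon_iff by metis
    then have "before (bs ! j) b" using before_bs[of j k] k by simp
    moreover have "S (bs ! j) = Some (std w ! j)"
      using std_entries_nth[of j T] j k by (simp add: S_def bs_def w_def)
    moreover have "index (l (std w ! j)) = index (l u)" using l_std j k by simp
    ultimately show "\<exists>b' v. before b' b \<and> S b' = Some v \<and> index (l v) = index (l u)" by blast
  qed
  ultimately have "slide_state D S e l"
    using D dom_S incr by unfold_locales auto
  moreover have "entry T b = map_option l (S b)" for b
  proof (cases "S b")
    case None
    then show ?thesis using dom_S by auto
  next
    case (Some v)
    then show ?thesis using S_Some l_std by fastforce
  qed
  ultimately show ?thesis unfolding S_def by blast
qed

text \<open>The way back, once the hole is outside the shape: compatibility orders the numbers as
  \<open>std\<close> orders the letters, so with the numbers \<open>1..m\<close> the criterion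
  \<open>std_eqI\<close> applies, and \<open>canonical\<close> becomes canonicity of the
  word.\<close>

lemma slide_state_tableau:
  assumes "slide_state D S e l" and shape: "strict_partition lam" "strict_partition mu" "diagram mu \<subseteq> diagram lam"
    and dom: "dom S = diagram lam - diagram mu"
    and ran: "ran S = {1..card (dom S)}"
    and pos: "\<And>v. v \<in> ran S \<Longrightarrow> 1 \<le> index (l v)"
  defines "T \<equiv> Filling lam mu (\<lambda>b. map_option l (S b))"
  shows "tableau T" "std_entries T = S"
proof -
  interpret slide_state D S e l by fact
  define bs where "bs = reading_boxes T"
  define w where "w = reading_word T"
  define u where "u = map (\<lambda>b. the (S b)) bs"
  have set_bs: "set bs = dom S" using set_reading_boxes[of T] shape dom by (simp add: bs_def T_def)
  have Sk: "S (bs ! k) = Some (u ! k)" if "k < length bs" for k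
    using that set_bs nth_mem[of k bs] by (auto simp: u_def)
  have w: "w = map l u"
    unfolding w_def reading_word_def u_def bs_def[symmetric] using set_bs by (auto simp: T_def)
  have len: "length w = length bs" "length u = length bs" by (simp_all add: w u_def)
  have before_bs: "before (bs ! j) (bs ! k) \<longleftrightarrow> j < k" if "j < length bs" "k < length bs" for j k
    using that reading_boxes_before unfolding bs_def by blast
  have "card (dom S) = length bs"
    using set_bs distinct_card[OF distinct_reading_boxes[of T]] by (simp add: bs_def)
  moreover have "set u = ran S"
  proof -
    have "set u = (\<lambda>b. the (S b)) ` dom S" by (simp add: u_def set_bs)
    then show ?thesis by (force simp: ran_def image_iff)
  qed
  ultimately have set_u: "set u = {1..length w}" using ran len by simp
  have canon_w: "canon w = w"
    unfolding canon_iff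
  proof (intro allI impI)
    fix k assume k: "k < length w" "primed (w ! k)"
    then have "primed (l (u ! k))" "k < length bs" using w len by auto
    then obtain b v where b: "before b (bs ! k)" "S b = Some v" "index (l v) = index (l (u ! k))"
      using canon Sk unfolding canonical_def by blast
    then have "b \<in> set bs" using set_bs by auto
    then obtain j where j: "j < length bs" "bs ! j = b" by (auto simp: in_set_conv_nth)
    then have "j < k" using before_bs[of j k] b(1) \<open>k < length bs\<close> by simp
    moreover have "v = u ! j" using Sk[OF j(1)] j(2) b(2) by simp
    ultimately show "\<exists>j < k. index (w ! j) = index (w ! k)" using b(3) w len k j by auto
  qed
  have "std w = u"
  proof (rule std_eqI)
    fix j k assume jk: "j < length w" "k < length w" "u ! j < u ! k"
    obtain r c where rc: "bs ! j = (r, c)" by (cases "bs ! j")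
    obtain r' c' where rc': "bs ! k = (r', c')" by (cases "bs ! k")
    have S: "S (r, c) = Some (u ! j)" "S (r', c') = Some (u ! k)" using Sk jk len rc rc' by metis+
    have wl: "w ! j = l (u ! j)" "w ! k = l (u ! k)" using w len jk by auto
    show "std_before w j k"
    proof (cases "r < r'")
      case True
      then have "k < j" using before_bs[of k j] jk len rc rc' by (simp add: before_def)
      then show ?thesis using compat_col[OF S jk(3) True] wl by (auto simp: std_before_def col_le_def)
    next
      case False
      have "before (bs ! j) (bs ! k)"
      proof (cases "r = r'")
        case True
        have "c < c'"
        proof (rule ccontr)
          assume "\<not> c < c'"
          then have "u ! k < u ! j \<or> (r, c) = (r', c')" using S_less[OF S(2,1)] True by auto
          then show False using jk(3) S by auto
        qed
        then show ?thesis using True rc rc' by (simp add: before_def)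
      qed (use False rc rc' in \<open>simp add: before_def\<close>)
      then have "j < k" using before_bs jk len by simp
      then show ?thesis using compat_row[OF S jk(3)] False wl by (auto simp: std_before_def row_le_def)
    qed
  qed (use len set_u in auto)
  then show "std_entries T = S"
  proof -
    have "std_entries T b = S b" for b
    proof (cases "b \<in> set bs")
      case True
      then obtain k where k: "k < length bs" "bs ! k = b" by (auto simp: in_set_conv_nth)
      then show ?thesis using std_entries_nth[of k T] Sk[OF k(1)] \<open>std w = u\<close> by (simp add: bs_def w_def)
    next
      case False
      then have "b \<notin> dom (std_entries T)" "b \<notin> dom S" using set_bs by (auto simp: dom_std_entries bs_def)
      then show ?thesis by (metis domIff)
    qed
    then show ?thesis by blast
  qed
  show "tableau T"
    unfolding tableau_def
  proof (intro conjI allI impI ballI)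
    show "skew_filling T" using shape dom by (auto simp: skew_filling_def T_def dom_def)
    show "canon (reading_word T) = reading_word T" using canon_w by (simp add: w_def)
    show "1 \<le> index a" if "a \<in> ran (entry T)" for a
      using that pos by (auto simp: T_def ran_def)
  next
    fix r c c' a b
    assume *: "c < c' \<and> entry T (r, c) = Some a \<and> entry T (r, c') = Some b"
    then obtain u v where "S (r, c) = Some u" "S (r, c') = Some v" "a = l u" "b = l v" by (auto simp: T_def)
    then have "row_le a b" using row_letters * by blast
    then show "a \<le> b" "a = b \<Longrightarrow> \<not> primed a" by (auto simp: row_le_def)
  next
    fix r r' c a b
    assume *: "r < r' \<and> entry T (r, c) = Some a \<and> entry T (r', c) = Some b"
    then obtain u v where "S (r, c) = Some u" "S (r', c) = Some v" "a = l u" "b = l v" by (auto simp: T_def)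
    then have "col_le a b" using col_letters * by blast
    then show "a \<le> b" "a = b \<Longrightarrow> primed a" by (auto simp: col_le_def)
  qed
qed

section \<open>Slides of tableaux\<close>

lemma reading_word_letters:
  assumes T: "tableau T" and S: "\<And>b. entry T b = map_option l (S b)"
    and N: "diagram (outer T) \<subseteq> {..<N} \<times> {..<N}" "length (outer T) < N"
  shows "reading_word T = map l (reading N S)"
proof -
  have "dom S = dom (entry T)" using S by (auto simp: dom_def)
  moreover have sf: "skew_filling T" using T by (simp add: tableau_def)
  ultimately have "dom S = diagram (outer T) - diagram (inner T)" by (simp add: skew_filling_def)
  then have "reading N S = map (\<lambda>b. the (S b)) (reading_boxes T)"
    using map_reading_boxes[of T S N] sf N by (simp add: skew_filling_def)
  moreover have "the (entry T b) = l (the (S b))" if "b \<in> set (reading_boxes T)" for b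
    using that tableau_reading_boxes[OF T] S[of b] by (cases "S b") auto
  ultimately show ?thesis by (simp add: reading_word_def)
qed

text \<open>The weight depends only on which numbers occur and on the indices of their labels, not
  on the boxes; both are preserved by \<open>slide_path\<close>.\<close>

lemma wt_reading_word:
  assumes T: "tableau T" and S: "\<And>b. entry T b = map_option l (S b)" and inj: "inj_on S (dom S)"
  shows "wt (reading_word T) i = card {v \<in> ran S. index (l v) = i}"
proof -
  define u where "u = map (\<lambda>b. the (S b)) (reading_boxes T)"
  have set: "set (reading_boxes T) = dom S"
    using tableau_reading_boxes[OF T] S by (auto simp: dom_def)
  have "the (entry T b) = l (the (S b))" if "b \<in> set (reading_boxes T)" for b
    using that set S[of b] by (cases "S b") auto
  then have "reading_word T = map l u"
    unfolding reading_word_def u_def by simp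
  then have "wt (reading_word T) i = length (filter (\<lambda>v. index (l v) = i) u)"
    by (simp add: wt_def filter_map comp_def)
  moreover have "distinct u"
  proof -
    have "inj_on (\<lambda>b. the (S b)) (dom S)"
      by (rule inj_onI, rule inj_onD[OF inj]) auto
    then show ?thesis using set by (simp add: u_def distinct_map distinct_reading_boxes)
  qed
  moreover have "set u = ran S"
  proof -
    have "set u = (\<lambda>b. the (S b)) ` dom S" by (simp add: u_def set)
    then show ?thesis by (force simp: ran_def image_iff)
  qed
  ultimately show ?thesis
    using distinct_card[of "filter (\<lambda>v. index (l v) = i) u"] by simp
qed

text \<open>At the end the boxes right of and below the hole are not filled. They could also be
  boxes of the inner shape, but then the hole would belong to it as well, inner shapes being closed
  towards the upper left.\<close>

lemma slide_tableau_end: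
  assumes T: "tableau T" and e: "e \<in> diagram (inner T)"
    and mu: "strict_partition mu" "diagram mu = diagram (inner T) - {e}"
    and path: "jdt_path (std_entries T) e S' e'"
  shows "e' \<in> diagram (outer T) - diagram mu" "dom S' = diagram (outer T) - diagram mu - {e'}"
    "(fst e', Suc (snd e')) \<notin> diagram (outer T)" "(Suc (fst e'), snd e') \<notin> diagram (outer T)"
proof -
  define D where "D = diagram (outer T) - diagram mu"
  have sf: "strict_partition (outer T)" "diagram (inner T) \<subseteq> diagram (outer T)"
    "dom (entry T) = diagram (outer T) - diagram (inner T)"
    using T by (auto simp: tableau_def skew_filling_def)
  have convex: "convex_shape D" unfolding D_def by (rule convex_skew_diagram[OF sf(1) mu(1)])
  moreover have "e \<in> D" "dom (entry T) = D - {e}" using e sf mu(2) by (auto simp: D_def)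
  ultimately obtain l where l: "slide_state D (std_entries T) e l"
    and "\<And>b. entry T b = map_option l (std_entries T b)"
    using tableau_slide_state[OF T, of D e] by blast
  obtain N where N: "diagram (outer T) \<subseteq> {..<N} \<times> {..<N}" using diagram_bound by blast
  have DN: "D \<subseteq> {..<N} \<times> {..<N}" using N by (auto simp: D_def)
  from slide_path[OF path l DN] obtain l' where l': "slide_state D S' e' l'"
    and stop: "S' (fst e', Suc (snd e')) = None" "S' (Suc (fst e'), snd e') = None"
    by blast
  interpret slide_state D S' e' l' by fact
  obtain r c where rc: "e' = (r, c)" by (cases e')
  have outside: "b \<notin> diagram (outer T)" if b: "S' b = None" "b \<noteq> e'" "fst b \<ge> r" "snd b \<ge> c" for b
  proof
    assume "b \<in> diagram (outer T)"
    moreover have "b \<notin> D" using b dom_S by auto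
    ultimately have "b \<in> diagram mu" by (simp add: D_def)
    moreover have "1 \<le> r" "r \<le> c" using hole D_bounds rc by auto
    ultimately have "(r, c) \<in> diagram mu" using diagram_ideal[OF mu(1), of "fst b" "snd b" r c] b by simp
    then show False using hole rc by (simp add: D_def)
  qed
  show "e' \<in> diagram (outer T) - diagram mu" "dom S' = diagram (outer T) - diagram mu - {e'}"
    using hole dom_S by (simp_all add: D_def)
  show "(fst e', Suc (snd e')) \<notin> diagram (outer T)" "(Suc (fst e'), snd e') \<notin> diagram (outer T)"
    using stop outside rc by auto
qed

lemma slide_tableau:
  assumes T: "tableau T" and e: "e \<in> diagram (inner T)"
    and mu: "strict_partition mu" "diagram mu = diagram (inner T) - {e}"
    and lam: "strict_partition lam" "diagram lam = diagram (outer T) - {e'}"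
    and path: "jdt_path (std_entries T) e S' e'"
  shows "\<exists>T'. tableau T' \<and> outer T' = lam \<and> inner T' = mu \<and> std_entries T' = S' \<and>
    wt (reading_word T') = wt (reading_word T) \<and>
    (\<forall>i. foldl (pair_step i) (0, 0) (reading_word T') = foldl (pair_step i) (0, 0) (reading_word T))"
proof -
  define D where "D = diagram (outer T) - diagram mu"
  have sf: "strict_partition (outer T)" "diagram (inner T) \<subseteq> diagram (outer T)"
    "dom (entry T) = diagram (outer T) - diagram (inner T)"
    using T by (auto simp: tableau_def skew_filling_def)
  have convex: "convex_shape D" unfolding D_def by (rule convex_skew_diagram[OF sf(1) mu(1)])
  moreover have D_e: "e \<in> D" "dom (entry T) = D - {e}" using e sf mu(2) by (auto simp: D_def)
  ultimately obtain l where l: "slide_state D (std_entries T) e l"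
    and entry: "\<And>b. entry T b = map_option l (std_entries T b)"
    using tableau_slide_state[OF T, of D e] by blast
  interpret S: slide_state D "std_entries T" e l by fact
  obtain N where N: "N > length (outer T) + length lam" "diagram (outer T) \<subseteq> {..<N} \<times> {..<N}"
    using diagram_bound by blast
  have DN: "D \<subseteq> {..<N} \<times> {..<N}" using N by (auto simp: D_def)
  from slide_path[OF path l DN] obtain l' where l': "slide_state D S' e' l'" and idx: "\<And>v. index (l' v) = index (l v)"
    and ran: "ran S' = ran (std_entries T)"
    and walk: "\<And>i. foldl (pair_step i) (0, 0) (map l' (reading N S'))
      = foldl (pair_step i) (0, 0) (map l (reading N (std_entries T)))"
    by blast
  interpret S': slide_state D S' e' l' by fact
  define T' where "T' = Filling lam mu (\<lambda>b. map_option l' (S' b))"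
  have dom: "dom S' = diagram lam - diagram mu" using S'.dom_S lam(2) by (auto simp: D_def)
  have "finite D" using finite_diagram by (simp add: D_def)
  then have "card (dom S') = card (dom (std_entries T))"
    using S'.dom_S S.dom_S S'.hole S.hole by simp
  moreover have "card (dom (std_entries T)) = length (reading_boxes T)"
    by (simp add: dom_std_entries distinct_card distinct_reading_boxes)
  ultimately have ran': "ran S' = {1..card (dom S')}" using ran ran_std_entries by simp
  have pos: "1 \<le> index (l' v)" if v: "v \<in> ran S'" for v
  proof -
    have "v \<in> ran (std_entries T)" using v ran by simp
    then obtain b where "std_entries T b = Some v" by (auto simp: ran_def)
    then have "l v \<in> ran (entry T)" using entry[of b] by (auto intro: ranI)
    then show ?thesis using T idx by (simp add: tableau_def)
  qed
  have sub: "diagram mu \<subseteq> diagram lam"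
    using mu(2) sf(2) lam(2) S'.hole by (auto simp: D_def)
  have T': "tableau T'" "std_entries T' = S'"
    using slide_state_tableau[OF l' lam(1) mu(1) sub dom ran' pos] by (simp_all add: T'_def)
  have word: "reading_word T = map l (reading N (std_entries T))"
    using reading_word_letters[OF T entry] N by simp
  have word': "reading_word T' = map l' (reading N S')"
    by (rule reading_word_letters[OF T'(1)]) (use N lam in \<open>auto simp: T'_def\<close>)
  have "wt (reading_word T') i = wt (reading_word T) i" for i
    using wt_reading_word[OF T entry S.inj] wt_reading_word[OF T'(1) _ S'.inj, of l'] idx ran
    by (simp add: T'_def)
  then have "wt (reading_word T') = wt (reading_word T)" by blast
  moreover have "outer T' = lam" "inner T' = mu" by (simp_all add: T'_def)
  ultimately show ?thesis using T' walk word word' by metis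
qed

text \<open>\<open>inner_slide\<close> constrains the letters of \<open>T'\<close> only indirectly.
  The tableau \<open>U\<close> built along the path has a known walk and shares boxes,
  standardization and weight with \<open>T'\<close>, so the two words coincide.\<close>

lemma inner_slide_walk:
  assumes "inner_slide T T'"
  shows "foldl (pair_step i) (0, 0) (reading_word T') = foldl (pair_step i) (0, 0) (reading_word T)"
proof -
  obtain e e' where e: "e \<in> diagram (inner T)" "diagram (inner T') = diagram (inner T) - {e}"
    "diagram (outer T') = diagram (outer T) - {e'}" "jdt_path (std_entries T) e (std_entries T') e'"
    and T: "tableau T" "tableau T'" and wt: "wt (reading_word T') = wt (reading_word T)"
    using assms unfolding inner_slide_def by blast
  have "strict_partition (outer T')" "strict_partition (inner T')"
    using T(2) by (auto simp: tableau_def skew_filling_def)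
  from slide_tableau[OF T(1) e(1) this(2) e(2) this(1) e(3,4)]
  obtain U where U: "tableau U" "outer U = outer T'" "inner U = inner T'" "std_entries U = std_entries T'"
    "wt (reading_word U) = wt (reading_word T)"
    "\<And>i. foldl (pair_step i) (0, 0) (reading_word U) = foldl (pair_step i) (0, 0) (reading_word T)"
    by blast
  have boxes: "reading_boxes U = reading_boxes T'" using U by (simp add: reading_boxes_def)
  have "std (reading_word U) = std (reading_word T')"
  proof (rule nth_equalityI)
    fix k assume "k < length (std (reading_word U))"
    then have "k < length (reading_boxes U)" by simp
    then show "std (reading_word U) ! k = std (reading_word T') ! k"
      using std_entries_nth[of k U] std_entries_nth[of k T'] boxes U(4) by simp
  qed (simp add: boxes)
  then have "reading_word U = reading_word T'"
    using U(1,5) T(2) wt by - (rule word_determined, simp_all add: tableau_def)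
  then show ?thesis using U(6) by simp
qed

lemma inner_slide_exists:
  assumes T: "tableau T" and "inner T \<noteq> []"
  shows "\<exists>T'. inner_slide T T' \<and> card (diagram (inner T')) < card (diagram (inner T))"
proof -
  have sf: "strict_partition (outer T)" "strict_partition (inner T)" "diagram (inner T) \<subseteq> diagram (outer T)"
    "dom (entry T) = diagram (outer T) - diagram (inner T)"
    using T by (auto simp: tableau_def skew_filling_def)
  define k where "k = length (inner T)"
  \<comment> \<open>The end of the last row of the inner shape is always a removable corner.\<close>
  define e where "e = (k, k + part (inner T) k - 1)"
  have k: "1 \<le> k" using assms(2) by (simp add: k_def Suc_le_eq)
  have pos: "0 < part (inner T) k" using part_pos[OF sf(2) k] by (simp add: k_def)
  have e: "e \<in> diagram (inner T)" using k pos by (auto simp: e_def diagram_iff)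
  have "\<exists>mu. strict_partition mu \<and> diagram mu = diagram (inner T) - {e}"
    unfolding e_def
  proof (rule remove_corner[OF sf(2)])
    show "(k, k + part (inner T) k - 1) \<in> diagram (inner T)" using e by (simp add: e_def)
    show "(k, Suc (k + part (inner T) k - 1)) \<notin> diagram (inner T)" using pos by (simp add: diagram_iff)
    show "(Suc k, k + part (inner T) k - 1) \<notin> diagram (inner T)" by (simp add: diagram_def k_def)
  qed
  then obtain mu where mu: "strict_partition mu" "diagram mu = diagram (inner T) - {e}" by blast
  define D where "D = diagram (outer T) - diagram mu"
  have "convex_shape D" unfolding D_def by (rule convex_skew_diagram[OF sf(1) mu(1)])
  moreover have "e \<in> D" "dom (entry T) = D - {e}" using e sf mu(2) by (auto simp: D_def)
  ultimately obtain l where l: "slide_state D (std_entries T) e l"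
    and "\<And>b. entry T b = map_option l (std_entries T b)"
    using tableau_slide_state[OF T, of D e] by blast
  obtain N where N: "diagram (outer T) \<subseteq> {..<N} \<times> {..<N}" using diagram_bound by blast
  have DN: "D \<subseteq> {..<N} \<times> {..<N}" using N by (auto simp: D_def)
  from slide_path_exists[OF l DN] obtain S' e' where path: "jdt_path (std_entries T) e S' e'" by blast
  note stop = slide_tableau_end[OF T e mu path]
  obtain r c where rc: "e' = (r, c)" by (cases e')
  obtain lam where lam: "strict_partition lam" "diagram lam = diagram (outer T) - {e'}"
    using remove_corner[OF sf(1), of r c] stop rc by auto
  from slide_tableau[OF T e mu lam path]
  obtain T' where T': "tableau T'" "outer T' = lam" "inner T' = mu" "std_entries T' = S'"
    "wt (reading_word T') = wt (reading_word T)"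
    by blast
  have "inner_slide T T'"
    unfolding inner_slide_def using T T' e mu lam path by blast
  moreover have "card (diagram (inner T')) < card (diagram (inner T))"
    using card_Diff1_less[OF finite_diagram e] mu(2) T'(3) by (simp del: card_Diff_singleton card_Diff_insert)
  ultimately show ?thesis by blast
qed

lemma rectification_exists:
  "tableau T \<Longrightarrow> \<exists>R. inner_slide\<^sup>*\<^sup>* T R \<and> inner R = []"
proof (induction "card (diagram (inner T))" arbitrary: T rule: less_induct)
  case less
  show ?case
  proof (cases "inner T = []")
    case False
    then obtain T' where T': "inner_slide T T'" "card (diagram (inner T')) < card (diagram (inner T))"
      using inner_slide_exists less.prems by blast
    then have "tableau T'" by (simp add: inner_slide_def)
    then obtain R where "inner_slide\<^sup>*\<^sup>* T' R" "inner R = []" using less.hyps[OF T'(2)] by blast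
    then show ?thesis using T'(1) by (meson converse_rtranclp_into_rtranclp)
  qed blast
qed

lemma slides_invariant:
  assumes "inner_slide\<^sup>*\<^sup>* T R" "tableau T"
  shows "tableau R \<and> wt (reading_word R) = wt (reading_word T) \<and>
    (\<forall>i. foldl (pair_step i) (0, 0) (reading_word R) = foldl (pair_step i) (0, 0) (reading_word T))"
  using assms
proof (induction rule: rtranclp_induct)
  case (step R R')
  then show ?case using inner_slide_walk[OF step(2)] by (auto simp: inner_slide_def)
qed simp

text \<open>The boxes lie in distinct rows and distinct columns: row \<open>r\<close> has the single box in column
  \<open>2 m - r + 1\<close>.\<close>
lemma tableau_of_word:
  assumes w: "w \<in> words n"
  shows "\<exists>T. tableau T \<and> reading_word T = w"
proof -
  define m where "m = length w"
  define lam where "lam = map (\<lambda>r. 2 * (m - r) + 2) [1..<Suc m]"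
  define mu where "mu = map (\<lambda>r. 2 * (m - r) + 1) [1..<Suc m]"
  define f where "f = (\<lambda>(r, c). if 1 \<le> r \<and> r \<le> m \<and> c = r + (2 * (m - r) + 1) then Some (w ! (m - r)) else None)"
  define T where "T = Filling lam mu f"
  have nth: "lam ! i = 2 * (m - Suc i) + 2" "mu ! i = 2 * (m - Suc i) + 1" if "i < m" for i
    using that by (simp_all add: lam_def mu_def del: upt_Suc)
  have len: "length lam = m" "length mu = m" by (simp_all add: lam_def mu_def)
  have part: "part lam r = (if 1 \<le> r \<and> r \<le> m then 2 * (m - r) + 2 else 0)"
    "part mu r = (if 1 \<le> r \<and> r \<le> m then 2 * (m - r) + 1 else 0)" for r
    using nth[of "r - 1"] len by (auto simp: part_def)
  have strict: "strict_partition lam" "strict_partition mu"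
    unfolding strict_partition_iff len using nth by auto
  have f_Some: "f (r, c) = Some a \<longleftrightarrow> 1 \<le> r \<and> r \<le> m \<and> c = r + (2 * (m - r) + 1) \<and> a = w ! (m - r)" for r c a
    by (auto simp: f_def)
  have sf: "skew_filling T"
  proof -
    have "diagram mu \<subseteq> diagram lam" by (auto simp: diagram_iff part split: if_splits)
    moreover have "(r, c) \<in> dom f \<longleftrightarrow> (r, c) \<in> diagram lam - diagram mu" for r c
      by (auto simp: dom_def f_def diagram_iff part split: if_splits)
    ultimately show ?thesis using strict by (auto simp: skew_filling_def T_def)
  qed
  have boxes: "reading_boxes T = map (\<lambda>r. (r, r + (2 * (m - r) + 1))) (rev [1..<Suc m])"
  proof -
    have "map (Pair r) [r + part mu r..<r + part lam r] = [(r, r + (2 * (m - r) + 1))]"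
      if "r \<in> set (rev [1..<Suc m])" for r
    proof -
      have "r + part lam r = Suc (r + part mu r)" "part mu r = 2 * (m - r) + 1"
        using that part by (auto simp del: upt_Suc)
      then show ?thesis by simp
    qed
    then have rows: "map (\<lambda>r. map (Pair r) [r + part mu r..<r + part lam r]) (rev [1..<Suc m]) =
        map (\<lambda>r. [(r, r + (2 * (m - r) + 1))]) (rev [1..<Suc m])"
      by (intro map_cong refl)
    have singles: "concat (map (\<lambda>r. [g r]) xs) = map g xs" for g :: "nat \<Rightarrow> box" and xs
      by (induction xs) auto
    show ?thesis
      unfolding reading_boxes_def T_def filling.sel len rows by (rule singles)
  qed
  have word: "reading_word T = w"
  proof (rule nth_equalityI)
    have len_boxes: "length (reading_boxes T) = m" by (simp add: boxes del: upt_Suc)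
    then show "length (reading_word T) = length w" by (simp add: m_def)
    fix k assume "k < length (reading_word T)"
    then have k: "k < m" by (simp add: len_boxes)
    then have "rev [1..<Suc m] ! k = m - k" by (simp add: rev_nth del: upt_Suc)
    then have "reading_boxes T ! k = (m - k, m - k + (2 * k + 1))" using k by (simp add: boxes del: upt_Suc)
    moreover have "f (m - k, m - k + (2 * k + 1)) = Some (w ! k)" using k by (auto simp: f_def)
    moreover have "k < length (reading_boxes T)" using k len_boxes by simp
    ultimately show "reading_word T ! k = w ! k" by (simp add: reading_word_def T_def)
  qed
  have "tableau T"
    unfolding tableau_def
  proof (intro conjI allI impI ballI)
    show "canon (reading_word T) = reading_word T" using w word by (simp add: words_def)
    show "1 \<le> index a" if a: "a \<in> ran (entry T)" for a
    proof -
      obtain r c where "f (r, c) = Some a" using a by (auto simp: T_def ran_def)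
      then have "a = w ! (m - r)" "m - r < length w" by (auto simp: f_Some m_def)
      then have "a \<in> set w" by simp
      then show ?thesis using w by (auto simp: words_def alphabet_def)
    qed
  qed (use sf in \<open>auto simp: T_def f_Some\<close>)
  then show ?thesis using word by blast
qed

section \<open>Tableaux of straight shape\<close>

lemma canonical_entry:
  assumes T: "tableau T" "entry T b = Some a" "primed a"
  obtains b' a' where "before b' b" "entry T b' = Some a'" "index a' = index a"
proof -
  have "b \<in> set (reading_boxes T)" using T tableau_reading_boxes by blast
  then obtain k where k: "k < length (reading_boxes T)" "reading_boxes T ! k = b" by (auto simp: in_set_conv_nth)
  have a: "reading_word T ! k = a" using reading_word_nth[OF T(1) k(1)] T(2) k(2) by simp
  have "canon (reading_word T) = reading_word T" using T(1) by (simp add: tableau_def)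
  then obtain j where j: "j < k" "index (reading_word T ! j) = index a"
    using k(1) a T(3) canon_iff[of "reading_word T"] by auto
  have "before (reading_boxes T ! j) b" using reading_boxes_before[of j T k] j(1) k by simp
  moreover have "entry T (reading_boxes T ! j) = Some (reading_word T ! j)"
    using reading_word_nth[OF T(1), of j] j(1) k(1) by simp
  ultimately show ?thesis using that j(2) by blast
qed

locale straight_tableau =
  fixes T :: "letter filling"
  assumes tableau: "tableau T" and straight: "inner T = []"
begin

lemma strict: "strict_partition (outer T)"
  using tableau by (simp add: tableau_def skew_filling_def)

lemma dom_entry: "dom (entry T) = diagram (outer T)"
proof -
  have "diagram [] = {}" by (auto simp: diagram_def)
  then show ?thesis using tableau straight by (simp add: tableau_def skew_filling_def)
qed

lemma entry_obtain: "b \<in> diagram (outer T) \<Longrightarrow> \<exists>a. entry T b = Some a"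
  using dom_entry by auto

lemma entry_bounds: "entry T (r, c) = Some a \<Longrightarrow> (r, c) \<in> diagram (outer T) \<and> 1 \<le> r \<and> r \<le> c"
  using dom_entry diagram_iff by blast

lemma row_entries: "entry T (r, c) = Some a \<Longrightarrow> entry T (r, c') = Some b \<Longrightarrow> c < c' \<Longrightarrow> row_le a b"
  using tableau unfolding tableau_def row_le_def by (metis le_less)

lemma col_entries: "entry T (r, c) = Some a \<Longrightarrow> entry T (r', c) = Some b \<Longrightarrow> r < r' \<Longrightarrow> col_le a b"
  using tableau unfolding tableau_def col_le_def by (metis le_less)

lemma below_diagonal_entry:
  assumes "entry T (k, k) = Some a" "entry T (r, c) = Some b" "k < r"
  shows "index a < index b"
proof -
  have "(k, c) \<in> diagram (outer T)"
    using diagram_ideal[OF strict, of r c k c] entry_bounds[OF assms(1)] entry_bounds[OF assms(2)] assms(3) by simp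
  then obtain m where m: "entry T (k, c) = Some m" using entry_obtain by blast
  have "row_le a m" using row_entries[OF assms(1) m] entry_bounds[OF assms(2)] assms(3) by simp
  moreover have "col_le m b" using col_entries[OF m assms(2,3)] .
  ultimately show ?thesis by (rule row_col_index_less)
qed

text \<open>Indices increase strictly from the diagonal entry of a row to any entry of the next row,
  and they start at 1 or more.\<close>

lemma row_le_index_entry: "entry T (r, c) = Some a \<Longrightarrow> r \<le> index a"
proof (induction r arbitrary: c a)
  case (Suc r)
  show ?case
  proof (cases "r = 0")
    case True
    then show ?thesis using Suc.prems tableau by (auto simp: tableau_def ran_def)
  next
    case False
    then have "(r, r) \<in> diagram (outer T)"
      using diagram_ideal[OF strict, of "Suc r" c r r] entry_bounds[OF Suc.prems] by simp
    then obtain d where d: "entry T (r, r) = Some d" using entry_obtain by blast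
    then show ?thesis using Suc.IH[OF d] below_diagonal_entry[OF d Suc.prems] by simp
  qed
qed simp

text \<open>A prime on such an entry would pass to the diagonal entry of row \<open>r\<close>, the
  smallest of the row. Canonicity then asks for an earlier letter of index \<open>r\<close>, hence
  one in a lower row, where all indices exceed \<open>r\<close>.\<close>

lemma unprimed_if_index_eq_row:
  assumes a: "entry T (r, c) = Some a" and r: "index a = r"
  shows "\<not> primed a"
proof
  assume p: "primed a"
  have "(r, r) \<in> diagram (outer T)"
    using diagram_ideal[OF strict, of r c r r] entry_bounds[OF a] by simp
  then obtain d where d: "entry T (r, r) = Some d" using entry_obtain by blast
  have "d \<le> a"
  proof (cases "c = r")
    case False
    then have "row_le d a" using row_entries[OF d a] entry_bounds[OF a] by simp
    then show ?thesis by (auto simp: row_le_def)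
  qed (use a d in simp)
  then have "index d = r" "primed d"
    using row_le_index_entry[OF d] r p by (auto simp: less_eq_letter_def)
  obtain b a' where b: "before b (r, r)" "entry T b = Some a'" "index a' = index d"
    using canonical_entry[OF tableau d \<open>primed d\<close>] .
  obtain r' c' where rc: "b = (r', c')" by (cases b)
  have "r < r'" using b(1) entry_bounds[of r' c' a'] b(2) rc by (auto simp: before_def)
  then show False using row_le_index_entry[of r' c' a'] b rc \<open>index d = r\<close> by simp
qed

text \<open>Just after an \<open>i + 1\<close> the ordinate is positive: the step goes up, or it
  goes left from a point off the axes. Only a letter \<open>i\<close> or \<open>i'\<close> could
  lower it again.\<close>

lemma walk_zero_later:
  assumes "snd (foldl (pair_step i) s (u @ a # v)) = 0" "index a = Suc i"
  shows "\<exists>b \<in> set v. index b = i"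
proof (rule ccontr)
  assume *: "\<not> (\<exists>b \<in> set v. index b = i)"
  have step: "snd s \<le> snd (pair_step i s b)" if "index b \<noteq> i" for s b
    using that by (cases s; cases b) auto
  have mono: "snd s \<le> snd (foldl (pair_step i) s v)" for s
    using *
  proof (induction v arbitrary: s)
    case (Cons b v)
    have "snd s \<le> snd (pair_step i s b)" using Cons.prems by (intro step) simp
    also have "\<dots> \<le> snd (foldl (pair_step i) (pair_step i s b) v)" using Cons by simp
    finally show ?case by simp
  qed simp
  have "0 < snd (pair_step i s a)" for s
    using assms(2) by (cases s; cases a) auto
  then show False using assms(1) mono by (metis foldl_Cons foldl_append not_less)
qed

text \<open>An entry \<open>i + 1\<close> above row \<open>i + 1\<close> would be followed in the reading word by an entry \<open>i\<close>, which by
  induction lies in row \<open>i\<close>, hence to its right in the same row.\<close>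
lemma index_eq_row:
  assumes bound: "\<And>a. a \<in> ran (entry T) \<Longrightarrow> index a \<le> n"
    and walk: "\<And>i. i \<in> {1..<n} \<Longrightarrow> snd (foldl (pair_step i) (0, 0) (reading_word T)) = 0"
  shows "entry T (r, c) = Some a \<Longrightarrow> index a \<le> i \<Longrightarrow> index a = r"
proof (induction i arbitrary: r c a)
  case 0
  then show ?case using row_le_index_entry[OF 0(1)] entry_bounds[OF 0(1)] by simp
next
  case (Suc i)
  show ?case
  proof (rule ccontr)
    assume neq: "index a \<noteq> r"
    then have ia: "index a = Suc i" "r \<le> i" using Suc row_le_index_entry[OF Suc.prems(1)] by force+
    have "a \<in> ran (entry T)" using Suc.prems(1) by (rule ranI)
    then have i: "i \<in> {1..<n}" using bound[of a] ia entry_bounds[OF Suc.prems(1)] by simp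
    obtain k where k: "k < length (reading_boxes T)" "reading_boxes T ! k = (r, c)"
      using Suc.prems(1) tableau_reading_boxes[OF tableau] by (metis domI in_set_conv_nth)
    have wk: "reading_word T ! k = a" using reading_word_nth[OF tableau k(1)] k(2) Suc.prems(1) by simp
    have "reading_word T = take k (reading_word T) @ a # drop (Suc k) (reading_word T)"
      using k(1) wk by (metis id_take_nth_drop length_reading_word)
    then obtain b where "b \<in> set (drop (Suc k) (reading_word T))" "index b = i"
      using walk_zero_later[of i "(0, 0)" "take k (reading_word T)" a] walk[OF i] ia(1) by metis
    then obtain m where m: "m < length (drop (Suc k) (reading_word T))" "drop (Suc k) (reading_word T) ! m = b"
      by (auto simp: in_set_conv_nth)
    define j where "j = Suc k + m"
    have j: "k < j" "j < length (reading_boxes T)" "reading_word T ! j = b"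
      using m by (simp_all add: j_def)
    obtain r' c' where rc': "reading_boxes T ! j = (r', c')" by (cases "reading_boxes T ! j")
    have b: "entry T (r', c') = Some b" using reading_word_nth[OF tableau j(2)] rc' j(3) by simp
    then have "r' = i" using Suc.IH[OF b] \<open>index b = i\<close> by simp
    moreover have "before (r, c) (r', c')" using reading_boxes_before[of k T j] k j rc' by simp
    ultimately have "r' = r" "c < c'" using ia(2) by (auto simp: before_def)
    then have "row_le a b" using row_entries[OF Suc.prems(1)] b by simp
    then show False using row_le_index ia(1) \<open>index b = i\<close> by fastforce
  qed
qed

lemma length_row:
  assumes "diagram (outer T) \<subseteq> {..<N} \<times> {..<N}" "1 \<le> k"
  shows "length (row_segment (entry T) k 0 N) = part (outer T) k"
proof -
  have "length (row_segment (entry T) k 0 N) = card (set (filter (\<lambda>j. entry T (k, j) \<noteq> None) [0..<N]))"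
    by (simp add: row_segment_def List.map_filter_def distinct_card del: set_filter)
  also have "set (filter (\<lambda>j. entry T (k, j) \<noteq> None) [0..<N]) = {k..<k + part (outer T) k}"
  proof -
    have "entry T (k, j) \<noteq> None \<longleftrightarrow> (k, j) \<in> diagram (outer T)" for j using dom_entry by auto
    then have "set (filter (\<lambda>j. entry T (k, j) \<noteq> None) [0..<N]) = {j. j < N \<and> (k, j) \<in> diagram (outer T)}"
      by auto
    also have "\<dots> = {j. (k, j) \<in> diagram (outer T)}" using assms(1) by auto
    also have "\<dots> = {k..<k + part (outer T) k}" using assms(2) by (auto simp: diagram_iff)
    finally show ?thesis .
  qed
  finally show ?thesis by simp
qed

text \<open>The first \<open>i\<close> leaves the y-axis and the next \<open>b\<close> lower the
  ordinate to 0, so \<open>b + 1\<close> letters suffice; from then on the walk runs along the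
  x-axis.\<close>

lemma walk_ones:
  "b < a \<or> b = 0 \<Longrightarrow> snd (foldl (pair_step i) (0, b) (replicate a (Letter i False))) = 0"
proof -
  have pos: "y \<le> k \<Longrightarrow> 0 < x \<Longrightarrow> snd (foldl (pair_step i) (x, y) (replicate k (Letter i False))) = 0" for k x y
  proof (induction k arbitrary: x y)
    case (Suc k)
    then show ?case by (cases y) auto
  qed simp
  assume "b < a \<or> b = 0"
  then show ?thesis using pos[of b "a - 1" 1] by (cases a) auto
qed

lemma walk_if_rows_constant:
  assumes rows: "\<And>r c a. entry T (r, c) = Some a \<Longrightarrow> a = Letter r False" and i: "1 \<le> i"
  shows "snd (foldl (pair_step i) (0, 0) (reading_word T)) = 0"
proof -
  obtain N where N: "Suc i + length (outer T) < N" "diagram (outer T) \<subseteq> {..<N} \<times> {..<N}"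
    using diagram_bound by blast
  define row where "row k = row_segment (entry T) k 0 N" for k
  have "map (\<lambda>b. the (entry T b)) (reading_boxes T) = reading N (entry T)"
    by (rule map_reading_boxes) (use strict straight dom_entry N in \<open>auto simp: strict_partition_def diagram_def\<close>)
  then have word: "reading_word T = concat (map row (rev [Suc (Suc i)..<N])) @ row (Suc i) @ row i @ concat (map row (rev [0..<i]))"
    using reading_rows[of i N "entry T"] N by (simp add: reading_word_def row_def[abs_def])
  have row: "a = Letter k False" if "a \<in> set (row k)" for a k
    using that rows by (auto simp: row_def set_row_segment)
  have low: "foldl (pair_step i) s (concat (map row (rev [Suc (Suc i)..<N]))) = s" for s
    using row by (intro walk_inert) fastforce
  have high: "foldl (pair_step i) s (concat (map row (rev [0..<i]))) = s" for s
    using row by (intro walk_inert) fastforce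
  have "row i = replicate (length (row i)) (Letter i False)"
    using row by (intro replicate_eqI[symmetric, THEN sym]) auto
  then have row_i: "row i = replicate (part (outer T) i) (Letter i False)"
    using length_row[OF N(2) i] by (simp add: row_def)
  have all: "filter (\<lambda>a. index a = Suc i) (row (Suc i)) = row (Suc i)"
    by (rule filter_True) (use row in fastforce)
  have "foldl (pair_step i) (0, 0) (row (Suc i)) = (0, part (outer T) (Suc i))"
  proof -
    have "index a \<noteq> i" if "a \<in> set (row (Suc i))" for a using row[OF that] by simp
    then have "foldl (pair_step i) (0, 0) (row (Suc i)) = (0, length (row (Suc i)))"
      using walk_y_axis[of "row (Suc i)" i 0] all by simp
    then show ?thesis using length_row[OF N(2), of "Suc i"] by (simp add: row_def)
  qed
  moreover have "part (outer T) (Suc i) < part (outer T) i \<or> part (outer T) (Suc i) = 0"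
    using part_less[OF strict i, of "Suc i"] by (cases "Suc i \<le> length (outer T)") (auto simp: part_def)
  ultimately show ?thesis
    using walk_ones[of "part (outer T) (Suc i)" "part (outer T) i" i] by (simp add: word low high row_i)
qed

end

section \<open>The ballot criterion\<close>

lemma ballot_iff_walk:
  assumes w: "w \<in> words n"
  shows "ballot w \<longleftrightarrow> (\<forall>i \<in> {1..<n}. snd (foldl (pair_step i) (0, 0) w) = 0)"
proof -
  define R where "R = rect w"
  have "\<exists>R T. tableau T \<and> reading_word T = w \<and> inner_slide\<^sup>*\<^sup>* T R \<and> inner R = []"
    using tableau_of_word[OF w] rectification_exists by blast
  then have "\<exists>T. tableau T \<and> reading_word T = w \<and> inner_slide\<^sup>*\<^sup>* T R \<and> inner R = []"
    unfolding R_def rect_def by (rule someI_ex)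
  then obtain T where T: "tableau T" "reading_word T = w" "inner_slide\<^sup>*\<^sup>* T R" "inner R = []" by blast
  have R: "tableau R" "wt (reading_word R) = wt w"
    "\<And>i. foldl (pair_step i) (0, 0) (reading_word R) = foldl (pair_step i) (0, 0) w"
    using slides_invariant[OF T(3,1)] T(2) by auto
  interpret straight_tableau R using R(1) T(4) by unfold_locales
  \<comment> \<open>Equality of the weights keeps the indices in \<open>R\<close> within those of
    \<open>w\<close>.\<close>
  have bound: "index a \<le> n" if a: "a \<in> ran (entry R)" for a
  proof -
    obtain b where b: "entry R b = Some a" using a by (auto simp: ran_def)
    then have "b \<in> set (reading_boxes R)" using tableau_reading_boxes[OF R(1)] by auto
    then have "a \<in> set (reading_word R)" using b by (force simp: reading_word_def)
    then have "0 < wt (reading_word R) (index a)" by (auto simp: wt_def filter_empty_conv)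
    then have "\<exists>a' \<in> set w. index a' = index a" using R(2) by (auto simp: wt_def filter_empty_conv)
    then show ?thesis using w by (force simp: words_def alphabet_def)
  qed
  show ?thesis
  proof
    assume "ballot w"
    then have "entry R (r, c) = Some a \<Longrightarrow> a = Letter r False" for r c a
      by (simp add: ballot_def R_def)
    then show "\<forall>i \<in> {1..<n}. snd (foldl (pair_step i) (0, 0) w) = 0"
      using walk_if_rows_constant R(3) by simp
  next
    assume walk: "\<forall>i \<in> {1..<n}. snd (foldl (pair_step i) (0, 0) w) = 0"
    have "a = Letter r False" if a: "entry R (r, c) = Some a" for r c a
    proof -
      have "index a = r"
        using index_eq_row[of n r c a "index a"] bound walk R(3) a by auto
      then show ?thesis using unprimed_if_index_eq_row[OF a] by (cases a) simp
    qed
    then show "ballot w" by (simp add: ballot_def R_def)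
  qed
qed

section \<open>Reflection in the diagonal and the anti-ballot criterion\<close>

lemma walk_end_pair_subword: "walk_end (pair_subword i w) = foldl (pair_step i) (0, 0) w"
  by (simp add: walk_end_def walk_pair_subword)

lemma canon_snoc:
  "canon (u @ [a]) = canon u @ [if \<exists>b \<in> set u. index b = index a then a else Letter (index a) False]"
proof -
  have nth: "(u @ [a]) ! j = u ! j" if "j < length u" for j
    using that by (simp add: nth_append)
  have "(\<exists>j < k. index ((u @ [a]) ! j) = index b) \<longleftrightarrow> (\<exists>j < k. index (u ! j) = index b)"
    if "k \<le> length u" for k b
    by (intro ex_cong1 conj_cong refl) (use nth that in simp)
  moreover have "(\<exists>j < length u. index (u ! j) = index a) \<longleftrightarrow> (\<exists>b \<in> set u. index b = index a)"
    unfolding set_conv_nth by blast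
  ultimately show ?thesis using nth by (simp add: canon_def) blast
qed

text \<open>Passing to canonical form affects only the first letter of each index. Before the first
  \<open>i\<close> the abscissa is 0, before the first \<open>i + 1\<close> the ordinate is 0, so
  that letter is read on an axis, where primes do not matter. The two axis statements are carried
  through the induction for this purpose.\<close>

lemma walk_canon:
  assumes "\<And>a. a \<in> set u \<Longrightarrow> index a \<in> {i, Suc i}"
  shows "foldl (pair_step i) (0, 0) (canon u) = foldl (pair_step i) (0, 0) u \<and>
    ((\<forall>a \<in> set u. index a \<noteq> i) \<longrightarrow> fst (foldl (pair_step i) (0, 0) u) = 0) \<and>
    ((\<forall>a \<in> set u. index a \<noteq> Suc i) \<longrightarrow> snd (foldl (pair_step i) (0, 0) u) = 0)"
  using assms
proof (induction u rule: rev_induct)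
  case (snoc a u)
  obtain x y where xy: "foldl (pair_step i) (0, 0) u = (x, y)" by fastforce
  show ?case
    using snoc.IH snoc.prems xy
    by (cases a rule: letter_cases[of _ i]) (force simp: canon_snoc)+
qed (simp add: canon_def)

lemma eta_in_words: "eta v \<in> words 2"
proof -
  define u where "u = map (\<lambda>a. Letter (if index a = 1 then 2 else 1) (\<not> primed a)) v"
  have len: "length (canon u) = length u" by (simp add: canon_def)
  have idx: "index (canon u ! k) = index (u ! k)" if "k < length u" for k
    using that by (simp add: canon_def)
  have "canon (canon u) = canon u"
    unfolding canon_iff len
  proof (intro allI impI)
    fix k assume k: "k < length u" "primed (canon u ! k)"
    have "canon u ! k = (if \<exists>j < k. index (u ! j) = index (u ! k) then u ! k else Letter (index (u ! k)) False)"
      using k(1) unfolding canon_def by simp blast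
    then have "\<exists>j < k. index (u ! j) = index (u ! k)" using k(2) by (metis letter.sel(2))
    then show "\<exists>j < k. index (canon u ! j) = index (canon u ! k)" using idx k(1) by auto
  qed
  moreover have "1 \<le> index a \<and> index a \<le> 2" if a: "a \<in> set (canon u)" for a
  proof -
    obtain k where "k < length (canon u)" "canon u ! k = a" using a by (auto simp: in_set_conv_nth)
    then have "k < length u" "canon u ! k = a" using len by simp_all
    then have "index a = index (u ! k)" "u ! k \<in> set u" using idx by auto
    then show ?thesis by (auto simp: u_def)
  qed
  ultimately show ?thesis by (auto simp: words_def alphabet_def eta_def u_def)
qed

text \<open>The map \<open>eta\<close> reflects every step of the walk in the diagonal.\<close>
lemma walk_eta:
  assumes v: "\<And>a. a \<in> set v \<Longrightarrow> index a \<in> {1, 2}"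
  shows "snd (foldl (pair_step 1) (0, 0) (eta v)) = fst (foldl (pair_step 1) (0, 0) v)"
proof -
  define flip where "flip a = Letter (if index a = 1 then 2 else 1) (\<not> primed a)" for a
  have flip: "index (flip a) \<in> {1, Suc 1}" for a by (simp add: flip_def)
  have step: "pair_step 1 (y, x) (flip a) = prod.swap (pair_step 1 (x, y) a)" if "index a \<in> {1, 2}" for x y a
    using that by (cases a) (auto simp: flip_def)
  have "foldl (pair_step 1) (prod.swap s) (map flip v) = prod.swap (foldl (pair_step 1) s v)" for s
    using v
  proof (induction v arbitrary: s)
    case (Cons a v)
    have "pair_step 1 (prod.swap s) (flip a) = prod.swap (pair_step 1 s a)"
      using step[of a "snd s" "fst s"] Cons.prems[of a] step[of a "fst s" "snd s"] by (cases s) simp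
    then show ?case using Cons by simp
  qed simp
  from this[of "(0, 0)"] have "foldl (pair_step 1) (0, 0) (map flip v) = prod.swap (foldl (pair_step 1) (0, 0) v)"
    by simp
  moreover have "foldl (pair_step 1) (0, 0) (canon (map flip v)) = foldl (pair_step 1) (0, 0) (map flip v)"
    using walk_canon[of "map flip v" 1] flip by auto
  moreover have "eta v = canon (map flip v)" by (simp add: eta_def flip_def[abs_def])
  ultimately show ?thesis by simp
qed

theorem theorem1p6:
  fixes n :: nat and w :: "letter list"
  assumes "w \<in> words n"
  shows "(ballot w \<longleftrightarrow> (\<forall>i \<in> {1..<n}. snd (walk_end (pair_subword i w)) = 0)) \<and>
         (anti_ballot n w \<longleftrightarrow> (\<forall>i \<in> {1..<n}. fst (walk_end (pair_subword i w)) = 0))"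
proof
  show "ballot w \<longleftrightarrow> (\<forall>i \<in> {1..<n}. snd (walk_end (pair_subword i w)) = 0)"
    using ballot_iff_walk[OF assms] by (simp add: walk_end_pair_subword)
  have "ballot (eta v) \<longleftrightarrow> fst (walk_end v) = 0" if v: "v = pair_subword i w" for v i
  proof -
    have idx: "index a \<in> {1, 2}" if "a \<in> set v" for a
      using that v by (auto simp: pair_subword_def)
    have "{1..<2} = {1::nat}" by auto
    then have "ballot (eta v) \<longleftrightarrow> fst (foldl (pair_step 1) (0, 0) v) = 0"
      using ballot_iff_walk[OF eta_in_words, of v] walk_eta[of v] idx by simp
    \<comment> \<open>The letters of \<open>v\<close> are already 1 and 2, so relabelling them once
      more changes nothing.\<close>
    moreover have "pair_subword 1 v = v"
      using idx unfolding pair_subword_def numeral_2_eq_2 by (auto simp: filter_id_conv intro!: map_idI)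
    ultimately show ?thesis using walk_end_pair_subword[of 1 v] by simp
  qed
  then show "anti_ballot n w \<longleftrightarrow> (\<forall>i \<in> {1..<n}. fst (walk_end (pair_subword i w)) = 0)"
    by (simp add: anti_ballot_def)
qed

end
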